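(* Let $n\geqslant1$, $\mu\in(0,1)$ and $s\geqslant0$. Suppose that $v_0\in H^{s+1}\cap L^1$ and $v_1\in H^{(s-3)_+}\cap L^1$. Then, provided that $P_{v_1}\neq0$, the solution $v$ to the linearized dissipative Boussinesq equation $$\begin{cases}v_{tt}-\Delta v+\Delta^2v+2\mu\Delta^2v_t=0,&x\in\mathbb{R}^n,\ t>0,\\ v(0,x)=v_0(x),\ v_t(0,x)=v_1(x),&x\in\mathbb{R}^n,\end{cases}$$ fulfills the following estimates for large time $t\gg1$: $$\mathcal{D}_n(t)|P_{v_1}|\lesssim\|v(t,\cdot)\|_{L^2}\lesssim\mathcal{D}_n(t)\|(v_0,v_1)\|_{(L^2\cap L^1)^2}$$ and $$t^{-\frac{2s+n}{8}}|P_{v_1}|\lesssim\|v(t,\cdot)\|_{\dot H^{s+1}}\lesssim t^{-\frac{2s+n}{8}}\|(v_0,v_1)\|_{(H^{s+1}\cap L^1)\times(H^{(s-3)_+}\cap L^1)}.$$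
   Context: All function spaces are over $\mathbb{R}^n$ and functions are real-valued. $H^\sigma$, $\dot H^\sigma$ are the inhomogeneous and homogeneous $L^2$-based Sobolev spaces; $(a)_+:=\max\{a,0\}$; intersection and product spaces carry the sum of the norms. $P_g:=\int_{\mathbb{R}^n}g(x)\,\mathrm{d}x$. Define $\mathcal{D}_1(t):=\sqrt t$, $\mathcal{D}_2(t):=\sqrt{\ln t}$ and $\mathcal{D}_n(t):=t^{-\frac{n-2}{8}}$ for $n\geqslant3$. $h\lesssim g$ means $h\leqslant Cg$ with a constant $C>0$ independent of $t$ and of the data; "for large time $t\gg1$" means for all $t\geqslant t_0$ with some sufficiently large $t_0$ (which, for the lower bounds, may depend on the data). The solution $v$ is given in Fourier variables by $\widehat v=\widehat K_0\widehat v_0+\widehat K_1\widehat v_1$ with $$\widehat K_0=\frac{\lambda_+\mathrm{e}^{\lambda_-t}-\lambda_-\mathrm{e}^{\lambda_+t}}{\lambda_+-\lambda_-},\quad \widehat K_1=\frac{\mathrm{e}^{\lambda_+t}-\mathrm{e}^{\lambda_-t}}{\lambda_+-\lambda_-},\quad \lambda_\pm=-\mu|\xi|^4\pm\sqrt{\mu^2|\xi|^8-|\xi|^2-|\xi|^4}$$ (extended by continuity where $\lambda_+=\lambda_-$). *)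

theory Defs
  imports "HOL-Analysis.Analysis"
begin

definition L1 :: "((real ^ 'n) \<Rightarrow> real) set"
  where "L1 = {f. integrable lborel f}"

definition L1_norm :: "((real ^ 'n) \<Rightarrow> real) \<Rightarrow> real"
  where "L1_norm f = (LINT x|lborel. \<bar>f x\<bar>)"

definition L2 :: "((real ^ 'n) \<Rightarrow> 'b :: {banach, second_countable_topology}) set"
  where "L2 = {f. f \<in> borel_measurable lborel \<and> integrable lborel (\<lambda>x. (norm (f x))\<^sup>2)}"

definition L2_norm :: "((real ^ 'n) \<Rightarrow> 'b :: {banach, second_countable_topology}) \<Rightarrow> real"
  where "L2_norm f = sqrt (LINT x|lborel. (norm (f x))\<^sup>2)"

definition mass :: "((real ^ 'n) \<Rightarrow> real) \<Rightarrow> real"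
  where "mass g = (LINT x|lborel. g x)"

(* Unitary normalisation, so that the Sobolev norm of order 0 below is the L2 norm. *)
definition fourier_integral :: "((real ^ 'n) \<Rightarrow> real) \<Rightarrow> real ^ 'n \<Rightarrow> complex"
  where "fourier_integral f \<xi> =
    (1 / sqrt (2 * pi) ^ CARD('n)) *\<^sub>R (LINT x|lborel. f x *\<^sub>R cis (- (x \<bullet> \<xi>)))"

(* The Fourier-Plancherel transform of an L2 function, as the limit in L2 of the Fourier
   integrals over balls. It is determined up to null sets only, and agrees almost everywhere
   with the Fourier integral when f is also in L1. The nonnegative integral expresses the
   convergence because it does not vanish on functions that are not square integrable. *)
definition fourier :: "((real ^ 'n) \<Rightarrow> real) \<Rightarrow> real ^ 'n \<Rightarrow> complex"
  where "fourier f = (SOME g. g \<in> L2 \<and>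
    ((\<lambda>R. \<integral>\<^sup>+ \<xi>. ennreal ((norm
        (fourier_integral (\<lambda>x. indicator (ball 0 R) x * f x) \<xi> - g \<xi>))\<^sup>2) \<partial>lborel)
      \<longlongrightarrow> 0) at_top)"

(* Inhomogeneous Sobolev space of order \<sigma> \<ge> 0. *)
definition sobolev :: "real \<Rightarrow> ((real ^ 'n) \<Rightarrow> real) set"
  where "sobolev \<sigma> =
    {f \<in> L2. (\<lambda>\<xi>. (sqrt (1 + (norm \<xi>)\<^sup>2) powr \<sigma>) *\<^sub>R fourier f \<xi>) \<in> L2}"

definition sobolev_norm :: "real \<Rightarrow> ((real ^ 'n) \<Rightarrow> real) \<Rightarrow> real"
  where "sobolev_norm \<sigma> f =
    L2_norm (\<lambda>\<xi>. (sqrt (1 + (norm \<xi>)\<^sup>2) powr \<sigma>) *\<^sub>R fourier f \<xi>)"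

(* The L2 functions in the homogeneous Sobolev space of order \<sigma> > 0; only such functions
   occur here. *)
definition hom_sobolev :: "real \<Rightarrow> ((real ^ 'n) \<Rightarrow> real) set"
  where "hom_sobolev \<sigma> = {f \<in> L2. (\<lambda>\<xi>. (norm \<xi> powr \<sigma>) *\<^sub>R fourier f \<xi>) \<in> L2}"

definition hom_sobolev_norm :: "real \<Rightarrow> ((real ^ 'n) \<Rightarrow> real) \<Rightarrow> real"
  where "hom_sobolev_norm \<sigma> f = L2_norm (\<lambda>\<xi>. (norm \<xi> powr \<sigma>) *\<^sub>R fourier f \<xi>)"

definition disc_root :: "real \<Rightarrow> real ^ 'n \<Rightarrow> complex"
  where "disc_root \<mu> \<xi> =
    csqrt (complex_of_real (\<mu>\<^sup>2 * norm \<xi> ^ 8 - (norm \<xi>)\<^sup>2 - norm \<xi> ^ 4))"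

definition lam_plus :: "real \<Rightarrow> real ^ 'n \<Rightarrow> complex"
  where "lam_plus \<mu> \<xi> = - complex_of_real (\<mu> * norm \<xi> ^ 4) + disc_root \<mu> \<xi>"

definition lam_minus :: "real \<Rightarrow> real ^ 'n \<Rightarrow> complex"
  where "lam_minus \<mu> \<xi> = - complex_of_real (\<mu> * norm \<xi> ^ 4) - disc_root \<mu> \<xi>"

(* The first branch of each kernel is the limit of the second one as the two roots merge. *)
definition kernel0 :: "real \<Rightarrow> real \<Rightarrow> real ^ 'n \<Rightarrow> complex"
  where "kernel0 \<mu> t \<xi> =
    (let p = lam_plus \<mu> \<xi>; m = lam_minus \<mu> \<xi> in
      if p = m then (1 - p * of_real t) * exp (p * of_real t)
      else (p * exp (m * of_real t) - m * exp (p * of_real t)) / (p - m))"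

definition kernel1 :: "real \<Rightarrow> real \<Rightarrow> real ^ 'n \<Rightarrow> complex"
  where "kernel1 \<mu> t \<xi> =
    (let p = lam_plus \<mu> \<xi>; m = lam_minus \<mu> \<xi> in
      if p = m then of_real t * exp (p * of_real t)
      else (exp (p * of_real t) - exp (m * of_real t)) / (p - m))"

(* The kernels solve the Fourier transform in x of
   v_tt - Laplace v + Laplace^2 v + 2 \<mu> Laplace^2 v_t = 0 with the prescribed data. *)
lemma kernels_solve:
  fixes \<xi> :: "real ^ 'n" and \<mu> :: real and a b :: complex
  defines "w \<equiv> \<lambda>t. kernel0 \<mu> t \<xi> * a + kernel1 \<mu> t \<xi> * b"
  shows "w 0 = a"
    and "\<exists>w'. w' 0 = b \<and> (\<forall>t. (w has_vector_derivative w' t) (at t) \<and>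
      (w' has_vector_derivative
        (- of_real (2 * \<mu> * norm \<xi> ^ 4) * w' t
         - of_real ((norm \<xi>)\<^sup>2 + norm \<xi> ^ 4) * w t)) (at t))"
proof -
  define p m where "p = lam_plus \<mu> \<xi>" and "m = lam_minus \<mu> \<xi>"
  have sum: "p + m = - of_real (2 * \<mu> * norm \<xi> ^ 4)"
    by (simp add: p_def m_def lam_plus_def lam_minus_def)
  have sq: "disc_root \<mu> \<xi> * disc_root \<mu> \<xi> =
      of_real (\<mu>\<^sup>2 * norm \<xi> ^ 8 - (norm \<xi>)\<^sup>2 - norm \<xi> ^ 4)"
    unfolding disc_root_def by (metis power2_csqrt power2_eq_square)
  have "p * m = of_real (\<mu> * norm \<xi> ^ 4) * of_real (\<mu> * norm \<xi> ^ 4)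
      - disc_root \<mu> \<xi> * disc_root \<mu> \<xi>"
    by (simp add: p_def m_def lam_plus_def lam_minus_def algebra_simps)
  also have "\<dots> = of_real ((norm \<xi>)\<^sup>2 + norm \<xi> ^ 4)"
    unfolding sq by (simp add: power2_eq_square algebra_simps flip: power_add)
  finally have prod: "p * m = of_real ((norm \<xi>)\<^sup>2 + norm \<xi> ^ 4)" .
  define F where "F = (\<lambda>z. (if p = m then (1 - p * z) * exp (p * z)
      else (p * exp (m * z) - m * exp (p * z)) / (p - m)) * a +
      (if p = m then z * exp (p * z)
      else (exp (p * z) - exp (m * z)) / (p - m)) * b)"
  define F' where "F' = (\<lambda>z. if p = m
      then - p * p * z * exp (p * z) * a + (1 + p * z) * exp (p * z) * b
      else (p * m * (exp (m * z) - exp (p * z)) / (p - m)) * a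
        + ((p * exp (p * z) - m * exp (m * z)) / (p - m)) * b)"
  have w: "w = (\<lambda>t. F (of_real t))"
    unfolding w_def kernel0_def kernel1_def Let_def p_def m_def F_def by (rule refl)
  show "w 0 = a" by (simp add: w F_def)
  have F: "(F has_field_derivative F' z) (at z)" for z
  proof (cases "p = m")
    case True
    then show ?thesis unfolding F_def F'_def
      by (auto intro!: derivative_eq_intros simp: algebra_simps)
  next
    case False
    define d where "d = inverse (p - m)"
    show ?thesis using False unfolding F_def F'_def divide_inverse d_def[symmetric]
      by (auto intro!: derivative_eq_intros simp: algebra_simps)
  qed
  have F': "(F' has_field_derivative ((p + m) * F' z - p * m * F z)) (at z)" for z
  proof (cases "p = m")
    case True
    then show ?thesis unfolding F_def F'_def
      by (auto intro!: derivative_eq_intros simp: algebra_simps)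
  next
    case False
    define d where "d = inverse (p - m)"
    show ?thesis using False unfolding F_def F'_def divide_inverse d_def[symmetric]
      by (auto intro!: derivative_eq_intros simp: algebra_simps)
  qed
  have "F' 0 = b"
    by (simp add: F'_def flip: left_diff_distrib)
  then show "\<exists>w'. w' 0 = b \<and> (\<forall>t. (w has_vector_derivative w' t) (at t) \<and>
      (w' has_vector_derivative
        (- of_real (2 * \<mu> * norm \<xi> ^ 4) * w' t
         - of_real ((norm \<xi>)\<^sup>2 + norm \<xi> ^ 4) * w t)) (at t))"
    unfolding sum[symmetric] prod[symmetric] w
    by (intro exI[of _ "\<lambda>t. F' (of_real t)"] conjI allI has_vector_derivative_real_field F F') simp
qed

definition boussinesq_solution ::
  "real \<Rightarrow> ((real ^ 'n) \<Rightarrow> real) \<Rightarrow> ((real ^ 'n) \<Rightarrow> real) \<Rightarrow> (real \<Rightarrow> real ^ 'n \<Rightarrow> real) \<Rightarrow> bool"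
  where "boussinesq_solution \<mu> v0 v1 v \<longleftrightarrow>
    (\<forall>t\<ge>0. v t \<in> L2 \<and>
      (AE \<xi> in lborel. fourier (v t) \<xi> =
        kernel0 \<mu> t \<xi> * fourier v0 \<xi> + kernel1 \<mu> t \<xi> * fourier v1 \<xi>))"

definition decay :: "nat \<Rightarrow> real \<Rightarrow> real"
  where "decay n t =
    (if n = 1 then sqrt t
     else if n = 2 then sqrt (ln t)
     else t powr (- (real n - 2) / 8))"

end

theory Submission
  imports Defs "HOL-Probability.Probability" "HOL-Real_Asymp.Real_Asymp"
begin

text \<open>
By Plancherel both norms of the solution are weighted \<open>L\<^sup>2\<close> norms of
\<open>K\<^sub>0 F\<^sub>0 + K\<^sub>1 F\<^sub>1\<close>, where \<open>F\<^sub>j\<close> is the transform of \<open>v\<^sub>j\<close>, so it suffices to understand the kernels.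
For \<open>|\<xi>| \<ge> 1\<close> both are \<open>O(exp (-\<mu> t / 4))\<close> and \<open>K\<^sub>1\<close> gains a factor \<open>|\<xi>|\<^sup>-\<^sup>4\<close>, which is why
\<open>v\<^sub>1\<close> may have less regularity. For \<open>|\<xi>| \<le> 1\<close> we have \<open>|K\<^sub>0| \<le> 2 exp (-\<mu> |\<xi>|\<^sup>4 t)\<close> and
\<open>K\<^sub>1 = exp (-\<mu> |\<xi>|\<^sup>4 t) sin (\<omega> t) / \<omega>\<close> with \<open>|\<xi>| \<le> \<omega> \<le> 2 |\<xi>|\<close>. There \<open>F\<^sub>j\<close> is bounded by the
\<open>L\<^sup>1\<close> norm, and the rescaling \<open>\<xi> = t\<^bsup>-1/4\<^esup> \<eta>\<close> gives the rates. If \<open>n \<le> 2\<close>, then \<open>|\<xi>|\<^sup>-\<^sup>2\<close> is not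
integrable at the origin, and \<open>|K\<^sub>1| \<le> min t (1 / |\<xi>|)\<close> summed over dyadic balls replaces the rescaling.

For the lower bounds, \<open>F\<^sub>1\<close> stays close to its nonzero value at the origin on a small ball, and
the part with \<open>K\<^sub>0\<close> is of lower order. The oscillation of \<open>K\<^sub>1\<close> is harmless: moving \<open>\<xi>\<close> by the vector
\<open>(2 / t) e\<close> changes \<open>\<omega> t\<close> by an amount between \<open>1\<close> and \<open>9 / 4\<close>, so the sine cannot be small at
both points, and translations preserve the measure.
\<close>

section \<open>The Plancherel theorem\<close>

text \<open>The regimes of \<open>decay\<close> reflect where |\<xi>|^-2, the size of the squared
  second kernel, puts its mass between the scale 1/t, below which the kernel saturates at t, and the
  scale t^(-1/4), above which the damping wins. For n = 1 the mass sits at 1/t. For n = 2 every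
  dyadic scale in between counts equally, whence the logarithm. For n \<ge> 3, or under the weight
  |\<xi>|^(2s+2), it sits at t^(-1/4). Two obstacles shape the rest. The constants must not depend
  on the data, whereas the ball on which the transform of \<open>v1\<close> stays away from zero
  does; so the lower bounds for the kernel fix their constant before the radius of that ball, and
  only the starting time depends on the radius. Moreover \<open>L2_norm\<close> is zero when its
  integral diverges, so energies are estimated as nonnegative integrals and membership in the spaces
  is derived along with the bounds. Similarly \<open>fourier\<close> is a choice among functions
  with a limit property, so that the existence of such a limit has to be established before anything
  is known about it.\<close>

lemma borel_measurable_cis [measurable (raw)]:
  "f \<in> borel_measurable M \<Longrightarrow> (\<lambda>x. cis (f x)) \<in> borel_measurable M"
  unfolding cis_conv_exp by measurable

lemma pred_ball [measurable]:
  fixes a :: "'a::euclidean_space"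
  shows "Measurable.pred borel (\<lambda>x. x \<in> ball a r)" "Measurable.pred borel (\<lambda>x. x \<in> cball a r)"
  by (simp_all add: pred_def)

section \<open>Gaussian integrals and the multiplication formula\<close>

text \<open>At \<open>h = 1\<close> this is the characteristic function of the standard normal law,
  freed from the factor 1 / sqrt (2 pi) of the density. A general \<open>h\<close> follows from the
  substitution of h x for x in the integrand with frequency \<open>u / h\<close>.\<close>

lemma has_bochner_integral_gaussian_cis:
  fixes h u :: real
  assumes "0 < h"
  shows "has_bochner_integral lborel (\<lambda>x. exp (- (h * x)\<^sup>2 / 2) *\<^sub>R cis (- (u * x)))
    (of_real (sqrt (2 * pi) / h * exp (- (u / h)\<^sup>2 / 2)))"
proof -
  define f where "f x = exp (- x\<^sup>2 / 2) *\<^sub>R cis (- (u / h * x))" for x :: real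
  have eq: "std_normal_density x = exp (- x\<^sup>2 / 2) / sqrt (2 * pi)" for x
    by (simp add: std_normal_density_def)
  have "integrable lborel (\<lambda>x. std_normal_density x * sqrt (2 * pi))"
    by simp
  then have "integrable lborel (\<lambda>x. exp (- x\<^sup>2 / 2) :: real)"
    by (simp add: eq del: integrable_mult_left_iff)
  then have int: "integrable lborel f"
    unfolding f_def by (rule Bochner_Integration.integrable_bound) auto
  have "of_real (exp (- (u / h)\<^sup>2 / 2)) = char std_normal_distribution (- (u / h))"
    by (simp add: char_std_normal_distribution)
  also have "\<dots> = (LINT x|lborel. std_normal_density x *\<^sub>R iexp (- (u / h) * x))"
    unfolding char_def by (subst integral_density) auto
  also have "\<dots> = (LINT x|lborel. (1 / sqrt (2 * pi)) *\<^sub>R f x)"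
    by (simp add: f_def eq cis_conv_exp)
  also have "\<dots> = (1 / sqrt (2 * pi)) *\<^sub>R (LINT x|lborel. f x)"
    using int by simp
  finally have "(LINT x|lborel. f x) = of_real (sqrt (2 * pi) * exp (- (u / h)\<^sup>2 / 2))"
    by (simp add: scaleR_conv_of_real field_simps)
  with int have "has_bochner_integral lborel f (of_real (sqrt (2 * pi) * exp (- (u / h)\<^sup>2 / 2)))"
    by (simp add: has_bochner_integral_iff)
  then have "has_bochner_integral lborel (\<lambda>x. f (0 + h * x))
      (of_real (sqrt (2 * pi) * exp (- (u / h)\<^sup>2 / 2)) /\<^sub>R \<bar>h\<bar>)"
    by (subst (asm) lborel_has_bochner_integral_real_affine_iff[of h _ _ 0]) (use assms in auto)
  with assms show ?thesis
    by (simp add: f_def scaleR_conv_of_real field_simps)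
qed

text \<open>\<open>lborel\<close> is the image of the product of one-dimensional Lebesgue measures
  under the coordinate map, so products of functions of one coordinate integrate factorwise.
  \<open>has_bochner_integral\<close> carries integrability along with the value.\<close>

lemma has_bochner_integral_lborel_prod:
  fixes f :: "'a::euclidean_space \<Rightarrow> real \<Rightarrow> 'b::{real_normed_field, banach, second_countable_topology}"
  assumes "\<And>b. b \<in> Basis \<Longrightarrow> has_bochner_integral lborel (f b) (I b)"
  shows "has_bochner_integral lborel (\<lambda>x. \<Prod>b\<in>Basis. f b (x \<bullet> b)) (\<Prod>b\<in>Basis. I b)"
proof -
  interpret P: product_sigma_finite "\<lambda>b::'a. lborel :: real measure" ..
  have [measurable]: "f b \<in> borel_measurable borel" if "b \<in> Basis" for b
    using assms[OF that] by (auto simp: has_bochner_integral_iff)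
  have int: "integrable lborel (f b)" if "b \<in> Basis" for b
    using assms[OF that] by (auto simp: has_bochner_integral_iff)
  have eq: "(\<lambda>x. \<Prod>b\<in>Basis. f b ((\<Sum>b\<in>Basis. x b *\<^sub>R b) \<bullet> b)) = (\<lambda>x. \<Prod>b\<in>Basis. f b (x b))"
    by (auto intro!: prod.cong)
  have l: "(lborel :: 'a measure) = distr (\<Pi>\<^sub>M b\<in>Basis. lborel) borel (\<lambda>f. \<Sum>b\<in>Basis. f b *\<^sub>R b)"
    by (rule lborel_eq)
  have m: "(\<lambda>x. \<Prod>b\<in>Basis. f b (x \<bullet> b)) \<in> borel_measurable borel"
    by measurable
  show ?thesis
    unfolding has_bochner_integral_iff
  proof
    show "integrable lborel (\<lambda>x. \<Prod>b\<in>Basis. f b (x \<bullet> b))"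
      unfolding l by (subst integrable_distr_eq)
        (use m in \<open>auto simp: eq intro!: P.product_integrable_prod int\<close>)
    show "(LINT x|lborel. (\<Prod>b\<in>Basis. f b (x \<bullet> b))) = prod I Basis"
      unfolding l by (subst integral_distr)
        (use m assms in \<open>auto simp: eq P.product_integral_prod int has_bochner_integral_iff
          intro!: prod.cong\<close>)
  qed
qed

lemma cis_sum: "finite A \<Longrightarrow> cis (\<Sum>a\<in>A. f a) = (\<Prod>a\<in>A. cis (f a))"
  by (induction A rule: finite_induct) (auto simp: cis_mult[symmetric])

lemma has_bochner_integral_gaussian_cis_euclidean:
  fixes z :: "'a::euclidean_space"
  assumes "0 < h"
  shows "has_bochner_integral lborel (\<lambda>x. exp (- (h * norm x)\<^sup>2 / 2) *\<^sub>R cis (- (z \<bullet> x)))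
    (of_real ((sqrt (2 * pi) / h) ^ DIM('a) * exp (- (norm z / h)\<^sup>2 / 2)))"
proof -
  have e: "exp (- (c * norm x)\<^sup>2 / 2) = (\<Prod>b\<in>Basis. exp (- (c * (x \<bullet> b))\<^sup>2 / 2))" for x :: 'a and c :: real
  proof -
    have "(norm x)\<^sup>2 = (\<Sum>b\<in>Basis. (x \<bullet> b)\<^sup>2)"
      by (simp add: norm_eq_sqrt_inner euclidean_inner[of x x] power2_eq_square sum_nonneg)
    then show ?thesis
      by (simp add: power_mult_distrib sum_distrib_left sum_divide_distrib flip: exp_sum sum_negf)
  qed
  have "has_bochner_integral lborel
     (\<lambda>x. \<Prod>b\<in>Basis. exp (- (h * (x \<bullet> b))\<^sup>2 / 2) *\<^sub>R cis (- ((z \<bullet> b) * (x \<bullet> b))))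
     (\<Prod>b\<in>(Basis::'a set). of_real (sqrt (2 * pi) / h * exp (- ((z \<bullet> b) / h)\<^sup>2 / 2)))"
    by (rule has_bochner_integral_lborel_prod) (rule has_bochner_integral_gaussian_cis[OF assms])
  moreover have "(\<Prod>b\<in>Basis. exp (- (h * (x \<bullet> b))\<^sup>2 / 2) *\<^sub>R cis (- ((z \<bullet> b) * (x \<bullet> b)))) =
      exp (- (h * norm x)\<^sup>2 / 2) *\<^sub>R cis (- (z \<bullet> x))" for x
    unfolding e by (subst (3) euclidean_inner)
      (simp add: scaleR_conv_of_real prod.distrib cis_sum flip: sum_negf)
  moreover have "(\<Prod>b\<in>(Basis::'a set). of_real (sqrt (2 * pi) / h * exp (- ((z \<bullet> b) / h)\<^sup>2 / 2)) :: complex) =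
    of_real ((sqrt (2 * pi) / h) ^ DIM('a) * exp (- (norm z / h)\<^sup>2 / 2))"
  proof -
    have "(\<Prod>b\<in>(Basis::'a set). sqrt (2 * pi) / h * exp (- ((z \<bullet> b) / h)\<^sup>2 / 2)) =
        (sqrt (2 * pi) / h) ^ DIM('a) * exp (- (norm z / h)\<^sup>2 / 2)"
      using e[of "1 / h" z] by (subst prod.distrib) simp
    then show ?thesis by (simp only: of_real_prod[symmetric])
  qed
  ultimately show ?thesis by simp
qed

lemma nn_integral_lborel_scaleR:
  fixes f :: "'a::euclidean_space \<Rightarrow> ennreal"
  assumes [measurable]: "f \<in> borel_measurable borel" and "0 < c"
  shows "(\<integral>\<^sup>+x. f x \<partial>lborel) = ennreal (c ^ DIM('a)) * (\<integral>\<^sup>+x. f (c *\<^sub>R x) \<partial>lborel)"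
  using assms(2) by (subst lborel_affine[of c 0])
    (auto simp: nn_integral_density nn_integral_distr nn_integral_cmult)

lemma nn_integral_lborel_translation:
  fixes f :: "'a::euclidean_space \<Rightarrow> ennreal"
  assumes [measurable]: "f \<in> borel_measurable borel"
  shows "(\<integral>\<^sup>+x. f (a + x) \<partial>lborel) = (\<integral>\<^sup>+x. f x \<partial>lborel)"
  by (subst (2) lborel_distr_plus[of a, symmetric]) (simp add: nn_integral_distr)

text \<open>Fubini: \<open>cis\<close> has modulus one, so |f x| |g \<xi>| is an integrable majorant
  on the product. No power of 2 pi appears because neither side carries the normalisation of
  \<open>fourier_integral\<close>.\<close>

lemma fourier_multiplication_formula:
  fixes f :: "'a::euclidean_space \<Rightarrow> real" and g :: "'a \<Rightarrow> complex"
  assumes f: "integrable lborel f" and g: "integrable lborel g"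
  shows "(LINT \<xi>|lborel. g \<xi> * (LINT x|lborel. f x *\<^sub>R cis (- (x \<bullet> \<xi>)))) =
    (LINT x|lborel. f x *\<^sub>R (LINT \<xi>|lborel. g \<xi> * cis (- (x \<bullet> \<xi>))))"
proof -
  have [measurable]: "f \<in> borel_measurable borel" "g \<in> borel_measurable borel"
    using f g by auto
  have cf: "integrable lborel (\<lambda>x. f x *\<^sub>R cis (- (x \<bullet> \<xi>)))" for \<xi>
    using f by (rule Bochner_Integration.integrable_bound) auto
  have cg: "integrable lborel (\<lambda>\<xi>. g \<xi> * cis (- (x \<bullet> \<xi>)))" for x
    using g by (rule Bochner_Integration.integrable_bound) (auto simp: norm_mult)
  have "integrable (lborel \<Otimes>\<^sub>M lborel) (\<lambda>(x, \<xi>). f x *\<^sub>R (g \<xi> * cis (- (x \<bullet> \<xi>))))"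
  proof (rule lborel_pair.Fubini_integrable)
    show "integrable lborel (\<lambda>x. LINT y|lborel. norm (case (x, y) of (x, \<xi>) \<Rightarrow> f x *\<^sub>R (g \<xi> * cis (- (x \<bullet> \<xi>)))))"
      using f by (simp add: norm_mult)
    show "AE x in lborel. integrable lborel (\<lambda>y. case (x, y) of (x, \<xi>) \<Rightarrow> f x *\<^sub>R (g \<xi> * cis (- (x \<bullet> \<xi>))))"
      using cg by simp
  qed measurable
  from lborel_pair.Fubini_integral[OF this] show ?thesis
    unfolding integral_mult_right_zero[symmetric] integral_scaleR_right[symmetric]
    by (simp add: mult_scaleR_right)
qed

definition gauss :: "'a::euclidean_space \<Rightarrow> real"
  where "gauss w = exp (- (norm w)\<^sup>2 / 2) / sqrt (2 * pi) ^ DIM('a)"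

lemma gauss_nonneg [simp]: "0 \<le> gauss w"
  by (simp add: gauss_def)

lemma borel_measurable_gauss [measurable]: "gauss \<in> borel_measurable borel"
  unfolding gauss_def by measurable

lemma has_bochner_integral_gauss: "has_bochner_integral lborel (gauss :: 'a::euclidean_space \<Rightarrow> real) 1"
proof -
  have "has_bochner_integral lborel (\<lambda>x::'a. complex_of_real (exp (- (norm x)\<^sup>2 / 2)))
      (of_real (sqrt (2 * pi) ^ DIM('a)))"
    using has_bochner_integral_gaussian_cis_euclidean[of 1 "0::'a"] by (simp add: scaleR_conv_of_real)
  then have "has_bochner_integral lborel (\<lambda>x::'a. exp (- (norm x)\<^sup>2 / 2)) (sqrt (2 * pi) ^ DIM('a))"
    by (metis has_bochner_integral_iff integral_complex_of_real complex_of_real_integrable_eq of_real_eq_iff)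
  then have "has_bochner_integral lborel (\<lambda>x::'a. exp (- (norm x)\<^sup>2 / 2) / sqrt (2 * pi) ^ DIM('a)) (sqrt (2 * pi) ^ DIM('a) / sqrt (2 * pi) ^ DIM('a))"
    by (rule has_bochner_integral_divide_zero)
  then show ?thesis by (simp add: gauss_def[abs_def])
qed

lemma integral_lborel_affine:
  fixes f :: "'a::euclidean_space \<Rightarrow> 'b::{banach, second_countable_topology}"
  assumes [measurable]: "f \<in> borel_measurable borel" and "c \<noteq> 0"
  shows "(LINT x|lborel. f x) = \<bar>c\<bar> ^ DIM('a) *\<^sub>R (LINT x|lborel. f (t + c *\<^sub>R x))"
  using assms(2) by (subst lborel_affine[of c t])
    (auto simp: integral_density integral_distr)

lemma sqrt_power_mult_self: "0 \<le> a \<Longrightarrow> sqrt a ^ n * sqrt a ^ n = a ^ n"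
  by (metis power_mult_distrib real_sqrt_mult_self abs_of_nonneg)

text \<open>The Gaussian factor makes the damped conjugate transform integrable, so that the
  multiplication formula applies. It is applied twice: once to write the energy as an integral
  against \<open>f\<close>, and once more to reach the transform of the Gaussian itself, a bump of
  width \<open>h\<close> centred at \<open>x\<close>.\<close>

lemma fourier_integral_gaussian_energy:
  fixes f :: "real ^ 'n \<Rightarrow> real"
  assumes f: "integrable lborel f" and h: "0 < h"
  shows "complex_of_real (LINT \<xi>|lborel. (norm (fourier_integral f \<xi>))\<^sup>2 * exp (- (h * norm \<xi>)\<^sup>2 / 2)) =
    of_real (LINT x|lborel. f x * (LINT w|lborel. f (x - h *\<^sub>R w) * gauss w))"
proof -
  have [measurable]: "f \<in> borel_measurable borel"
    using f by auto
  define c where "c = 1 / sqrt (2 * pi) ^ CARD('n)"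
  define \<Phi> where "\<Phi> \<xi> = (LINT x|lborel. f x *\<^sub>R cis (- (x \<bullet> \<xi>)))" for \<xi>
  define G where "G \<xi> = exp (- (h * norm \<xi>)\<^sup>2 / 2)" for \<xi> :: "real ^ 'n"
  have [measurable]: "\<Phi> \<in> borel_measurable borel" "G \<in> borel_measurable borel"
    unfolding \<Phi>_def G_def by measurable
  have [measurable]: "(\<lambda>\<xi>. cnj (\<Phi> \<xi>)) \<in> borel_measurable borel"
    by (rule measurable_compose[of \<Phi> _ borel]) (auto intro!: borel_measurable_continuous_onI continuous_intros)
  have G: "has_bochner_integral lborel (\<lambda>\<xi>. G \<xi> *\<^sub>R cis (- (z \<bullet> \<xi>)))
      (of_real ((sqrt (2 * pi) / h) ^ CARD('n) * exp (- (norm z / h)\<^sup>2 / 2)))" for z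
    using has_bochner_integral_gaussian_cis_euclidean[OF h, of z] by (simp add: G_def)
  then have Gint: "integrable lborel (\<lambda>\<xi>. complex_of_real (G \<xi>))"
    using G[of 0] by (simp add: has_bochner_integral_iff scaleR_conv_of_real)
  have cnj: "cnj (\<Phi> \<xi>) = (LINT x|lborel. f x *\<^sub>R cis (x \<bullet> \<xi>))" for \<xi>
    unfolding \<Phi>_def by (subst Bochner_Integration.integral_cnj[symmetric]) (simp add: cis_cnj scaleR_conv_of_real)
  have bd: "norm (\<Phi> \<xi>) \<le> (LINT x|lborel. \<bar>f x\<bar>)" for \<xi>
    unfolding \<Phi>_def by (rule order_trans[OF integral_norm_bound]) simp
  have g: "integrable lborel (\<lambda>\<xi>. G \<xi> *\<^sub>R (cis (- (z \<bullet> \<xi>)) * cnj (\<Phi> \<xi>)))" for z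
  proof (rule Bochner_Integration.integrable_bound[OF integrable_mult_right[OF Gint]])
    show "AE \<xi> in lborel. norm (G \<xi> *\<^sub>R (cis (- (z \<bullet> \<xi>)) * cnj (\<Phi> \<xi>))) \<le>
        norm (of_real (LINT x|lborel. \<bar>f x\<bar>) * complex_of_real (G \<xi>))"
      using mult_left_mono[OF bd, of "\<bar>G _\<bar>"] by (simp add: norm_mult mult.commute)
  qed measurable
  have inner: "(LINT \<xi>|lborel. G \<xi> *\<^sub>R (cis (- (x \<bullet> \<xi>)) * cnj (\<Phi> \<xi>))) =
      of_real ((2 * pi) ^ CARD('n)) * of_real (LINT w|lborel. f (x - h *\<^sub>R w) * gauss w)" for x
  proof -
    \<comment> \<open>The substitution is y = x - h w; the negative scaling factor is what produces
      the argument of \<open>f\<close> in the claim.\<close>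
    have "(LINT y|lborel. f y * ((sqrt (2 * pi) / h) ^ CARD('n) * exp (- (norm (y - x) / h)\<^sup>2 / 2))) =
       h ^ CARD('n) * (LINT w|lborel. f (x + - h *\<^sub>R w) * ((sqrt (2 * pi) / h) ^ CARD('n) * exp (- (norm (x + - h *\<^sub>R w - x) / h)\<^sup>2 / 2)))"
      by (subst integral_lborel_affine[of _ "- h" x]) (use h in auto)
    also have "\<dots> = (LINT w|lborel. h ^ CARD('n) * (f (x + - h *\<^sub>R w) * ((sqrt (2 * pi) / h) ^ CARD('n) * exp (- (norm (x + - h *\<^sub>R w - x) / h)\<^sup>2 / 2))))"
      by (simp only: integral_mult_right_zero)
    also have "\<dots> = (LINT w|lborel. (2 * pi) ^ CARD('n) * (f (x - h *\<^sub>R w) * gauss w))"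
    proof (rule Bochner_Integration.integral_cong[OF refl])
      fix w
      have P: "(2 * pi) ^ CARD('n) = sqrt (2 * pi) ^ CARD('n) * sqrt (2 * pi) ^ CARD('n)"
        by (rule sqrt_power_mult_self[symmetric]) simp
      show "h ^ CARD('n) * (f (x + - h *\<^sub>R w) * ((sqrt (2 * pi) / h) ^ CARD('n) * exp (- (norm (x + - h *\<^sub>R w - x) / h)\<^sup>2 / 2))) =
          (2 * pi) ^ CARD('n) * (f (x - h *\<^sub>R w) * gauss w)"
        using h unfolding P by (simp add: gauss_def power_divide)
    qed
    also have "\<dots> = (2 * pi) ^ CARD('n) * (LINT w|lborel. f (x - h *\<^sub>R w) * gauss w)"
      by (simp only: integral_mult_right_zero)
    finally have key: "(LINT y|lborel. f y * ((sqrt (2 * pi) / h) ^ CARD('n) * exp (- (norm (y - x) / h)\<^sup>2 / 2))) =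
        (2 * pi) ^ CARD('n) * (LINT w|lborel. f (x - h *\<^sub>R w) * gauss w)" .
    \<comment> \<open>The multiplication formula has the kernel
      \<open>cis (- (x \<bullet> \<xi>))\<close>, that of \<open>\<Phi>\<close> and not of its
      conjugate; conjugating the whole integral removes the mismatch.\<close>
    have cn: "(LINT \<xi>|lborel. G \<xi> *\<^sub>R (cis (- (x \<bullet> \<xi>)) * cnj (\<Phi> \<xi>))) =
        cnj (LINT \<xi>|lborel. (G \<xi> *\<^sub>R cis (x \<bullet> \<xi>)) * \<Phi> \<xi>)"
      by (subst Bochner_Integration.integral_cnj[symmetric]) (simp add: cis_cnj scaleR_conv_of_real mult_ac)
    have "(LINT \<xi>|lborel. (G \<xi> *\<^sub>R cis (x \<bullet> \<xi>)) * \<Phi> \<xi>) =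
        (LINT y|lborel. f y *\<^sub>R (LINT \<xi>|lborel. (G \<xi> *\<^sub>R cis (x \<bullet> \<xi>)) * cis (- (y \<bullet> \<xi>))))"
      unfolding \<Phi>_def
      by (rule fourier_multiplication_formula[OF f])
        (use G[of "-x"] in \<open>simp add: has_bochner_integral_iff\<close>)
    also have "\<dots> = (LINT y|lborel. f y *\<^sub>R (LINT \<xi>|lborel. G \<xi> *\<^sub>R cis (- ((y - x) \<bullet> \<xi>))))"
      by (simp add: cis_mult inner_diff_left)
    also have "\<dots> = (LINT y|lborel. f y *\<^sub>R of_real ((sqrt (2 * pi) / h) ^ CARD('n) * exp (- (norm (y - x) / h)\<^sup>2 / 2)))"
      using G by (simp add: has_bochner_integral_iff)
    also have "\<dots> = of_real (LINT y|lborel. f y * ((sqrt (2 * pi) / h) ^ CARD('n) * exp (- (norm (y - x) / h)\<^sup>2 / 2)))"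
      by (simp add: scaleR_conv_of_real flip: of_real_mult integral_complex_of_real)
    finally have "(LINT \<xi>|lborel. (G \<xi> *\<^sub>R cis (x \<bullet> \<xi>)) * \<Phi> \<xi>) =
        of_real ((2 * pi) ^ CARD('n) * (LINT w|lborel. f (x - h *\<^sub>R w) * gauss w))"
      unfolding key .
    with cn show ?thesis by simp
  qed
  have "complex_of_real (LINT \<xi>|lborel. (norm (fourier_integral f \<xi>))\<^sup>2 * G \<xi>) =
      (LINT \<xi>|lborel. of_real (c\<^sup>2) * (G \<xi> *\<^sub>R cnj (\<Phi> \<xi>) * \<Phi> \<xi>))"
    unfolding integral_complex_of_real[symmetric]
  proof (rule Bochner_Integration.integral_cong[OF refl])
    fix \<xi>
    have "norm (fourier_integral f \<xi>) = c * norm (\<Phi> \<xi>)"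
      unfolding fourier_integral_def \<Phi>_def c_def by simp
    moreover have "cnj (\<Phi> \<xi>) * \<Phi> \<xi> = of_real ((norm (\<Phi> \<xi>))\<^sup>2)"
      by (metis complex_norm_square mult.commute)
    ultimately show "complex_of_real ((norm (fourier_integral f \<xi>))\<^sup>2 * G \<xi>) =
        of_real (c\<^sup>2) * (G \<xi> *\<^sub>R cnj (\<Phi> \<xi>) * \<Phi> \<xi>)"
      by (simp add: power_mult_distrib scaleR_conv_of_real mult_ac)
  qed
  also have "\<dots> = of_real (c\<^sup>2) * (LINT \<xi>|lborel. (G \<xi> *\<^sub>R cnj (\<Phi> \<xi>)) * \<Phi> \<xi>)"
    by (simp only: integral_mult_right_zero)
  finally have 1: "complex_of_real (LINT \<xi>|lborel. (norm (fourier_integral f \<xi>))\<^sup>2 * G \<xi>) =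
      of_real (c\<^sup>2) * (LINT \<xi>|lborel. (G \<xi> *\<^sub>R cnj (\<Phi> \<xi>)) * \<Phi> \<xi>)" .
  have "(LINT \<xi>|lborel. (G \<xi> *\<^sub>R cnj (\<Phi> \<xi>)) * \<Phi> \<xi>) =
      (LINT x|lborel. f x *\<^sub>R (LINT \<xi>|lborel. (G \<xi> *\<^sub>R cnj (\<Phi> \<xi>)) * cis (- (x \<bullet> \<xi>))))"
    unfolding \<Phi>_def[of "_::real^'n"]
    by (subst fourier_multiplication_formula[OF f, symmetric])
      (use g[of 0] in \<open>simp_all add: \<Phi>_def\<close>)
  also have "\<dots> = (LINT x|lborel. f x *\<^sub>R (of_real ((2 * pi) ^ CARD('n)) * of_real (LINT w|lborel. f (x - h *\<^sub>R w) * gauss w)))"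
    unfolding inner[symmetric] by (simp add: mult.commute)
  finally have 2: "(LINT \<xi>|lborel. (G \<xi> *\<^sub>R cnj (\<Phi> \<xi>)) * \<Phi> \<xi>) =
      (LINT x|lborel. f x *\<^sub>R (of_real ((2 * pi) ^ CARD('n)) * of_real (LINT w|lborel. f (x - h *\<^sub>R w) * gauss w)))" .
  \<comment> \<open>The unitary normalisation enters here: its square cancels the power of 2 pi that
    comes from the Gaussian integral and from the normalisation of \<open>gauss\<close>.\<close>
  have c2: "c\<^sup>2 * (2 * pi) ^ CARD('n) = 1"
    using sqrt_power_mult_self[of "2 * pi" "CARD('n)"] by (simp add: c_def power2_eq_square del: real_sqrt_mult)
  have c3: "of_real (c\<^sup>2) * (u *\<^sub>R (of_real ((2 * pi) ^ CARD('n)) * of_real v)) = complex_of_real (u * v)" for u v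
  proof -
    have "c\<^sup>2 * (u * ((2 * pi) ^ CARD('n) * v)) = (c\<^sup>2 * (2 * pi) ^ CARD('n)) * (u * v)"
      by (simp only: mult_ac)
    then show ?thesis
      unfolding c2 by (simp only: scaleR_conv_of_real of_real_mult[symmetric] mult_1_left)
  qed
  have "of_real (c\<^sup>2) * (LINT x|lborel. f x *\<^sub>R (of_real ((2 * pi) ^ CARD('n)) * of_real (LINT w|lborel. f (x - h *\<^sub>R w) * gauss w))) =
    (LINT x|lborel. complex_of_real (f x * (LINT w|lborel. f (x - h *\<^sub>R w) * gauss w)))"
    by (subst integral_mult_right_zero[symmetric]) (simp only: c3)
  with 1 2 show ?thesis
    by (simp only: G_def integral_complex_of_real)
qed

lemma fourier_integral_norm_le:
  fixes f :: "real ^ 'n \<Rightarrow> real"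
  shows "norm (fourier_integral f \<xi>) \<le> (LINT x|lborel. \<bar>f x\<bar>) / sqrt (2 * pi) ^ CARD('n)"
proof -
  have "norm (LINT x|lborel. f x *\<^sub>R cis (- (x \<bullet> \<xi>))) \<le> (LINT x|lborel. \<bar>f x\<bar>)"
    by (rule order_trans[OF integral_norm_bound]) simp
  then show ?thesis
    by (simp add: fourier_integral_def divide_right_mono)
qed

lemma borel_measurable_fourier_integral [measurable]:
  fixes f :: "real ^ 'n \<Rightarrow> real"
  assumes [measurable]: "f \<in> borel_measurable borel"
  shows "fourier_integral f \<in> borel_measurable borel"
  unfolding fourier_integral_def by measurable

abbreviation sq_integral :: "('a::euclidean_space \<Rightarrow> real) \<Rightarrow> ennreal"
  where "sq_integral f \<equiv> \<integral>\<^sup>+x. ennreal ((f x)\<^sup>2) \<partial>lborel"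

abbreviation sq_norm_integral :: "('a::euclidean_space \<Rightarrow> 'b::real_normed_vector) \<Rightarrow> ennreal"
  where "sq_norm_integral f \<equiv> \<integral>\<^sup>+x. ennreal ((norm (f x))\<^sup>2) \<partial>lborel"

text \<open>The second summand is the defect of the Gaussian regularisation. It vanishes as \<open>h\<close> tends to
\<open>0\<close> because translations are continuous in the mean square.\<close>

lemma gaussian_energy_identity:
  fixes f :: "real ^ 'n \<Rightarrow> real"
  assumes f: "integrable lborel f" and f2: "integrable lborel (\<lambda>x. (f x)\<^sup>2)" and h: "0 < h"
  shows "(\<integral>\<^sup>+\<xi>. ennreal ((norm (fourier_integral f \<xi>))\<^sup>2 * exp (- (h * norm \<xi>)\<^sup>2 / 2)) \<partial>lborel) +
      (\<integral>\<^sup>+w. ennreal (gauss w / 2) * sq_integral (\<lambda>x. f x - f (x - h *\<^sub>R w)) \<partial>lborel) =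
    sq_integral f"
proof -
  have [measurable]: "f \<in> borel_measurable borel"
    using f by auto
  define e where "e = (LINT x|lborel. (f x)\<^sup>2)"
  have N: "sq_integral f = ennreal e"
    unfolding e_def by (rule nn_integral_eq_integral[OF f2]) simp
  have g1: "(\<integral>\<^sup>+w. ennreal (gauss (w :: real ^ 'n)) \<partial>lborel) = 1"
    using has_bochner_integral_gauss
    by (subst nn_integral_eq_integral) (auto simp: has_bochner_integral_iff)
  let ?M = "lborel \<Otimes>\<^sub>M lborel :: ((real ^ 'n) \<times> (real ^ 'n)) measure"
  \<comment> \<open>Polarisation on the product space: with u = f x and v = f (x - h w), (u - v)^2 /
    2 = (u^2 + v^2) / 2 - u v. Both \<open>a\<close> and \<open>b\<close> integrate to
    \<open>e\<close> because \<open>gauss\<close> has mass one, \<open>p\<close> integrates to the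
    damped energy, and \<open>q\<close> gives the defect.\<close>
  define a where "a = (\<lambda>(x, w :: real ^ 'n). (f x)\<^sup>2 * gauss w)"
  define b where "b = (\<lambda>(x, w). (f (x - h *\<^sub>R w))\<^sup>2 * gauss w)"
  define p where "p = (\<lambda>(x, w). f x * f (x - h *\<^sub>R w) * gauss w)"
  define q where "q = (\<lambda>(x, w). (f x - f (x - h *\<^sub>R w))\<^sup>2 * (gauss w / 2))"
  have [measurable]: "a \<in> borel_measurable ?M" "b \<in> borel_measurable ?M"
      "p \<in> borel_measurable ?M" "q \<in> borel_measurable ?M"
    unfolding a_def b_def p_def q_def by measurable
  have "0 \<le> e"
    by (simp add: e_def)
  have "(\<integral>\<^sup>+z. ennreal (a z) \<partial>?M) = (\<integral>\<^sup>+x. \<integral>\<^sup>+(w :: real ^ 'n). ennreal ((f x)\<^sup>2) * ennreal (gauss w) \<partial>lborel \<partial>lborel)"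
    by (subst lborel.nn_integral_fst[symmetric]) (simp_all add: a_def ennreal_mult)
  also have "\<dots> = ennreal e"
    by (simp add: nn_integral_cmult g1 N)
  finally have "has_bochner_integral ?M a e"
    using \<open>0 \<le> e\<close> by (intro has_bochner_integral_nn_integral) (auto simp: a_def)
  moreover have "has_bochner_integral ?M b e"
  proof -
    have "(\<integral>\<^sup>+z. ennreal (b z) \<partial>?M) = (\<integral>\<^sup>+(w :: real ^ 'n). \<integral>\<^sup>+x. ennreal (gauss w) * ennreal ((f (- (h *\<^sub>R w) + x))\<^sup>2) \<partial>lborel \<partial>lborel)"
      by (subst lborel_pair.nn_integral_snd[symmetric]) (simp_all add: b_def ennreal_mult mult.commute)
    also have "\<dots> = (\<integral>\<^sup>+w. ennreal (gauss (w :: real ^ 'n)) * ennreal e \<partial>lborel)"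
      by (subst nn_integral_cmult, measurable)
        (subst nn_integral_lborel_translation[of "\<lambda>x. ennreal ((f x)\<^sup>2)"], simp_all add: N)
    also have "\<dots> = ennreal e"
      by (simp add: nn_integral_multc g1)
    finally show ?thesis
      using \<open>0 \<le> e\<close> by (intro has_bochner_integral_nn_integral) (auto simp: b_def)
  qed
  ultimately have "has_bochner_integral ?M (\<lambda>z. a z + b z) (e + e)"
    by (rule has_bochner_integral_add)
  then have "has_bochner_integral ?M (\<lambda>z. (a z + b z) / 2) ((e + e) / 2)"
    by (rule has_bochner_integral_divide_zero)
  then have ab: "has_bochner_integral ?M (\<lambda>z. (a z + b z) / 2) e"
    by simp
  \<comment> \<open>|u v| \<le> (u^2 + v^2) / 2 provides the majorant (a + b) / 2.\<close>
  have p: "integrable ?M p"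
  proof (rule Bochner_Integration.integrable_bound)
    show "integrable ?M (\<lambda>z. (a z + b z) / 2)"
      using ab by (simp add: has_bochner_integral_iff)
    have "\<bar>u * v * g\<bar> \<le> \<bar>(u\<^sup>2 * g + v\<^sup>2 * g) / 2\<bar>" if "0 \<le> g" for u v g :: real
    proof -
      have "0 \<le> g * (\<bar>u\<bar> - \<bar>v\<bar>)\<^sup>2" using that by simp
      with that show ?thesis by (simp add: power2_eq_square abs_mult algebra_simps)
    qed
    then show "AE z in ?M. norm (p z) \<le> norm ((a z + b z) / 2)"
      by (auto simp: p_def a_def b_def split: prod.splits)
  qed simp
  have q_eq: "q z = (a z + b z) / 2 - p z" for z
    by (auto simp: q_def p_def a_def b_def power2_eq_square field_simps split: prod.splits)
  define A where "A = integral\<^sup>L ?M p"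
  have q: "has_bochner_integral ?M q (e - A)"
    unfolding q_eq[abs_def] A_def by (intro has_bochner_integral_diff ab has_bochner_integral_integrable p)
  have A: "(LINT \<xi>|lborel. (norm (fourier_integral f \<xi>))\<^sup>2 * exp (- (h * norm \<xi>)\<^sup>2 / 2)) = A"
  proof -
    have "A = (LINT x|lborel. LINT w|lborel. p (x, w))"
      unfolding A_def by (rule lborel_pair.integral_fst'[OF p, symmetric])
    also have "\<dots> = (LINT x|lborel. f x * (LINT w|lborel. f (x - h *\<^sub>R w) * gauss w))"
      by (simp add: p_def mult.assoc)
    finally show ?thesis
      using fourier_integral_gaussian_energy[OF f h] by (simp only: of_real_eq_iff)
  qed
  have "0 \<le> A"
    unfolding A[symmetric] by simp
  have "0 \<le> e - A"
  proof -
    have "0 \<le> integral\<^sup>L ?M q"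
      by (rule Bochner_Integration.integral_nonneg) (auto simp: q_def)
    then show ?thesis
      using q by (simp add: has_bochner_integral_iff)
  qed
  have "integrable lborel (\<lambda>\<xi>. (norm (fourier_integral f \<xi>))\<^sup>2 * exp (- (h * norm \<xi>)\<^sup>2 / 2))"
  proof (rule Bochner_Integration.integrable_bound)
    let ?B = "(LINT x|lborel. \<bar>f x\<bar>) / sqrt (2 * pi) ^ CARD('n)"
    have "integrable lborel (\<lambda>\<xi>::real^'n. complex_of_real (exp (- (h * norm \<xi>)\<^sup>2 / 2)))"
      using has_bochner_integral_gaussian_cis_euclidean[OF h, of "0::real^'n"]
      by (simp add: has_bochner_integral_iff scaleR_conv_of_real)
    then show "integrable lborel (\<lambda>\<xi>::real^'n. ?B\<^sup>2 * exp (- (h * norm \<xi>)\<^sup>2 / 2))"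
      by (intro integrable_mult_right) (simp only: complex_of_real_integrable_eq)
    show "AE \<xi> in lborel. norm ((norm (fourier_integral f \<xi>))\<^sup>2 * exp (- (h * norm \<xi>)\<^sup>2 / 2))
        \<le> norm (?B\<^sup>2 * exp (- (h * norm \<xi>)\<^sup>2 / 2))"
      using fourier_integral_norm_le[of f] by (auto simp: abs_mult intro!: mult_right_mono power_mono)
  qed measurable
  then have 1: "(\<integral>\<^sup>+\<xi>. ennreal ((norm (fourier_integral f \<xi>))\<^sup>2 * exp (- (h * norm \<xi>)\<^sup>2 / 2)) \<partial>lborel) = ennreal A"
    unfolding A[symmetric] by (rule nn_integral_eq_integral) simp
  have "ennreal (e - A) = (\<integral>\<^sup>+z. ennreal (q z) \<partial>?M)"
    using q by (subst nn_integral_eq_integral) (auto simp: has_bochner_integral_iff q_def)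
  also have "\<dots> = (\<integral>\<^sup>+w. \<integral>\<^sup>+x. ennreal (gauss w / 2) * ennreal ((f x - f (x - h *\<^sub>R w))\<^sup>2) \<partial>lborel \<partial>lborel)"
  proof -
    have "ennreal (q (x, w)) = ennreal (gauss w / 2) * ennreal ((f x - f (x - h *\<^sub>R w))\<^sup>2)" for x w
      by (subst ennreal_mult[symmetric]) (auto simp: q_def)
    then show ?thesis
      by (subst lborel_pair.nn_integral_snd[symmetric]) simp_all
  qed
  also have "\<dots> = (\<integral>\<^sup>+w. ennreal (gauss w / 2) * sq_integral (\<lambda>x. f x - f (x - h *\<^sub>R w)) \<partial>lborel)"
    by (subst nn_integral_cmult) simp_all
  finally show ?thesis
    using ennreal_plus[OF \<open>0 \<le> A\<close> \<open>0 \<le> e - A\<close>] unfolding 1 N by simp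
qed

section \<open>Continuity of translations in the mean square\<close>

lemma tendsto_0_ennrealI:
  fixes X :: "'a \<Rightarrow> ennreal"
  assumes "\<And>e::real. 0 < e \<Longrightarrow> eventually (\<lambda>n. X n \<le> ennreal e) F"
  shows "(X \<longlongrightarrow> 0) F"
proof (rule order_tendstoI)
  fix a :: ennreal assume "0 < a"
  then obtain e :: real where e: "0 < e" "ennreal e < a"
    by (metis dense ennreal_cases ennreal_less_iff ennreal_0 less_top_ennreal not_le order_less_imp_le order_refl top_greatest ennreal_less_zero_iff)
  show "eventually (\<lambda>n. X n < a) F"
    using assms[OF e(1)] by eventually_elim (use e in auto)
qed auto

lemma two_mult_ennreal: "2 * ennreal x = ennreal (2 * x)"
  by (simp add: ennreal_mult')

text \<open>Young's inequality under the integral. The free parameter lets the factor of the first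
  term approach 1 at the expense of the second, which an exact identity such as Plancherel's
  requires; for mere convergence the value 1 is enough.\<close>

lemma nn_integral_norm_square_triangle:
  fixes f g h :: "'a \<Rightarrow> 'b::{real_normed_vector, second_countable_topology}"
  assumes [measurable]: "f \<in> borel_measurable M" "g \<in> borel_measurable M" "h \<in> borel_measurable M"
    and \<eta>: "0 < \<eta>"
  shows "(\<integral>\<^sup>+x. ennreal ((norm (f x - g x))\<^sup>2) \<partial>M) \<le>
    ennreal (1 + \<eta>) * (\<integral>\<^sup>+x. ennreal ((norm (f x - h x))\<^sup>2) \<partial>M) +
    ennreal (1 + 1 / \<eta>) * (\<integral>\<^sup>+x. ennreal ((norm (h x - g x))\<^sup>2) \<partial>M)"
proof -
  have "ennreal ((norm (f x - g x))\<^sup>2) \<le>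
      ennreal (1 + \<eta>) * ennreal ((norm (f x - h x))\<^sup>2) + ennreal (1 + 1 / \<eta>) * ennreal ((norm (h x - g x))\<^sup>2)" for x
  proof -
    define a b where "a = norm (f x - h x)" and "b = norm (h x - g x)"
    have "(norm (f x - g x))\<^sup>2 \<le> (a + b)\<^sup>2"
      using norm_triangle_ineq[of "f x - h x" "h x - g x"]
      unfolding a_def b_def by (intro power_mono) simp_all
    \<comment> \<open>The added square is exactly the gap in 2 a b \<le> \<eta> a^2 + b^2 /
      \<eta>.\<close>
    also have "\<dots> \<le> (a + b)\<^sup>2 + (\<eta> * a - b)\<^sup>2 / \<eta>"
      using \<eta> by simp
    also have "\<dots> = (1 + \<eta>) * a\<^sup>2 + (1 + 1 / \<eta>) * b\<^sup>2"
      using \<eta> by (simp add: field_simps power2_eq_square)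
    finally have "ennreal ((norm (f x - g x))\<^sup>2) \<le> ennreal ((1 + \<eta>) * a\<^sup>2 + (1 + 1 / \<eta>) * b\<^sup>2)"
      by (rule ennreal_leI)
    then show ?thesis
      using \<eta> by (simp add: ennreal_mult a_def b_def)
  qed
  then have "(\<integral>\<^sup>+x. ennreal ((norm (f x - g x))\<^sup>2) \<partial>M) \<le>
      (\<integral>\<^sup>+x. ennreal (1 + \<eta>) * ennreal ((norm (f x - h x))\<^sup>2) + ennreal (1 + 1 / \<eta>) * ennreal ((norm (h x - g x))\<^sup>2) \<partial>M)"
    by (rule nn_integral_mono)
  also have "\<dots> = ennreal (1 + \<eta>) * (\<integral>\<^sup>+x. ennreal ((norm (f x - h x))\<^sup>2) \<partial>M) +
    ennreal (1 + 1 / \<eta>) * (\<integral>\<^sup>+x. ennreal ((norm (h x - g x))\<^sup>2) \<partial>M)"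
    by (simp add: nn_integral_add nn_integral_cmult)
  finally show ?thesis .
qed

lemma nn_integral_square_triangle:
  fixes f g h :: "'a \<Rightarrow> real"
  assumes [measurable]: "f \<in> borel_measurable M" "g \<in> borel_measurable M" "h \<in> borel_measurable M"
  shows "(\<integral>\<^sup>+x. ennreal ((f x - g x)\<^sup>2) \<partial>M) \<le>
    2 * (\<integral>\<^sup>+x. ennreal ((f x - h x)\<^sup>2) \<partial>M) + 2 * (\<integral>\<^sup>+x. ennreal ((h x - g x)\<^sup>2) \<partial>M)"
  using nn_integral_norm_square_triangle[of f M g h 1] assms by simp

text \<open>A cutoff in height and in space that is continuous in both arguments, unlike
  multiplication by an indicator. Applied to a continuous function it therefore yields a continuous
  function, now bounded and of bounded support.\<close>

definition cutoff :: "real \<Rightarrow> real \<Rightarrow> 'a::euclidean_space \<Rightarrow> real"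
  where "cutoff m y x = max (- m) (min m y) * max 0 (min 1 (m + 1 - norm x))"

lemma cutoff_bounds:
  assumes "0 \<le> m"
  shows "\<bar>cutoff m y x\<bar> \<le> m" "m + 1 \<le> norm x \<Longrightarrow> cutoff m y x = 0"
    "\<bar>y - cutoff m y x\<bar> \<le> \<bar>y\<bar>" "\<bar>y\<bar> \<le> m \<Longrightarrow> norm x \<le> m \<Longrightarrow> cutoff m y x = y"
proof -
  define u where "u = max (- m) (min m y)"
  define k where "k = max 0 (min 1 (m + 1 - norm x))"
  have c: "cutoff m y x = u * k" by (simp add: cutoff_def u_def k_def)
  have k: "0 \<le> k" "k \<le> 1" by (auto simp: k_def)
  have u: "\<bar>u\<bar> \<le> m" "\<bar>u\<bar> \<le> \<bar>y\<bar>" "0 \<le> y \<Longrightarrow> 0 \<le> u" "y \<le> 0 \<Longrightarrow> u \<le> 0"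
    using assms by (auto simp: u_def)
  have "\<bar>u * k\<bar> \<le> \<bar>u\<bar> * 1" unfolding abs_mult using k by (intro mult_left_mono) auto
  then have uk: "\<bar>u * k\<bar> \<le> \<bar>u\<bar>" by simp
  then show "\<bar>cutoff m y x\<bar> \<le> m" using u c by simp
  show "m + 1 \<le> norm x \<Longrightarrow> cutoff m y x = 0" by (simp add: cutoff_def)
  have "0 \<le> y \<Longrightarrow> 0 \<le> u * k" "y \<le> 0 \<Longrightarrow> u * k \<le> 0"
    using u k by (auto simp: mult_nonpos_nonneg)
  with uk u(2) show "\<bar>y - cutoff m y x\<bar> \<le> \<bar>y\<bar>" unfolding c by linarith
  show "\<bar>y\<bar> \<le> m \<Longrightarrow> norm x \<le> m \<Longrightarrow> cutoff m y x = y" by (simp add: cutoff_def)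
qed

lemma borel_measurable_cutoff [measurable]:
  fixes f :: "'a::euclidean_space \<Rightarrow> real"
  assumes [measurable]: "f \<in> borel_measurable borel"
  shows "(\<lambda>x. cutoff m (f x) x) \<in> borel_measurable borel"
  unfolding cutoff_def by measurable

lemma emeasure_lborel_cball_finite: "emeasure lborel (cball (a::'a::euclidean_space) r) < \<infinity>"
  using emeasure_bounded_finite[OF bounded_cball] by (simp add: less_top)

text \<open>Two dominated convergences: \<open>f\<close> is close to its cutoff at a large height
  \<open>k\<close>, and that cutoff is close to the cutoff of a continuous function near
  \<open>f\<close>. Each error is at most e/4 because the triangle inequality doubles both.\<close>

lemma square_integrable_approx_continuous:
  fixes f :: "'a::euclidean_space \<Rightarrow> real"
  assumes f[measurable]: "f \<in> borel_measurable borel" and f2: "sq_integral f < \<infinity>"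
    and "0 < e"
  obtains g m where "continuous_on UNIV g" "0 \<le> m" "\<And>x. \<bar>g x\<bar> \<le> m"
    "\<And>x. m + 1 \<le> norm x \<Longrightarrow> g x = 0" "sq_integral (\<lambda>x. f x - g x) \<le> ennreal e"
proof -
  have "(\<lambda>k. sq_integral (\<lambda>x. f x - cutoff (real k) (f x) x)) \<longlonglongrightarrow> (\<integral>\<^sup>+x. 0 \<partial>(lborel :: 'a measure))"
  proof (rule nn_integral_dominated_convergence[OF _ _ _ _ f2])
    show "AE x in lborel. ennreal ((f x - cutoff (real k) (f x) x)\<^sup>2) \<le> ennreal ((f x)\<^sup>2)" for k
      using cutoff_bounds(3)[of "real k"] by (auto intro!: ennreal_leI simp: abs_le_square_iff[symmetric])
    show "AE x in lborel. (\<lambda>k. ennreal ((f x - cutoff (real k) (f x) x)\<^sup>2)) \<longlonglongrightarrow> 0"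
    proof (rule AE_I2)
      fix x
      have "eventually (\<lambda>k. ennreal ((f x - cutoff (real k) (f x) x)\<^sup>2) = 0) sequentially"
        using eventually_ge_at_top[of "nat \<lceil>max \<bar>f x\<bar> (norm x)\<rceil>"]
      proof eventually_elim
        case (elim k)
        then have "max \<bar>f x\<bar> (norm x) \<le> real k" by linarith
        then show ?case using cutoff_bounds(4)[of "real k" "f x" x] by simp
      qed
      then show "(\<lambda>k. ennreal ((f x - cutoff (real k) (f x) x)\<^sup>2)) \<longlonglongrightarrow> 0"
        by (rule tendsto_eventually)
    qed
  qed auto
  then have "eventually (\<lambda>k. (sq_integral (\<lambda>x. f x - cutoff (real k) (f x) x)) < ennreal (e / 4)) sequentially"
    using \<open>0 < e\<close> by (intro order_tendstoD(2)[of _ 0]) auto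
  then obtain k :: nat where k: "sq_integral (\<lambda>x. f x - cutoff (real k) (f x) x) < ennreal (e / 4)"
    by (auto dest: eventually_happens)
  have "f \<in> borel_measurable lebesgue"
    by (simp add: measurable_completion)
  \<comment> \<open>This form of measurability supplies continuous functions that converge to
    \<open>f\<close> off a negligible set, with no control of their size. The cutoff gives them a
    common bound and a common support, hence a majorant.\<close>
  then have "f measurable_on UNIV"
    by (rule lebesgue_measurable_imp_measurable_on) simp
  then obtain N g where N: "negligible N" and gc: "\<And>n. continuous_on UNIV (g n)"
    and gl: "\<And>x. x \<notin> N \<Longrightarrow> (\<lambda>n. g n x) \<longlonglongrightarrow> f x"
    by (auto simp: measurable_on_def)
  have [measurable]: "g n \<in> borel_measurable borel" for n
    using gc by (rule borel_measurable_continuous_onI)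
  have "AE x in lebesgue. x \<notin> N"
    using N by (simp add: negligible_iff_null_sets AE_not_in)
  then have N': "AE x in lborel. x \<notin> N"
    by (simp add: AE_completion_iff)
  have "(\<lambda>n. sq_integral (\<lambda>x. cutoff k (f x) x - cutoff k (g n x) x)) \<longlonglongrightarrow> (\<integral>\<^sup>+x. 0 \<partial>(lborel :: 'a measure))"
  proof (rule nn_integral_dominated_convergence)
    let ?w = "\<lambda>x::'a. ennreal ((2 * real k)\<^sup>2) * indicator (cball 0 (real k + 1)) x"
    show "AE x in lborel. ennreal ((cutoff k (f x) x - cutoff k (g n x) x)\<^sup>2) \<le> ?w x" for n
    proof (rule AE_I2)
      fix x
      have "\<bar>cutoff k (f x) x - cutoff k (g n x) x\<bar> \<le> \<bar>2 * real k\<bar>"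
        using cutoff_bounds(1)[of "real k" "f x" x] cutoff_bounds(1)[of "real k" "g n x" x] by linarith
      then have "(cutoff k (f x) x - cutoff k (g n x) x)\<^sup>2 \<le> (2 * real k)\<^sup>2"
        by (simp only: abs_le_square_iff)
      then show "ennreal ((cutoff k (f x) x - cutoff k (g n x) x)\<^sup>2) \<le> ?w x"
        using cutoff_bounds(2)[of "real k" x "f x"] cutoff_bounds(2)[of "real k" x "g n x"]
        by (auto simp: indicator_def intro!: ennreal_leI)
    qed
    show "(\<integral>\<^sup>+x. ?w x \<partial>lborel) < \<infinity>"
      using emeasure_lborel_cball_finite[of 0 "real k + 1"]
      by (subst nn_integral_cmult_indicator) (auto simp: ennreal_mult_less_top)
    show "AE x in lborel. (\<lambda>n. ennreal ((cutoff k (f x) x - cutoff k (g n x) x)\<^sup>2)) \<longlonglongrightarrow> 0"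
      using N'
    proof eventually_elim
      case (elim x)
      have "(\<lambda>n. cutoff k (g n x) x) \<longlonglongrightarrow> cutoff k (f x) x"
        unfolding cutoff_def by (intro tendsto_intros gl elim)
      then have "(\<lambda>n. (cutoff k (f x) x - cutoff k (g n x) x)\<^sup>2) \<longlonglongrightarrow> (cutoff k (f x) x - cutoff k (f x) x)\<^sup>2"
        by (intro tendsto_intros)
      from tendsto_ennrealI[OF this] show ?case by simp
    qed
  qed measurable
  then have "eventually (\<lambda>n. (sq_integral (\<lambda>x. cutoff k (f x) x - cutoff k (g n x) x)) < ennreal (e / 4)) sequentially"
    using \<open>0 < e\<close> by (intro order_tendstoD(2)[of _ 0]) auto
  then obtain n where n: "sq_integral (\<lambda>x. cutoff k (f x) x - cutoff k (g n x) x) < ennreal (e / 4)"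
    by (auto dest: eventually_happens)
  show ?thesis
  proof (rule that[of "\<lambda>x. cutoff k (g n x) x" "real k"])
    show "continuous_on UNIV (\<lambda>x. cutoff k (g n x) x)"
      unfolding cutoff_def by (intro continuous_intros gc)
    have "sq_integral (\<lambda>x. f x - cutoff k (g n x) x) \<le> 2 * ennreal (e / 4) + 2 * ennreal (e / 4)"
      by (rule order_trans[OF nn_integral_square_triangle[where h="\<lambda>x. cutoff k (f x) x"]], measurable)
        (intro add_mono mult_left_mono less_imp_le[OF k] less_imp_le[OF n]; simp)
    also have "\<dots> = ennreal (2 * (e / 4) + 2 * (e / 4))"
      using \<open>0 < e\<close> by (simp add: two_mult_ennreal del: ennreal_plus flip: ennreal_plus)
    finally show "sq_integral (\<lambda>x. f x - cutoff k (g n x) x) \<le> ennreal e"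
      by simp
  qed (use cutoff_bounds[of "real k"] in auto)
qed

text \<open>For a continuous function of bounded support, dominated convergence applies; the two
  errors made in replacing \<open>f\<close> and its translate are equal by translation invariance.
  After the doublings the three errors of size e/16 add up to 10 e/16.\<close>

lemma square_integrable_translation_continuous:
  fixes f :: "'a::euclidean_space \<Rightarrow> real" and z :: "nat \<Rightarrow> 'a"
  assumes f[measurable]: "f \<in> borel_measurable borel" and f2: "sq_integral f < \<infinity>"
    and z: "z \<longlonglongrightarrow> 0"
  shows "(\<lambda>n. sq_integral (\<lambda>x. f x - f (x - z n))) \<longlonglongrightarrow> 0"
proof (rule tendsto_0_ennrealI)
  fix e :: real assume "0 < e"
  then have "0 < e / 16" by simp
  from square_integrable_approx_continuous[OF f f2 this]
  obtain g m where g: "continuous_on UNIV g" "0 \<le> m" "\<And>x. \<bar>g x\<bar> \<le> m"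
    "\<And>x. m + 1 \<le> norm x \<Longrightarrow> g x = 0" and fg: "sq_integral (\<lambda>x. f x - g x) \<le> ennreal (e / 16)"
    by blast
  have [measurable]: "g \<in> borel_measurable borel"
    using g(1) by (rule borel_measurable_continuous_onI)
  \<comment> \<open>A bound on the shifts places the supports of \<open>g\<close> and of all its
    translates in one ball, which carries the majorant.\<close>
  obtain B where B: "\<And>n. norm (z n) \<le> B"
    using z by (metis convergent_imp_Bseq convergent_def BseqE)
  have "(\<lambda>n. sq_integral (\<lambda>x. g x - g (x - z n))) \<longlonglongrightarrow> (\<integral>\<^sup>+x. 0 \<partial>(lborel :: 'a measure))"
  proof (rule nn_integral_dominated_convergence)
    let ?w = "\<lambda>x::'a. ennreal ((2 * m)\<^sup>2) * indicator (cball 0 (m + 1 + B)) x"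
    show "AE x in lborel. ennreal ((g x - g (x - z n))\<^sup>2) \<le> ?w x" for n
    proof (rule AE_I2)
      fix x
      have "\<bar>g x - g (x - z n)\<bar> \<le> \<bar>2 * m\<bar>"
        using g(3)[of x] g(3)[of "x - z n"] g(2) by linarith
      then have *: "(g x - g (x - z n))\<^sup>2 \<le> (2 * m)\<^sup>2"
        by (simp only: abs_le_square_iff)
      have "g x = 0 \<and> g (x - z n) = 0" if "x \<notin> cball 0 (m + 1 + B)"
        using that B[of n] norm_triangle_ineq2[of x "z n"] norm_ge_zero[of "z n"]
        by (intro conjI g(4)) (auto simp del: norm_ge_zero)
      with * show "ennreal ((g x - g (x - z n))\<^sup>2) \<le> ?w x"
        by (auto simp: indicator_def intro!: ennreal_leI)
    qed
    show "(\<integral>\<^sup>+x. ?w x \<partial>lborel) < \<infinity>"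
      using emeasure_lborel_cball_finite[of 0 "m + 1 + B"]
      by (subst nn_integral_cmult_indicator) (auto simp: ennreal_mult_less_top)
    show "AE x in lborel. (\<lambda>n. ennreal ((g x - g (x - z n))\<^sup>2)) \<longlonglongrightarrow> 0"
    proof (rule AE_I2)
      fix x
      have "(\<lambda>n. x - z n) \<longlonglongrightarrow> x - 0"
        using z by (intro tendsto_intros)
      then have "(\<lambda>n. g (x - z n)) \<longlonglongrightarrow> g x"
        using g(1) by (intro continuous_on_tendsto_compose[of UNIV g]) auto
      then have "(\<lambda>n. (g x - g (x - z n))\<^sup>2) \<longlonglongrightarrow> (g x - g x)\<^sup>2"
        by (intro tendsto_intros)
      from tendsto_ennrealI[OF this] show "(\<lambda>n. ennreal ((g x - g (x - z n))\<^sup>2)) \<longlonglongrightarrow> 0"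
        by simp
    qed
  qed measurable
  then have "eventually (\<lambda>n. (sq_integral (\<lambda>x. g x - g (x - z n))) < ennreal (e / 16)) sequentially"
    using \<open>0 < e\<close> by (intro order_tendstoD(2)[of _ 0]) auto
  then show "eventually (\<lambda>n. (sq_integral (\<lambda>x. f x - f (x - z n))) \<le> ennreal e) sequentially"
  proof eventually_elim
    case (elim n)
    have tr: "sq_integral (\<lambda>x. g (x - z n) - f (x - z n)) \<le> ennreal (e / 16)"
      using nn_integral_lborel_translation[of "\<lambda>x. ennreal ((g x - f x)\<^sup>2)" "- z n"] fg
      by (simp add: power2_commute)
    have "sq_integral (\<lambda>x. f x - f (x - z n)) \<le>
        2 * sq_integral (\<lambda>x. f x - g x) + 2 * sq_integral (\<lambda>x. g x - f (x - z n))"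
      by (rule nn_integral_square_triangle) auto
    also have "\<dots> \<le> 2 * ennreal (e / 16) + 2 * (2 * ennreal (e / 16) + 2 * ennreal (e / 16))"
      by (intro add_mono mult_left_mono fg order_trans[OF nn_integral_square_triangle[where h="\<lambda>x. g (x - z n)"]]
          tr less_imp_le[OF elim]) auto
    also have "\<dots> = ennreal (2 * (e / 16) + 2 * (2 * (e / 16) + 2 * (e / 16)))"
      using \<open>0 < e\<close> by (simp add: two_mult_ennreal del: ennreal_plus flip: ennreal_plus)
    also have "\<dots> \<le> ennreal e"
      using \<open>0 < e\<close> by (intro ennreal_leI) simp
    finally show ?case .
  qed
qed

text \<open>As \<open>h\<close> decreases to 0 the damped energy increases, so monotone convergence
  yields the full energy with no prior knowledge that it is finite. The defect is handled by
  dominated convergence, since a translate differs from \<open>f\<close> by at most 4 N in squared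
  mean.\<close>

lemma plancherel_L1_L2:
  fixes f :: "real ^ 'n \<Rightarrow> real"
  assumes f: "integrable lborel f" and f2: "integrable lborel (\<lambda>x. (f x)\<^sup>2)"
  shows "sq_norm_integral (fourier_integral f) = sq_integral f"
proof -
  have [measurable]: "f \<in> borel_measurable borel"
    using f by auto
  define N where "N = sq_integral f"
  have N: "N < \<infinity>"
    using f2 by (simp add: N_def integrable_iff_bounded)
  define h where "h n = 1 / real (Suc n)" for n
  have h: "0 < h n" for n by (simp add: h_def)
  have h0: "h \<longlonglongrightarrow> 0"
    unfolding h_def using LIMSEQ_inverse_real_of_nat by (simp add: inverse_eq_divide)
  have hdec: "h n \<le> h m" if "m \<le> n" for m n
    using that by (auto simp: h_def intro!: divide_left_mono)
  define T where "T z = sq_integral (\<lambda>x. f x - f (x - z))" for z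
  have [measurable]: "T \<in> borel_measurable borel"
    unfolding T_def by measurable
  have T_le: "T z \<le> 4 * N" for z
  proof -
    have "T z \<le> 2 * sq_integral (\<lambda>x. f x - 0) + 2 * sq_integral (\<lambda>x. 0 - f (x - z))"
      unfolding T_def by (rule nn_integral_square_triangle) auto
    also have "sq_integral (\<lambda>x. 0 - f (x - z)) = N"
      unfolding N_def using nn_integral_lborel_translation[of "\<lambda>x. ennreal ((f x)\<^sup>2)" "- z"]
      by simp
    also have "2 * sq_integral (\<lambda>x. f x - 0) + 2 * N = 4 * N"
      unfolding N_def by (simp flip: distrib_right)
    finally show ?thesis .
  qed
  have "(\<lambda>n. \<integral>\<^sup>+w. ennreal (gauss w / 2) * T (h n *\<^sub>R w) \<partial>lborel) \<longlonglongrightarrow> (\<integral>\<^sup>+(w::real^'n). 0 \<partial>lborel)"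
  proof (rule nn_integral_dominated_convergence)
    show "AE w in lborel. ennreal (gauss w / 2) * T (h n *\<^sub>R w) \<le> ennreal (gauss w / 2) * (4 * N)" for n
      by (auto intro!: mult_left_mono T_le)
    have "has_bochner_integral lborel (\<lambda>w::real^'n. gauss w / 2) (1 / 2)"
      by (rule has_bochner_integral_divide_zero[OF has_bochner_integral_gauss])
    then have "(\<integral>\<^sup>+w. ennreal (gauss (w::real^'n) / 2) \<partial>lborel) = ennreal (1 / 2)"
      by (subst nn_integral_eq_integral) (auto simp: has_bochner_integral_iff)
    then have "(\<integral>\<^sup>+w. ennreal (gauss (w::real^'n) / 2) \<partial>lborel) < top"
      by (simp only: ennreal_less_top)
    then show "(\<integral>\<^sup>+(w::real^'n). ennreal (gauss w / 2) * (4 * N) \<partial>lborel) < \<infinity>"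
      using N by (simp add: nn_integral_multc ennreal_mult_less_top)
    show "AE w in lborel. (\<lambda>n. ennreal (gauss w / 2) * T (h n *\<^sub>R w)) \<longlonglongrightarrow> 0"
    proof (rule AE_I2)
      fix w :: "real ^ 'n"
      have "(\<lambda>n. h n *\<^sub>R w) \<longlonglongrightarrow> 0 *\<^sub>R w"
        by (intro tendsto_intros h0)
      then have "(\<lambda>n. T (h n *\<^sub>R w)) \<longlonglongrightarrow> 0"
        unfolding T_def using N by (intro square_integrable_translation_continuous) (auto simp: N_def)
      then have "(\<lambda>n. ennreal (gauss w / 2) * T (h n *\<^sub>R w)) \<longlonglongrightarrow> ennreal (gauss w / 2) * 0"
        by (intro ennreal_tendsto_cmult) auto
      then show "(\<lambda>n. ennreal (gauss w / 2) * T (h n *\<^sub>R w)) \<longlonglongrightarrow> 0" by simp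
    qed
  qed auto
  moreover have "(\<lambda>n. \<integral>\<^sup>+\<xi>. ennreal ((norm (fourier_integral f \<xi>))\<^sup>2 * exp (- (h n * norm \<xi>)\<^sup>2 / 2)) \<partial>lborel)
      \<longlonglongrightarrow> sq_norm_integral (fourier_integral f)"
  proof (rule nn_integral_LIMSEQ)
    show "incseq (\<lambda>n \<xi>. ennreal ((norm (fourier_integral f \<xi>))\<^sup>2 * exp (- (h n * norm \<xi>)\<^sup>2 / 2)))"
      using hdec less_imp_le[OF h]
      by (auto simp: incseq_def le_fun_def intro!: ennreal_leI mult_left_mono power_mono mult_right_mono)
    fix \<xi> :: "real ^ 'n"
    have "(\<lambda>n. (norm (fourier_integral f \<xi>))\<^sup>2 * exp (- (h n * norm \<xi>)\<^sup>2 / 2)) \<longlonglongrightarrow>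
        (norm (fourier_integral f \<xi>))\<^sup>2 * exp (- (0 * norm \<xi>)\<^sup>2 / 2)"
      by (intro tendsto_intros h0) auto
    from tendsto_ennrealI[OF this]
    show "(\<lambda>n. ennreal ((norm (fourier_integral f \<xi>))\<^sup>2 * exp (- (h n * norm \<xi>)\<^sup>2 / 2))) \<longlonglongrightarrow>
        ennreal ((norm (fourier_integral f \<xi>))\<^sup>2)"
      by simp
  qed auto
  ultimately have "(\<lambda>n. (\<integral>\<^sup>+\<xi>. ennreal ((norm (fourier_integral f \<xi>))\<^sup>2 * exp (- (h n * norm \<xi>)\<^sup>2 / 2)) \<partial>lborel) +
      (\<integral>\<^sup>+w. ennreal (gauss w / 2) * T (h n *\<^sub>R w) \<partial>lborel)) \<longlonglongrightarrow>
      sq_norm_integral (fourier_integral f) + (\<integral>\<^sup>+(w::real^'n). 0 \<partial>lborel)"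
    by (intro tendsto_add)
  \<comment> \<open>By the energy identity this sequence is constant, so its value equals its
    limit.\<close>
  then show ?thesis
    unfolding T_def gaussian_energy_identity[OF f f2 h] by (simp add: LIMSEQ_const_iff)
qed

section \<open>Extension of the transform to square integrable functions\<close>

lemma L2_truncation:
  fixes f :: "real ^ 'n \<Rightarrow> real"
  assumes f: "f \<in> L2"
  shows "integrable lborel (\<lambda>x. indicator (ball 0 R) x * f x)"
    "integrable lborel (\<lambda>x. (indicator (ball 0 R) x * f x)\<^sup>2)"
proof -
  have [measurable]: "f \<in> borel_measurable borel" and f2: "integrable lborel (\<lambda>x. (f x)\<^sup>2)"
    using f by (auto simp: L2_def)
  show "integrable lborel (\<lambda>x. (indicator (ball 0 R) x * f x)\<^sup>2)"
    using f2 by (rule Bochner_Integration.integrable_bound) (auto simp: indicator_def)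
  have "emeasure lborel (ball (0 :: real ^ 'n) R) < \<infinity>"
    using emeasure_bounded_finite[OF bounded_ball] by (simp add: less_top)
  then have "integrable lborel (\<lambda>x::real^'n. indicator (ball 0 R) x :: real)"
    by (intro integrable_real_indicator) auto
  then have "integrable lborel (\<lambda>x. indicator (ball 0 R) x + (f x)\<^sup>2)"
    using f2 by (rule Bochner_Integration.integrable_add)
  then show "integrable lborel (\<lambda>x. indicator (ball 0 R) x * f x)"
  proof (rule Bochner_Integration.integrable_bound)
    \<comment> \<open>This is why a square integrable function is integrable on a set of finite
      measure.\<close>
    have "\<bar>f x\<bar> \<le> 1 + (f x)\<^sup>2" for x
      using sum_squares_bound[of "\<bar>f x\<bar>" 1] by (auto simp: power2_eq_square)
    then show "AE x in lborel. norm (indicator (ball 0 R) x * f x) \<le> norm (indicator (ball 0 R) x + (f x)\<^sup>2)"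
      by (auto simp: indicator_def)
  qed simp
qed

lemma fourier_integral_diff:
  assumes "integrable lborel f" "integrable lborel g"
  shows "fourier_integral (\<lambda>x. f x - g x) \<xi> = fourier_integral f \<xi> - fourier_integral g \<xi>"
proof -
  have [measurable]: "f \<in> borel_measurable borel" "g \<in> borel_measurable borel"
    using assms by auto
  have "integrable lborel (\<lambda>x. f x *\<^sub>R cis (- (x \<bullet> \<xi>)))" "integrable lborel (\<lambda>x. g x *\<^sub>R cis (- (x \<bullet> \<xi>)))"
    by (rule Bochner_Integration.integrable_bound[OF assms(1)], measurable)
      (rule Bochner_Integration.integrable_bound[OF assms(2)], measurable)
  then show ?thesis
    by (simp add: fourier_integral_def scaleR_diff_left scaleR_diff_right)
qed

abbreviation fourier_ball :: "(real ^ 'n \<Rightarrow> real) \<Rightarrow> real \<Rightarrow> real ^ 'n \<Rightarrow> complex"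
  where "fourier_ball f R \<equiv> fourier_integral (\<lambda>x. indicator (ball 0 R) x * f x)"

definition tail_energy :: "(real ^ 'n \<Rightarrow> real) \<Rightarrow> real \<Rightarrow> ennreal"
  where "tail_energy f R = sq_integral (\<lambda>x. indicator (- ball 0 R) x * f x)"

lemma L2D:
  assumes "f \<in> L2"
  shows "f \<in> borel_measurable borel" "integrable lborel (\<lambda>x. (norm (f x))\<^sup>2)"
    "sq_norm_integral f < \<infinity>"
  using assms by (auto simp: L2_def integrable_iff_bounded)

lemma L2I:
  assumes "f \<in> borel_measurable borel" "sq_norm_integral f < \<infinity>"
  shows "f \<in> L2"
  using assms by (auto simp: L2_def integrable_iff_bounded)

lemma tail_energy_tendsto:
  assumes f: "f \<in> L2"
  shows "(tail_energy f \<longlongrightarrow> 0) at_top"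
proof -
  have [measurable]: "f \<in> borel_measurable borel"
    using f by (rule L2D)
  have seq: "(\<lambda>n. tail_energy f (real n)) \<longlonglongrightarrow> (\<integral>\<^sup>+x. 0 \<partial>(lborel :: (real ^ 'a) measure))"
    unfolding tail_energy_def
  proof (rule nn_integral_dominated_convergence[OF _ _ _ _ L2D(3)[OF f]])
    show "AE x in lborel. (\<lambda>n. ennreal ((indicator (- ball 0 (real n)) x * f x)\<^sup>2)) \<longlonglongrightarrow> 0"
    proof (rule AE_I2)
      fix x :: "real ^ 'a"
      have "eventually (\<lambda>n. ennreal ((indicator (- ball 0 (real n)) x * f x)\<^sup>2) = 0) sequentially"
        using eventually_gt_at_top[of "nat \<lceil>norm x\<rceil>"]
        by eventually_elim (auto simp: indicator_def, linarith)
      then show "(\<lambda>n. ennreal ((indicator (- ball 0 (real n)) x * f x)\<^sup>2)) \<longlonglongrightarrow> 0"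
        by (rule tendsto_eventually)
    qed
  qed (auto simp: indicator_def)
  show ?thesis
  proof (rule tendsto_0_ennrealI)
    fix e :: real assume "0 < e"
    with seq have "eventually (\<lambda>n. tail_energy f (real n) < ennreal e) sequentially"
      by (intro order_tendstoD(2)[of _ 0]) auto
    then obtain n where n: "tail_energy f (real n) < ennreal e"
      by (auto dest: eventually_happens)
    have "tail_energy f R \<le> tail_energy f (real n)" if "real n \<le> R" for R
      unfolding tail_energy_def using that
      by (intro nn_integral_mono) (auto simp: indicator_def)
    then show "eventually (\<lambda>R. tail_energy f R \<le> ennreal e) at_top"
      using n by (auto simp: eventually_at_top_linorder intro!: exI[of _ "real n"] intro: order_trans less_imp_le)
  qed
qed

text \<open>Plancherel on the shell between the two radii. The bound is free of \<open>S\<close>,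
  which makes the transforms over balls Cauchy and survives the passage to the limit in
  \<open>S\<close>.\<close>

lemma fourier_ball_diff:
  assumes f: "f \<in> L2" and "R \<le> S"
  shows "sq_norm_integral (\<lambda>\<xi>. fourier_ball f R \<xi> - fourier_ball f S \<xi>) \<le> tail_energy f R"
proof -
  have [measurable]: "f \<in> borel_measurable borel"
    using f by (rule L2D)
  let ?g = "\<lambda>x. indicator (ball 0 R) x * f x - indicator (ball 0 S) x * f x"
  have "integrable lborel (\<lambda>x. (?g x)\<^sup>2)"
    by (rule Bochner_Integration.integrable_bound[OF L2D(2)[OF f]]) (auto simp: indicator_def)
  then have "sq_norm_integral (fourier_integral ?g) = sq_integral ?g"
    using L2_truncation(1)[OF f] by (intro plancherel_L1_L2 Bochner_Integration.integrable_diff)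
  also have "\<dots> \<le> tail_energy f R"
    unfolding tail_energy_def using \<open>R \<le> S\<close>
    by (intro nn_integral_mono) (auto simp: indicator_def)
  finally show ?thesis
    by (simp only: fourier_integral_diff[OF L2_truncation(1)[OF f] L2_truncation(1)[OF f]])
qed

text \<open>The geometric weights trade squares for absolute values, so that mean square estimates
  of the increments give convergence at almost every point.\<close>

lemma convergent_if_summable_weighted_squares:
  fixes G :: "nat \<Rightarrow> 'a::banach"
  assumes "summable (\<lambda>k. 2 ^ k * (norm (G (Suc k) - G k))\<^sup>2)"
  shows "convergent G"
proof -
  have "summable (\<lambda>k. G (Suc k) - G k)"
  proof (rule summable_norm_cancel, rule summable_comparison_test')
    show "summable (\<lambda>k. (1 / 2) ^ k + 2 ^ k * (norm (G (Suc k) - G k))\<^sup>2)"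
      by (intro summable_add assms summable_geometric) simp
    fix k :: nat
    define d where "d = norm (G (Suc k) - G k)"
    \<comment> \<open>AM-GM: \<open>2 d \<le> 2\<^bsup>-k\<^esup> + 2\<^sup>k d\<^sup>2\<close>\<close>
    have "0 \<le> (1 / 2) ^ k * (1 - 2 ^ k * d)\<^sup>2 + (1 / 2) ^ k"
      by simp
    also have "\<dots> = 2 * ((1 / 2) ^ k - d) + 2 ^ k * d\<^sup>2"
      by (simp add: power2_eq_square algebra_simps power_one_over)
    finally have "d \<le> (1 / 2) ^ k + 2 ^ k * d\<^sup>2"
      using zero_le_power2[of d] by (smt (verit) mult_nonneg_nonneg zero_le_power)
    then show "norm (norm (G (Suc k) - G k)) \<le> (1 / 2) ^ k + 2 ^ k * (norm (G (Suc k) - G k))\<^sup>2"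
      by (simp add: d_def)
  qed
  then have "(\<lambda>n. \<Sum>k<n. G (Suc k) - G k) \<longlonglongrightarrow> (\<Sum>k. G (Suc k) - G k)"
    by (rule summable_LIMSEQ)
  then have "(\<lambda>n. G n - G 0) \<longlonglongrightarrow> (\<Sum>k. G (Suc k) - G k)"
    by (simp add: sum_lessThan_telescope)
  from tendsto_add[OF this tendsto_const[of "G 0"]] show ?thesis
    by (auto simp: convergent_def)
qed

text \<open>The Riesz-Fischer argument for the transforms over balls. Radii with tail energy at most
  4^-k leave room for the weights 2^k, so almost everywhere convergence holds along them; Fatou's
  lemma then turns the pointwise limit into a limit in the mean along all radii.\<close>

lemma fourier_exists:
  fixes f :: "real ^ 'n \<Rightarrow> real"
  assumes f: "f \<in> L2"
  shows "\<exists>g. g \<in> L2 \<and>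
    ((\<lambda>R. sq_norm_integral (\<lambda>\<xi>. fourier_ball f R \<xi> - g \<xi>)) \<longlongrightarrow> 0) at_top"
proof -
  have [measurable]: "f \<in> borel_measurable borel"
    using f by (rule L2D)
  have "\<exists>m::nat. \<forall>R\<ge>real m. tail_energy f R \<le> ennreal ((1 / 4) ^ k)" for k
  proof -
    have "eventually (\<lambda>R. tail_energy f R < ennreal ((1 / 4) ^ k)) at_top"
      using tail_energy_tendsto[OF f] by (rule order_tendstoD) simp
    then obtain R where "\<And>S. R \<le> S \<Longrightarrow> tail_energy f S < ennreal ((1 / 4) ^ k)"
      by (auto simp: eventually_at_top_linorder)
    then show ?thesis
    proof (intro exI[of _ "nat \<lceil>R\<rceil>"] allI impI)
      fix S assume "real (nat \<lceil>R\<rceil>) \<le> S"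
      then have "R \<le> S" by linarith
      then show "tail_energy f S \<le> ennreal ((1 / 4) ^ k)"
        using \<open>\<And>S. R \<le> S \<Longrightarrow> _\<close> less_imp_le by blast
    qed
  qed
  then obtain m :: "nat \<Rightarrow> nat" where m: "\<And>k R. real (m k) \<le> R \<Longrightarrow> tail_energy f R \<le> ennreal ((1 / 4) ^ k)"
    by metis
  \<comment> \<open>The sum makes \<open>r\<close> increasing and at least \<open>m k\<close>; the
    summand \<open>k\<close> makes it unbounded.\<close>
  define r where "r k = real (k + (\<Sum>j\<le>k. m j))" for k
  have r: "tail_energy f (r k) \<le> ennreal ((1 / 4) ^ k)" for k
  proof (rule m)
    have "m k \<le> (\<Sum>j\<le>k. m j)"
      by (rule member_le_sum) auto
    then show "real (m k) \<le> r k"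
      unfolding r_def of_nat_le_iff by (rule trans_le_add2)
  qed
  have r_Suc: "r k \<le> r (Suc k)" for k
    by (simp add: r_def)
  have r_ge: "real k \<le> r k" for k
    unfolding r_def of_nat_le_iff by (rule le_add1)
  define G where "G k = fourier_ball f (r k)" for k
  have [measurable]: "G k \<in> borel_measurable borel" for k
    unfolding G_def by measurable
  define g where "g \<xi> = lim (\<lambda>k. G k \<xi>)" for \<xi>
  have [measurable]: "g \<in> borel_measurable borel"
    unfolding g_def by measurable
  have "(\<integral>\<^sup>+\<xi>. (\<Sum>k. ennreal (2 ^ k * (norm (G (Suc k) \<xi> - G k \<xi>))\<^sup>2)) \<partial>lborel) =
      (\<Sum>k. (\<integral>\<^sup>+\<xi>. ennreal (2 ^ k * (norm (G (Suc k) \<xi> - G k \<xi>))\<^sup>2) \<partial>lborel))"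
    by (rule nn_integral_suminf) measurable
  also have "\<dots> \<le> (\<Sum>k. ennreal ((1 / 2) ^ k))"
  proof (rule suminf_le)
    fix k
    have "(\<integral>\<^sup>+\<xi>. ennreal (2 ^ k * (norm (G (Suc k) \<xi> - G k \<xi>))\<^sup>2) \<partial>lborel) =
        ennreal (2 ^ k) * sq_norm_integral (\<lambda>\<xi>. G k \<xi> - G (Suc k) \<xi>)"
      by (simp add: ennreal_mult nn_integral_cmult norm_minus_commute)
    also have "\<dots> \<le> ennreal (2 ^ k) * ennreal ((1 / 4) ^ k)"
      unfolding G_def by (intro mult_left_mono order_trans[OF fourier_ball_diff[OF f r_Suc] r]) simp
    also have "\<dots> = ennreal ((1 / 2) ^ k)"
      by (simp flip: ennreal_mult power_mult_distrib)
    finally show "(\<integral>\<^sup>+\<xi>. ennreal (2 ^ k * (norm (G (Suc k) \<xi> - G k \<xi>))\<^sup>2) \<partial>lborel) \<le> ennreal ((1 / 2) ^ k)" .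
  qed auto
  also have "\<dots> = ennreal (\<Sum>k. (1 / 2) ^ k)"
    by (rule suminf_ennreal2) (auto intro: summable_geometric)
  finally have "(\<integral>\<^sup>+\<xi>. (\<Sum>k. ennreal (2 ^ k * (norm (G (Suc k) \<xi> - G k \<xi>))\<^sup>2)) \<partial>lborel) \<noteq> \<infinity>"
    by (auto simp: top_unique)
  then have "AE \<xi> in lborel. (\<Sum>k. ennreal (2 ^ k * (norm (G (Suc k) \<xi> - G k \<xi>))\<^sup>2)) \<noteq> \<infinity>"
    by (intro nn_integral_PInf_AE) measurable
  then have lim: "AE \<xi> in lborel. (\<lambda>k. G k \<xi>) \<longlonglongrightarrow> g \<xi>"
  proof eventually_elim
    case (elim \<xi>)
    then have "summable (\<lambda>k. 2 ^ k * (norm (G (Suc k) \<xi> - G k \<xi>))\<^sup>2)"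
      by (intro summable_suminf_not_top) auto
    then show ?case
      unfolding g_def convergent_LIMSEQ_iff[symmetric] by (rule convergent_if_summable_weighted_squares)
  qed
  \<comment> \<open>Fatou in the outer radius: the bound of \<open>fourier_ball_diff\<close> is
    uniform in that radius and passes to the limit \<open>g\<close>.\<close>
  have le: "sq_norm_integral (\<lambda>\<xi>. fourier_ball f R \<xi> - g \<xi>) \<le> tail_energy f R" for R
  proof -
    have "sq_norm_integral (\<lambda>\<xi>. fourier_ball f R \<xi> - g \<xi>) =
        (\<integral>\<^sup>+ \<xi>. liminf (\<lambda>k. ennreal ((norm (fourier_ball f R \<xi> - G k \<xi>))\<^sup>2)) \<partial>lborel)"
    proof (rule nn_integral_cong_AE, use lim in eventually_elim)
      case (elim \<xi>)
      then have "(\<lambda>k. ennreal ((norm (fourier_ball f R \<xi> - G k \<xi>))\<^sup>2)) \<longlonglongrightarrow> ennreal ((norm (fourier_ball f R \<xi> - g \<xi>))\<^sup>2)"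
        by (intro tendsto_intros)
      then show ?case
        by (rule lim_imp_Liminf[OF trivial_limit_sequentially, symmetric])
    qed
    also have "\<dots> \<le> liminf (\<lambda>k. sq_norm_integral (\<lambda>\<xi>. fourier_ball f R \<xi> - G k \<xi>))"
      by (rule nn_integral_liminf) measurable
    also have "\<dots> \<le> liminf (\<lambda>k. tail_energy f R)"
    proof (rule Liminf_mono)
      show "eventually (\<lambda>k. (sq_norm_integral (\<lambda>\<xi>. fourier_ball f R \<xi> - G k \<xi>)) \<le> tail_energy f R) sequentially"
        using eventually_ge_at_top[of "nat \<lceil>R\<rceil>"]
      proof eventually_elim
        case (elim k)
        then have "R \<le> r k" using r_ge[of k] by linarith
        then show ?case unfolding G_def by (rule fourier_ball_diff[OF f])
      qed
    qed
    finally show ?thesis by (simp add: Liminf_const)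
  qed
  have "((\<lambda>R. sq_norm_integral (\<lambda>\<xi>. fourier_ball f R \<xi> - g \<xi>)) \<longlongrightarrow> 0) at_top"
    by (rule tendsto_sandwich[OF _ _ tendsto_const tail_energy_tendsto[OF f]]) (auto simp: le)
  moreover have "g \<in> L2"
  proof (rule L2I)
    \<comment> \<open>At radius 0 the ball is empty and its transform vanishes, so the bound
      \<open>le\<close> controls \<open>g\<close> itself.\<close>
    have "sq_norm_integral g = sq_norm_integral (\<lambda>\<xi>. fourier_ball f 0 \<xi> - g \<xi>)"
      by (simp add: fourier_integral_def)
    also have "\<dots> \<le> tail_energy f 0" by (rule le)
    also have "\<dots> \<le> sq_norm_integral f"
      unfolding tail_energy_def by (intro nn_integral_mono) (auto simp: indicator_def)
    also have "\<dots> < \<infinity>" using L2D(3)[OF f] .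
    finally show "sq_norm_integral g < \<infinity>" .
  qed simp
  ultimately show ?thesis by blast
qed

lemma
  fixes f :: "real ^ 'n \<Rightarrow> real"
  assumes f: "f \<in> L2"
  shows fourier_in_L2: "fourier f \<in> L2"
    and fourier_tendsto: "((\<lambda>R. sq_norm_integral (\<lambda>\<xi>. fourier_ball f R \<xi> - fourier f \<xi>)) \<longlongrightarrow> 0) at_top"
  using someI_ex[OF fourier_exists[OF f]] unfolding fourier_def by auto

lemma ennreal_le_if_le_one_plus_eps_mult:
  fixes X Y :: ennreal
  assumes "\<And>\<eta>. 0 < \<eta> \<Longrightarrow> X \<le> ennreal (1 + \<eta>) * Y" and "Y < \<infinity>"
  shows "X \<le> Y"
proof (rule LIMSEQ_le_const)
  have "(\<lambda>n. ennreal (1 + 1 / real (Suc n))) \<longlonglongrightarrow> ennreal (1 + 0)"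
    using LIMSEQ_inverse_real_of_nat by (intro tendsto_intros) (simp add: inverse_eq_divide)
  then have "(\<lambda>n. Y * ennreal (1 + 1 / real (Suc n))) \<longlonglongrightarrow> Y * ennreal (1 + 0)"
    using assms(2) by (intro ennreal_tendsto_cmult) auto
  then show "(\<lambda>n. ennreal (1 + 1 / real (Suc n)) * Y) \<longlonglongrightarrow> Y"
    by (simp add: mult.commute)
  show "\<exists>N. \<forall>n\<ge>N. X \<le> ennreal (1 + 1 / real (Suc n)) * Y"
    using assms(1) by simp
qed

text \<open>The energies of the transforms over balls converge to \<open>N\<close>, and the
  transforms converge in the mean to \<open>fourier f\<close>. The weighted triangle inequality in
  both directions, followed by \<eta> tending to 0, gives two inequalities; the first supplies the
  finiteness under which \<eta> can be removed in the second.\<close>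

theorem plancherel:
  fixes f :: "real ^ 'n \<Rightarrow> real"
  assumes f: "f \<in> L2"
  shows "sq_norm_integral (fourier f) = sq_integral f"
proof -
  have [measurable]: "f \<in> borel_measurable borel" "fourier f \<in> borel_measurable borel"
    using f fourier_in_L2[OF f] by (auto dest: L2D)
  let ?I = "\<lambda>g. (\<integral>\<^sup>+\<xi>. ennreal ((norm (g \<xi> :: complex))\<^sup>2) \<partial>(lborel :: (real ^ 'n) measure))"
  define N where "N = sq_integral f"
  have "N < \<infinity>" using L2D(3)[OF f] by (simp add: N_def)
  have eq: "?I (fourier_ball f R) = sq_integral (\<lambda>x. indicator (ball 0 R) x * f x)" for R
    by (intro plancherel_L1_L2 L2_truncation f)
  have lim: "(\<lambda>n. ?I (\<lambda>\<xi>. fourier_ball f (real n) \<xi> - fourier f \<xi>)) \<longlonglongrightarrow> 0"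
    by (rule filterlim_compose[OF fourier_tendsto[OF f] filterlim_real_sequentially])
  have Nlim: "(\<lambda>n. ?I (fourier_ball f (real n))) \<longlonglongrightarrow> N"
    unfolding eq N_def
  proof (rule nn_integral_LIMSEQ)
    show "incseq (\<lambda>n x. ennreal ((indicator (ball 0 (real n)) x * f x)\<^sup>2))"
      by (auto simp: incseq_def le_fun_def indicator_def)
    fix x :: "real ^ 'n"
    have "eventually (\<lambda>n. ennreal ((indicator (ball 0 (real n)) x * f x)\<^sup>2) = ennreal ((f x)\<^sup>2)) sequentially"
      using eventually_gt_at_top[of "nat \<lceil>norm x\<rceil>"]
      by eventually_elim (auto simp: indicator_def, linarith)
    then show "(\<lambda>n. ennreal ((indicator (ball 0 (real n)) x * f x)\<^sup>2)) \<longlonglongrightarrow> ennreal ((f x)\<^sup>2)"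
      by (rule tendsto_eventually)
  qed auto
  have "?I (fourier f) \<le> ennreal (1 + \<eta>) * N" if "0 < \<eta>" for \<eta>
  proof (rule LIMSEQ_le_const)
    show "(\<lambda>n. ennreal (1 + \<eta>) * ?I (fourier_ball f (real n)) +
        ennreal (1 + 1 / \<eta>) * ?I (\<lambda>\<xi>. fourier_ball f (real n) \<xi> - fourier f \<xi>)) \<longlonglongrightarrow> ennreal (1 + \<eta>) * N"
      using tendsto_add[OF ennreal_tendsto_cmult[OF _ Nlim] ennreal_tendsto_cmult[OF _ lim],
          of "ennreal (1 + \<eta>)" "ennreal (1 + 1 / \<eta>)"] by simp
    show "\<exists>n0. \<forall>n\<ge>n0. ?I (fourier f) \<le> ennreal (1 + \<eta>) * ?I (fourier_ball f (real n)) +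
        ennreal (1 + 1 / \<eta>) * ?I (\<lambda>\<xi>. fourier_ball f (real n) \<xi> - fourier f \<xi>)"
      using nn_integral_norm_square_triangle[of "\<lambda>_. 0" lborel "fourier f" "fourier_ball f (real _)", OF _ _ _ that]
      by simp
  qed
  then have 1: "?I (fourier f) \<le> N"
    using \<open>N < \<infinity>\<close> by (rule ennreal_le_if_le_one_plus_eps_mult)
  have "N \<le> ennreal (1 + \<eta>) * ?I (fourier f)" if "0 < \<eta>" for \<eta>
  proof (rule LIMSEQ_le[OF Nlim])
    show "(\<lambda>n. ennreal (1 + \<eta>) * ?I (fourier f) +
        ennreal (1 + 1 / \<eta>) * ?I (\<lambda>\<xi>. fourier_ball f (real n) \<xi> - fourier f \<xi>)) \<longlonglongrightarrow> ennreal (1 + \<eta>) * ?I (fourier f)"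
      using tendsto_add[OF tendsto_const[of "ennreal (1 + \<eta>) * ?I (fourier f)"]
          ennreal_tendsto_cmult[OF _ lim, of "ennreal (1 + 1 / \<eta>)"]] by simp
    show "\<exists>n0. \<forall>n\<ge>n0. ?I (fourier_ball f (real n)) \<le> ennreal (1 + \<eta>) * ?I (fourier f) +
        ennreal (1 + 1 / \<eta>) * ?I (\<lambda>\<xi>. fourier_ball f (real n) \<xi> - fourier f \<xi>)"
      using nn_integral_norm_square_triangle[of "\<lambda>_. 0" lborel "fourier_ball f (real _)" "fourier f", OF _ _ _ that]
      by (simp add: norm_minus_commute)
  qed
  moreover have "?I (fourier f) < \<infinity>"
    using 1 \<open>N < \<infinity>\<close> by (rule le_less_trans)
  ultimately have "N \<le> ?I (fourier f)"
    by (rule ennreal_le_if_le_one_plus_eps_mult)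
  with 1 show ?thesis by (simp add: N_def)
qed

text \<open>The transforms over balls converge pointwise to the Fourier integral and in the mean to
  \<open>fourier f\<close>. By Fatou the squared distance of the two limits integrates to 0.\<close>

lemma fourier_AE_eq_fourier_integral:
  fixes f :: "real ^ 'n \<Rightarrow> real"
  assumes f: "f \<in> L2" and f1: "integrable lborel f"
  shows "AE \<xi> in lborel. fourier f \<xi> = fourier_integral f \<xi>"
proof -
  have [measurable]: "f \<in> borel_measurable borel" "fourier f \<in> borel_measurable borel"
    using f fourier_in_L2[OF f] by (auto dest: L2D)
  have lim: "(\<lambda>n. sq_norm_integral (\<lambda>\<xi>. fourier_ball f (real n) \<xi> - fourier f \<xi>)) \<longlonglongrightarrow> 0"
    by (rule filterlim_compose[OF fourier_tendsto[OF f] filterlim_real_sequentially])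
  have pt: "(\<lambda>n. fourier_ball f (real n) \<xi>) \<longlonglongrightarrow> fourier_integral f \<xi>" for \<xi>
    unfolding fourier_integral_def
  proof (intro tendsto_intros integral_dominated_convergence[where w="\<lambda>x. norm (f x)"])
    show "AE x in lborel. (\<lambda>n. (indicator (ball 0 (real n)) x * f x) *\<^sub>R cis (- (x \<bullet> \<xi>))) \<longlonglongrightarrow> f x *\<^sub>R cis (- (x \<bullet> \<xi>))"
    proof (rule AE_I2)
      fix x :: "real ^ 'n"
      have "eventually (\<lambda>n. (indicator (ball 0 (real n)) x * f x) *\<^sub>R cis (- (x \<bullet> \<xi>)) = f x *\<^sub>R cis (- (x \<bullet> \<xi>))) sequentially"
        using eventually_gt_at_top[of "nat \<lceil>norm x\<rceil>"]
        by eventually_elim (auto simp: indicator_def, linarith)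
      then show "(\<lambda>n. (indicator (ball 0 (real n)) x * f x) *\<^sub>R cis (- (x \<bullet> \<xi>))) \<longlonglongrightarrow> f x *\<^sub>R cis (- (x \<bullet> \<xi>))"
        by (rule tendsto_eventually)
    qed
  qed (use f1 in \<open>auto simp: indicator_def\<close>)
  have "sq_norm_integral (\<lambda>\<xi>. fourier_integral f \<xi> - fourier f \<xi>) =
      (\<integral>\<^sup>+ \<xi>. liminf (\<lambda>n. ennreal ((norm (fourier_ball f (real n) \<xi> - fourier f \<xi>))\<^sup>2)) \<partial>lborel)"
  proof (rule nn_integral_cong)
    fix \<xi> :: "real ^ 'n"
    have "(\<lambda>n. ennreal ((norm (fourier_ball f (real n) \<xi> - fourier f \<xi>))\<^sup>2)) \<longlonglongrightarrow> ennreal ((norm (fourier_integral f \<xi> - fourier f \<xi>))\<^sup>2)"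
      by (intro tendsto_intros pt)
    then show "ennreal ((norm (fourier_integral f \<xi> - fourier f \<xi>))\<^sup>2) = liminf (\<lambda>n. ennreal ((norm (fourier_ball f (real n) \<xi> - fourier f \<xi>))\<^sup>2))"
      by (rule lim_imp_Liminf[OF trivial_limit_sequentially, symmetric])
  qed
  also have "\<dots> \<le> liminf (\<lambda>n. sq_norm_integral (\<lambda>\<xi>. fourier_ball f (real n) \<xi> - fourier f \<xi>))"
    by (rule nn_integral_liminf) measurable
  also have "\<dots> = 0"
    using lim by (rule lim_imp_Liminf[OF trivial_limit_sequentially])
  finally have "AE \<xi> in lborel. ennreal ((norm (fourier_integral f \<xi> - fourier f \<xi>))\<^sup>2) = 0"
    by (subst (asm) le_zero_eq, subst (asm) nn_integral_0_iff_AE) auto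
  then show ?thesis
    by eventually_elim (simp add: ennreal_eq_0_iff)
qed

section \<open>The kernels\<close>

text \<open>The entire functions \<open>sinh (z t) / z\<close> and \<open>cosh (z t)\<close> of \<open>D = z\<^sup>2\<close>, for real \<open>D\<close> of either sign.\<close>

definition osc :: "real \<Rightarrow> real \<Rightarrow> real"
  where "osc D t = (if D < 0 then sin (sqrt (- D) * t) / sqrt (- D)
    else if D = 0 then t else sinh (sqrt D * t) / sqrt D)"

definition osc' :: "real \<Rightarrow> real \<Rightarrow> real"
  where "osc' D t = (if D < 0 then cos (sqrt (- D) * t) else cosh (sqrt D * t))"

text \<open>With a the \<open>damping\<close> and D the \<open>discriminant\<close>, the
  characteristic roots are -a \<plusminus> sqrt D.\<close>

definition damping :: "real \<Rightarrow> real \<Rightarrow> real"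
  where "damping \<mu> r = \<mu> * r ^ 4"

definition discriminant :: "real \<Rightarrow> real \<Rightarrow> real"
  where "discriminant \<mu> r = \<mu>\<^sup>2 * r ^ 8 - r\<^sup>2 - r ^ 4"

lemma discriminant_eq: "discriminant \<mu> r = (damping \<mu> r)\<^sup>2 - r\<^sup>2 - r ^ 4"
  by (simp add: discriminant_def damping_def power_mult_distrib flip: power_mult)

lemma disc_root_eq:
  "disc_root \<mu> \<xi> = (if discriminant \<mu> (norm \<xi>) < 0
    then \<i> * of_real (sqrt (- discriminant \<mu> (norm \<xi>))) else of_real (sqrt (discriminant \<mu> (norm \<xi>))))"
proof -
  have "disc_root \<mu> \<xi> = csqrt (of_real (discriminant \<mu> (norm \<xi>)))"
    by (simp add: disc_root_def discriminant_def)
  then show ?thesis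
    by (auto simp: csqrt_of_real_nonpos csqrt_of_real_nonneg)
qed

lemma sin_complex_exp: "exp (\<i> * of_real x) - exp (- (\<i> * of_real x)) = 2 * \<i> * of_real (sin x)"
  using cis_conv_exp[of x] cis_conv_exp[of "- x"] by (simp add: complex_eq_iff flip: cis_conv_exp)

lemma cos_complex_exp: "exp (\<i> * of_real x) + exp (- (\<i> * of_real x)) = 2 * of_real (cos x)"
  using cis_conv_exp[of x] cis_conv_exp[of "- x"] by (simp add: complex_eq_iff flip: cis_conv_exp)

text \<open>After the factor exp (- a t) is split off, both kernels are even in the root of the
  discriminant. The branch chosen by \<open>csqrt\<close> is thus irrelevant, the kernels are real,
  and the merging of the roots is the removable singularity built into \<open>osc\<close>.\<close>

lemma
  fixes \<xi> :: "real ^ 'n" and \<mu> t :: real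
  defines "a \<equiv> damping \<mu> (norm \<xi>)" and "D \<equiv> discriminant \<mu> (norm \<xi>)"
  shows kernel1_eq: "kernel1 \<mu> t \<xi> = of_real (exp (- a * t) * osc D t)"
    and kernel0_eq: "kernel0 \<mu> t \<xi> = of_real (exp (- a * t) * (osc' D t + a * osc D t))"
proof -
  define d where "d = disc_root \<mu> \<xi>"
  have p: "lam_plus \<mu> \<xi> = - of_real a + d" and m: "lam_minus \<mu> \<xi> = - of_real a - d"
    by (simp_all add: lam_plus_def lam_minus_def a_def damping_def d_def)
  have d: "d = (if D < 0 then \<i> * of_real (sqrt (- D)) else of_real (sqrt D))"
    unfolding d_def D_def by (rule disc_root_eq)
  define S where "S = exp (d * of_real t) - exp (- (d * of_real t))"
  define C where "C = exp (d * of_real t) + exp (- (d * of_real t))"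
  have e: "exp ((- of_real a + d) * of_real t) = of_real (exp (- a * t)) * exp (d * of_real t)"
      "exp ((- of_real a - d) * of_real t) = of_real (exp (- a * t)) * exp (- (d * of_real t))"
    by (simp_all add: exp_of_real[symmetric] exp_add[symmetric] left_diff_distrib distrib_right)
  have S: "S = 2 * d * of_real (osc D t)" if "d \<noteq> 0"
  proof (cases "D < 0")
    case True
    then have "S = 2 * \<i> * of_real (sin (sqrt (- D) * t))"
      unfolding S_def d using sin_complex_exp[of "sqrt (- D) * t"] by (simp add: mult.assoc)
    with True that show ?thesis by (simp add: osc_def d)
  next
    case False
    with that have "0 < D" by (auto simp: d)
    then have "S = of_real (2 * sinh (sqrt D * t))"
      unfolding S_def d by (simp add: sinh_def exp_of_real[symmetric])
    with \<open>0 < D\<close> show ?thesis by (simp add: osc_def d)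
  qed
  have C: "C = 2 * of_real (osc' D t)"
  proof (cases "D < 0")
    case True
    then show ?thesis
      unfolding C_def d using cos_complex_exp[of "sqrt (- D) * t"] by (simp add: mult.assoc osc'_def)
  next
    case False
    then have "C = of_real (2 * cosh (sqrt D * t))"
      unfolding C_def d by (simp add: cosh_def exp_of_real[symmetric])
    with False show ?thesis by (simp add: osc'_def)
  qed
  have D0: "D = 0" if "d = 0"
    using that by (auto simp: d split: if_splits)
  show "kernel1 \<mu> t \<xi> = of_real (exp (- a * t) * osc D t)"
  proof (cases "d = 0")
    case True
    with D0 show ?thesis
      unfolding kernel1_def p m by (simp add: osc_def exp_of_real[symmetric])
  next
    case False
    then have "kernel1 \<mu> t \<xi> = of_real (exp (- a * t)) * S / (2 * d)"
      unfolding kernel1_def p m Let_def e S_def by (simp add: right_diff_distrib)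
    with False S show ?thesis by simp
  qed
  show "kernel0 \<mu> t \<xi> = of_real (exp (- a * t) * (osc' D t + a * osc D t))"
  proof (cases "d = 0")
    case True
    with D0 show ?thesis
      unfolding kernel0_def p m by (simp add: osc_def osc'_def exp_of_real[symmetric] algebra_simps)
  next
    case False
    then have "kernel0 \<mu> t \<xi> = of_real (exp (- a * t)) * (d * C + of_real a * S) / (2 * d)"
      unfolding kernel0_def p m Let_def e S_def C_def by (simp add: algebra_simps)
    also have "\<dots> = of_real (exp (- a * t)) * (of_real (osc' D t) + of_real a * of_real (osc D t))"
      using False by (simp add: S C field_simps)
    finally show ?thesis by simp
  qed
qed

lemma borel_measurable_kernel [measurable]:
  "kernel0 \<mu> t \<in> borel_measurable borel" "kernel1 \<mu> t \<in> borel_measurable borel"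
  unfolding kernel0_eq[abs_def] kernel1_eq[abs_def] osc_def osc'_def damping_def discriminant_def sinh_def cosh_def
  by measurable

section \<open>Pointwise bounds for the kernels\<close>

lemma sinh_le_mult_exp: "0 \<le> x \<Longrightarrow> sinh x \<le> x * exp x" for x :: real
proof -
  assume "0 \<le> x"
  have "exp (- x) = exp x * exp (- (2 * x))" by (simp add: exp_add[symmetric])
  moreover have "exp x * (1 - exp (- (2 * x))) \<le> exp x * (2 * x)"
    using exp_ge_add_one_self[of "- (2 * x)"] by (intro mult_left_mono) auto
  ultimately show ?thesis by (simp add: sinh_def algebra_simps)
qed

text \<open>|sin x| \<le> |x| and sinh x \<le> x exp x cancel the denominator. This keeps the bound
  uniform near D = 0, where a bound by 1 / sqrt |D| blows up.\<close>

lemma abs_osc_le: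
  assumes "0 \<le> t"
  shows "\<bar>osc D t\<bar> \<le> t * exp (sqrt (max 0 D) * t)"
proof -
  consider "D < 0" | "D = 0" | "0 < D" by linarith
  then show ?thesis
  proof cases
    case 1
    have "\<bar>sin (sqrt (- D) * t)\<bar> \<le> sqrt (- D) * t"
      using abs_sin_x_le_abs_x[of "sqrt (- D) * t"] assms 1 by (simp add: abs_mult)
    with 1 show ?thesis by (simp add: osc_def field_simps)
  next
    case 3
    have "sinh (sqrt D * t) \<le> sqrt D * t * exp (sqrt D * t)"
      using assms 3 by (intro sinh_le_mult_exp) simp
    moreover have "0 \<le> sinh (sqrt D * t)" using assms 3 by simp
    ultimately show ?thesis using 3 by (simp add: osc_def field_simps)
  qed (simp add: osc_def assms)
qed

lemma abs_osc_le_neg: "D < 0 \<Longrightarrow> \<bar>osc D t\<bar> \<le> 1 / sqrt (- D)"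
  by (simp add: osc_def divide_right_mono)

lemma cosh_le_exp: "0 \<le> x \<Longrightarrow> cosh x \<le> exp x" for x :: real
  by (simp add: cosh_def)

lemma sinh_le_exp: "sinh x \<le> exp x" for x :: real
  by (simp add: sinh_def) (smt (verit) exp_ge_zero)

lemma abs_osc_le_pos: "0 < D \<Longrightarrow> 0 \<le> t \<Longrightarrow> \<bar>osc D t\<bar> \<le> exp (sqrt D * t) / sqrt D"
  by (simp add: osc_def divide_right_mono sinh_le_exp)

lemma abs_osc'_le:
  assumes "0 \<le> t"
  shows "\<bar>osc' D t\<bar> \<le> exp (sqrt (max 0 D) * t)"
proof (cases "D < 0")
  case True
  have "\<bar>cos (sqrt (- D) * t)\<bar> \<le> 1" by simp
  with True show ?thesis by (simp add: osc'_def)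
next
  case False
  with assms show ?thesis using cosh_le_exp[of "sqrt D * t"] by (simp add: osc'_def)
qed

text \<open>Since r \<le> 1 and \<mu> < 1, the positive term \<mu>^2 r^8 is at most r^4. Hence every
  low frequency oscillates.\<close>

lemma discriminant_low:
  assumes "0 < \<mu>" "\<mu> < 1" "0 < r" "r \<le> 1"
  shows "r\<^sup>2 \<le> - discriminant \<mu> r" "- discriminant \<mu> r \<le> 2 * r\<^sup>2"
proof -
  have "r ^ 4 \<le> r\<^sup>2" "r ^ 8 \<le> r ^ 4" using assms by (auto intro: power_decreasing)
  moreover have "\<mu>\<^sup>2 * r ^ 8 \<le> 1 * r ^ 8"
    using assms by (intro mult_right_mono) (auto simp: power_le_one)
  moreover have "0 \<le> \<mu>\<^sup>2 * r ^ 8" by simp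
  ultimately show "r\<^sup>2 \<le> - discriminant \<mu> r" "- discriminant \<mu> r \<le> 2 * r\<^sup>2"
    unfolding discriminant_def by linarith+
qed

text \<open>The two bounds for the second kernel come from |osc| \<le> t and |osc| \<le> 1 / r. In
  the first kernel the additional term is at most \<mu> r^4 / r \<le> 1, hence the constant
  2.\<close>

lemma kernel_low:
  fixes \<xi> :: "real ^ 'n"
  assumes "0 < \<mu>" "\<mu> < 1" "0 < norm \<xi>" "norm \<xi> \<le> 1" "0 \<le> t"
  shows "norm (kernel1 \<mu> t \<xi>) \<le> exp (- \<mu> * norm \<xi> ^ 4 * t) * t"
    "norm (kernel1 \<mu> t \<xi>) \<le> exp (- \<mu> * norm \<xi> ^ 4 * t) / norm \<xi>"
    "norm (kernel0 \<mu> t \<xi>) \<le> 2 * exp (- \<mu> * norm \<xi> ^ 4 * t)"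
proof -
  define r D where "r = norm \<xi>" and "D = discriminant \<mu> r"
  have r: "0 < r" "r \<le> 1" using assms by (auto simp: r_def)
  have "r\<^sup>2 \<le> - D"
    using discriminant_low(1)[OF assms(1,2) r] by (simp add: D_def)
  then have "r \<le> sqrt (- D)" and neg: "D < 0"
    using r by (auto intro: real_le_rsqrt) (smt (verit) zero_less_power)
  then have inv: "1 / sqrt (- D) \<le> 1 / r"
    using r by (intro divide_left_mono) auto
  have n1: "norm (kernel1 \<mu> t \<xi>) = exp (- damping \<mu> r * t) * \<bar>osc D t\<bar>"
    unfolding kernel1_eq by (simp add: norm_mult r_def D_def abs_mult)
  have n0: "norm (kernel0 \<mu> t \<xi>) = exp (- damping \<mu> r * t) * \<bar>osc' D t + damping \<mu> r * osc D t\<bar>"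
    unfolding kernel0_eq by (simp only: norm_of_real abs_mult abs_exp_cancel r_def D_def)
  have o1: "\<bar>osc D t\<bar> \<le> t" using abs_osc_le[OF assms(5), of D] neg by simp
  have o2: "\<bar>osc D t\<bar> \<le> 1 / r" using abs_osc_le_neg[OF neg, of t] inv by linarith
  have "\<bar>osc' D t\<bar> \<le> 1" using abs_osc'_le[OF assms(5), of D] neg by simp
  moreover have "\<bar>damping \<mu> r * osc D t\<bar> \<le> 1"
  proof -
    have "\<bar>damping \<mu> r * osc D t\<bar> \<le> damping \<mu> r * (1 / r)"
      unfolding abs_mult using o2 assms r by (intro mult_mono) (auto simp: damping_def)
    also have "\<dots> = \<mu> * r ^ 3" using r by (simp add: damping_def power_numeral_reduce)
    also have "\<dots> \<le> 1 * 1" using assms r by (intro mult_mono power_le_one) auto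
    finally show ?thesis by simp
  qed
  ultimately have o0: "\<bar>osc' D t + damping \<mu> r * osc D t\<bar> \<le> 2" by linarith
  show "norm (kernel1 \<mu> t \<xi>) \<le> exp (- \<mu> * norm \<xi> ^ 4 * t) * t"
    unfolding n1 using o1 by (simp add: damping_def r_def)
  show "norm (kernel1 \<mu> t \<xi>) \<le> exp (- \<mu> * norm \<xi> ^ 4 * t) / norm \<xi>"
    unfolding n1 using mult_left_mono[OF o2, of "exp (- damping \<mu> r * t)"] by (simp add: damping_def r_def)
  show "norm (kernel0 \<mu> t \<xi>) \<le> 2 * exp (- \<mu> * norm \<xi> ^ 4 * t)"
    unfolding n0 using mult_left_mono[OF o0, of "exp (- damping \<mu> r * t)"] by (simp add: damping_def r_def mult.commute)
qed

text \<open>Two regimes. For D \<le> a^2 / 4 the growth exponent is at most a / 2; half of the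
  remaining damping absorbs the factor t at the price of 4 / a, and the other half decays. For
  larger D the denominator is at least a / 2, but the slow root -a + sqrt D needs to be kept away
  from 0. In both cases the gain 1 / a produces the fourth power of the frequency.\<close>

lemma kernel_high:
  fixes \<xi> :: "real ^ 'n"
  assumes \<mu>: "0 < \<mu>" "\<mu> < 1" and "1 \<le> norm \<xi>" "0 \<le> t"
  shows "norm (kernel1 \<mu> t \<xi>) \<le> 4 / (\<mu> * norm \<xi> ^ 4) * exp (- \<mu> * t / 4)"
    "norm (kernel0 \<mu> t \<xi>) \<le> 5 * exp (- \<mu> * t / 4)"
proof -
  define r D where "r = norm \<xi>" and "D = discriminant \<mu> r"
  define a where "a = damping \<mu> r"
  have r: "1 \<le> r" using assms by (auto simp: r_def)
  then have r4: "1 \<le> r ^ 4" by simp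
  have a: "\<mu> \<le> a" using mult_left_mono[OF r4, of \<mu>] \<mu> by (simp add: a_def damping_def)
  have "0 < a" using a \<mu> by linarith
  have D: "D = a\<^sup>2 - r\<^sup>2 - r ^ 4" by (simp add: D_def discriminant_eq a_def)
  have n1: "norm (kernel1 \<mu> t \<xi>) = exp (- a * t) * \<bar>osc D t\<bar>"
    unfolding kernel1_eq by (simp only: norm_of_real abs_mult abs_exp_cancel r_def D_def a_def)
  have n0: "norm (kernel0 \<mu> t \<xi>) = exp (- a * t) * \<bar>osc' D t + a * osc D t\<bar>"
    unfolding kernel0_eq by (simp only: norm_of_real abs_mult abs_exp_cancel r_def D_def a_def)
  define E where "E = exp (- \<mu> * t / 4)"
  have "exp (- a * t) * \<bar>osc D t\<bar> \<le> 4 / a * E \<and> exp (- a * t) * \<bar>osc' D t\<bar> \<le> E"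
  proof (cases "D \<le> a\<^sup>2 / 4")
    case True
    have "sqrt (max 0 D) \<le> sqrt ((a / 2)\<^sup>2)"
      using True by (intro real_sqrt_le_mono max.boundedI) (simp_all add: power_divide)
    also have "\<dots> = a / 2"
      using \<open>0 < a\<close> by (subst real_sqrt_abs) simp
    finally have "sqrt (max 0 D) \<le> a / 2" .
    then have "sqrt (max 0 D) * t \<le> a / 2 * t" using assms by (intro mult_right_mono)
    then have s: "exp (sqrt (max 0 D) * t) \<le> exp (a * t / 2)" by simp
    have E: "exp (- (a * t / 4)) \<le> E"
      unfolding E_def using mult_right_mono[OF a assms(4)] by simp
    have "\<bar>osc D t\<bar> \<le> t * exp (a * t / 2)"
      using abs_osc_le[OF assms(4), of D] mult_left_mono[OF s assms(4)] by linarith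
    then have "exp (- a * t) * \<bar>osc D t\<bar> \<le> exp (- a * t) * (t * exp (a * t / 2))"
      by (intro mult_left_mono) auto
    also have "\<dots> = t * exp (- (a * t / 4)) * exp (- (a * t / 4))"
      by (simp add: mult.assoc mult.left_commute[of _ t] flip: exp_add)
    also have "\<dots> \<le> 4 / a * exp (- (a * t / 4))"
    proof (rule mult_right_mono)
      have "a * t / 4 \<le> exp (a * t / 4)" using exp_ge_add_one_self[of "a * t / 4"] by linarith
      then show "t * exp (- (a * t / 4)) \<le> 4 / a"
        using \<open>0 < a\<close> by (simp add: exp_minus field_simps)
    qed simp
    also have "\<dots> \<le> 4 / a * E" using E \<open>0 < a\<close> by (intro mult_left_mono) auto
    finally have 1: "exp (- a * t) * \<bar>osc D t\<bar> \<le> 4 / a * E" .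
    have "exp (- a * t) * \<bar>osc' D t\<bar> \<le> exp (- a * t) * exp (a * t / 2)"
      by (intro mult_left_mono order_trans[OF abs_osc'_le[OF assms(4), of D] s]) simp
    also have "\<dots> = exp (- (a * t / 4)) * exp (- (a * t / 4))"
      by (simp flip: exp_add)
    also have "\<dots> \<le> 1 * E"
      using E \<open>0 < a\<close> assms by (intro mult_mono) auto
    finally show ?thesis using 1 by simp
  next
    case False
    define d where "d = sqrt D"
    have "0 < D" using False \<open>0 < a\<close> by (smt (verit) zero_le_power2 divide_nonneg_pos)
    have "(a / 2)\<^sup>2 \<le> D" using False by (simp add: power_divide)
    then have "a / 2 \<le> d" unfolding d_def by (rule real_le_rsqrt)
    have "d\<^sup>2 = D" using \<open>0 < D\<close> by (simp add: d_def)
    have "a \<le> r ^ 4"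
      unfolding a_def damping_def using \<mu> r4 mult_right_mono[of \<mu> 1 "r ^ 4"] by simp
    moreover have "0 \<le> r\<^sup>2" by simp
    ultimately have d2: "d\<^sup>2 \<le> a * (a - 1)"
      unfolding \<open>d\<^sup>2 = D\<close> D right_diff_distrib mult_1_right power2_eq_square[of a] by linarith
    with \<open>d\<^sup>2 = D\<close> \<open>0 < D\<close> have "0 < a * (a - 1)" by linarith
    then have "1 < a" using \<open>0 < a\<close> by (simp add: zero_less_mult_iff)
    \<comment> \<open>The roots \<open>-a \<plusminus> d\<close> have product \<open>r\<^sup>2 + r\<^sup>4 \<ge> a\<close>, which keeps the larger one away from \<open>0\<close>.\<close>
    have "d \<le> a - 1 / 2"
    proof (rule power2_le_imp_le)
      show "d\<^sup>2 \<le> (a - 1 / 2)\<^sup>2"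
        using d2 by (simp add: power2_eq_square algebra_simps)
    qed (use \<open>1 < a\<close> in simp)
    then have "(d - a) * t \<le> - 1 / 2 * t"
      using assms by (intro mult_right_mono) auto
    moreover have "\<mu> * t \<le> 1 * t"
      using \<mu> assms by (intro mult_right_mono) auto
    ultimately have "- a * t + d * t \<le> - \<mu> * t / 4"
      using assms by (simp add: algebra_simps)
    then have e: "exp (- a * t) * exp (d * t) \<le> E"
      unfolding E_def exp_add[symmetric] by simp
    have "1 / d \<le> 4 / a"
      using \<open>a / 2 \<le> d\<close> \<open>0 < a\<close> by (simp add: field_simps)
    have "exp (- a * t) * \<bar>osc D t\<bar> \<le> exp (- a * t) * (exp (d * t) / d)"
      unfolding d_def by (intro mult_left_mono abs_osc_le_pos \<open>0 < D\<close> assms) simp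
    also have "\<dots> = 1 / d * (exp (- a * t) * exp (d * t))" by simp
    also have "\<dots> \<le> 4 / a * E"
      using \<open>1 / d \<le> 4 / a\<close> e \<open>0 < a\<close> by (intro mult_mono) auto
    finally have 1: "exp (- a * t) * \<bar>osc D t\<bar> \<le> 4 / a * E" .
    have "exp (- a * t) * \<bar>osc' D t\<bar> \<le> exp (- a * t) * exp (d * t)"
      using abs_osc'_le[OF assms(4), of D] \<open>0 < D\<close> by (intro mult_left_mono) (auto simp: d_def)
    with e 1 show ?thesis by linarith
  qed
  then have 1: "exp (- a * t) * \<bar>osc D t\<bar> \<le> 4 / a * E" and 2: "exp (- a * t) * \<bar>osc' D t\<bar> \<le> E"
    by auto
  show "norm (kernel1 \<mu> t \<xi>) \<le> 4 / (\<mu> * norm \<xi> ^ 4) * exp (- \<mu> * t / 4)"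
    using 1 unfolding n1 E_def by (simp add: a_def damping_def r_def)
  have "exp (- a * t) * \<bar>osc' D t + a * osc D t\<bar> \<le> exp (- a * t) * (\<bar>osc' D t\<bar> + a * \<bar>osc D t\<bar>)"
    using \<open>0 < a\<close> by (intro mult_left_mono order_trans[OF abs_triangle_ineq]) (auto simp: abs_mult)
  also have "\<dots> = exp (- a * t) * \<bar>osc' D t\<bar> + a * (exp (- a * t) * \<bar>osc D t\<bar>)"
    by (simp add: algebra_simps)
  also have "\<dots> \<le> E + a * (4 / a * E)"
    using 1 2 \<open>0 < a\<close> by (intro add_mono mult_left_mono) auto
  finally show "norm (kernel0 \<mu> t \<xi>) \<le> 5 * exp (- \<mu> * t / 4)"
    unfolding n0 using \<open>0 < a\<close> by (simp add: E_def)
qed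

section \<open>Lower bounds for the oscillating kernel\<close>

lemma sin_square_add_ge:
  fixes x y :: real
  assumes "1 \<le> y - x" "y - x \<le> 9 / 4"
  shows "1 / 8 \<le> (sin x)\<^sup>2 + (sin y)\<^sup>2"
proof -
  have pi: "3 < pi" "pi < 4" using pi_gt3 pi_less_4 by auto
  \<comment> \<open>With 3 < pi < 4 the interval from 1 to 9/4 lies inside the one from pi / 6 to 5
    pi / 6, where the sine is at least 1/2. The addition formula then bounds |sin x| + |sin y| from
    below.\<close>
  have "sin (pi / 6) \<le> sin (y - x)"
  proof (cases "y - x \<le> pi / 2")
    case True
    then show ?thesis using assms pi by (intro sin_monotone_2pi_le) auto
  next
    case False
    have "sin (pi / 6) \<le> sin (pi - (y - x))"
      using False assms pi by (intro sin_monotone_2pi_le) auto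
    then show ?thesis by simp
  qed
  then have "1 / 2 \<le> sin (y - x)" by (simp add: sin_30)
  also have "\<dots> \<le> \<bar>sin y * cos x\<bar> + \<bar>cos y * sin x\<bar>"
    by (simp add: sin_diff)
  also have "\<dots> \<le> \<bar>sin y\<bar> * 1 + 1 * \<bar>sin x\<bar>"
    unfolding abs_mult by (intro add_mono mult_mono) auto
  finally have "(1 / 2)\<^sup>2 \<le> (\<bar>sin x\<bar> + \<bar>sin y\<bar>)\<^sup>2"
    by (intro power_mono) auto
  also have "\<dots> \<le> 2 * ((sin x)\<^sup>2 + (sin y)\<^sup>2)"
    using sum_squares_bound[of "\<bar>sin x\<bar>" "\<bar>sin y\<bar>"] by (simp add: power2_eq_square algebra_simps)
  finally show ?thesis by (simp add: power2_eq_square)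
qed

text \<open>The \<omega> of the overview: the imaginary part of \<open>lam_plus\<close> where the
  discriminant is negative.\<close>

definition frequency :: "real \<Rightarrow> real \<Rightarrow> real"
  where "frequency \<mu> r = sqrt (- discriminant \<mu> r)"

text \<open>The refined upper bound is a square root estimate, (r (1 + r^2 / 2))^2 = r^2 + r^4 + r^6
  / 4. It shows that \<omega> / r is close to 1, which differences of frequencies need; the cruder
  bound by 2 r^2 serves for denominators.\<close>

lemma frequency_bounds:
  assumes "0 < \<mu>" "\<mu> < 1" "0 < r" "r \<le> 1"
  shows "r \<le> frequency \<mu> r" "frequency \<mu> r \<le> r * (1 + r\<^sup>2 / 2)" "(frequency \<mu> r)\<^sup>2 = - discriminant \<mu> r"
    "(frequency \<mu> r)\<^sup>2 \<le> 2 * r\<^sup>2"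
proof -
  note D = discriminant_low[OF assms]
  then show "r \<le> frequency \<mu> r"
    unfolding frequency_def by (intro real_le_rsqrt)
  have "0 \<le> - discriminant \<mu> r" using D(1) by (smt (verit) zero_le_power2)
  then show "(frequency \<mu> r)\<^sup>2 = - discriminant \<mu> r"
    unfolding frequency_def by simp
  with D show "(frequency \<mu> r)\<^sup>2 \<le> 2 * r\<^sup>2" by simp
  have "- discriminant \<mu> r \<le> r\<^sup>2 + r ^ 4"
    unfolding discriminant_def by simp
  also have "\<dots> \<le> (r * (1 + r\<^sup>2 / 2))\<^sup>2"
  proof -
    have "(r * (1 + r\<^sup>2 / 2))\<^sup>2 = r\<^sup>2 + r ^ 4 + (r ^ 3)\<^sup>2 / 4"
      by (simp add: power2_eq_square algebra_simps power_numeral_reduce)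
    then show ?thesis by simp
  qed
  finally show "frequency \<mu> r \<le> r * (1 + r\<^sup>2 / 2)"
    unfolding frequency_def using assms by (intro real_le_lsqrt) auto
qed

text \<open>The difference of the squares is (r'^2 - r^2) X with 1 \<le> X \<le> 9/8, since both
  squared radii are at most 1/16. Dividing by the sum of the frequencies, which lies between r' + r
  and 6/5 (r' + r), gives both constants.\<close>

lemma frequency_diff:
  assumes \<mu>: "0 < \<mu>" "\<mu> < 1" and r: "0 < r" "r \<le> r'" "r' \<le> 1 / 4"
  shows "5 / 6 * (r' - r) \<le> frequency \<mu> r' - frequency \<mu> r"
    "frequency \<mu> r' - frequency \<mu> r \<le> 9 / 8 * (r' - r)"
proof -
  define \<omega> \<omega>' where "\<omega> = frequency \<mu> r" and "\<omega>' = frequency \<mu> r'"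
  have le: "0 < r'" "r \<le> 1" "r' \<le> 1" using r by auto
  note w = frequency_bounds[OF \<mu> r(1) le(2), folded \<omega>_def]
  note w' = frequency_bounds[OF \<mu> le(1) le(3), folded \<omega>'_def]
  have sq: "r\<^sup>2 \<le> (1 / 4)\<^sup>2" "r'\<^sup>2 \<le> (1 / 4)\<^sup>2"
    using r by (auto intro!: power_mono)
  then have sq': "r\<^sup>2 \<le> 1 / 16" "r'\<^sup>2 \<le> 1 / 16"
    by (simp_all add: power2_eq_square)
  define q where "q = 1 - \<mu>\<^sup>2 * (r' ^ 4 + r ^ 4)"
  have q: "0 \<le> q" "q \<le> 1"
  proof -
    have "r' ^ 4 \<le> (1 / 4) ^ 4" "r ^ 4 \<le> (1 / 4) ^ 4" using r by (auto intro!: power_mono)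
    then have "r' ^ 4 + r ^ 4 \<le> 1" by (simp add: power_numeral_reduce)
    then have "\<mu>\<^sup>2 * (r' ^ 4 + r ^ 4) \<le> 1 * 1"
      using \<mu> by (intro mult_mono) (auto simp: power_le_one)
    then show "0 \<le> q" by (simp add: q_def)
    show "q \<le> 1" by (simp add: q_def)
  qed
  define X where "X = 1 + (r'\<^sup>2 + r\<^sup>2) * q"
  have "(r'\<^sup>2 + r\<^sup>2) * q \<le> 1 / 8 * 1"
    using sq' q by (intro mult_mono) auto
  then have X: "1 \<le> X" "X \<le> 9 / 8"
    using q by (auto simp: X_def)
  have "\<omega>'\<^sup>2 - \<omega>\<^sup>2 = (r' - r) * (r' + r) * X"
    unfolding w(3) w'(3) discriminant_def X_def q_def
    by (simp add: algebra_simps power_numeral_reduce)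
  then have eq: "(\<omega>' - \<omega>) * (\<omega>' + \<omega>) = (r' - r) * (r' + r) * X"
    by (simp add: power2_eq_square algebra_simps)
  have pos: "0 < r' + r" "r' + r \<le> \<omega>' + \<omega>" using r w(1) w'(1) by auto
  have up: "\<omega>' + \<omega> \<le> 6 / 5 * (r' + r)"
  proof -
    have "r * (1 + r\<^sup>2 / 2) \<le> r * (6 / 5)" "r' * (1 + r'\<^sup>2 / 2) \<le> r' * (6 / 5)"
      using sq' r le by (auto intro!: mult_left_mono)
    with w(2) w'(2) show ?thesis unfolding distrib_left by linarith
  qed
  have "0 \<le> (\<omega>' - \<omega>) * (\<omega>' + \<omega>)"
    unfolding eq using r pos X by simp
  then have nn: "0 \<le> \<omega>' - \<omega>"
    using pos by (simp add: zero_le_mult_iff)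
  have "(\<omega>' - \<omega>) * (r' + r) \<le> (\<omega>' - \<omega>) * (\<omega>' + \<omega>)"
    using nn pos by (intro mult_left_mono) auto
  also have "\<dots> \<le> (r' - r) * (r' + r) * (9 / 8)"
    unfolding eq using X r pos by (intro mult_left_mono) auto
  finally have "(\<omega>' - \<omega>) * (r' + r) \<le> (9 / 8 * (r' - r)) * (r' + r)" by (simp only: mult_ac)
  then show "\<omega>' - \<omega> \<le> 9 / 8 * (r' - r)"
    using pos by (simp only: mult_le_cancel_right_pos)
  have "(r' - r) * (r' + r) * 1 \<le> (\<omega>' - \<omega>) * (\<omega>' + \<omega>)"
    unfolding eq using X r pos by (intro mult_left_mono) auto
  also have "\<dots> \<le> (\<omega>' - \<omega>) * (6 / 5 * (r' + r))"
    using nn up by (intro mult_left_mono) auto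
  finally have "(r' - r) * (r' + r) \<le> (6 / 5 * (\<omega>' - \<omega>)) * (r' + r)" by (simp only: mult_ac mult_1_right)
  then have "r' - r \<le> 6 / 5 * (\<omega>' - \<omega>)"
    using pos by (simp only: mult_le_cancel_right_pos)
  then show "5 / 6 * (r' - r) \<le> \<omega>' - \<omega>" by simp
qed

lemma norm_kernel1_low:
  fixes \<xi> :: "real ^ 'n"
  assumes "0 < \<mu>" "\<mu> < 1" "0 < norm \<xi>" "norm \<xi> \<le> 1"
  shows "norm (kernel1 \<mu> t \<xi>) =
    exp (- \<mu> * norm \<xi> ^ 4 * t) * \<bar>sin (frequency \<mu> (norm \<xi>) * t)\<bar> / frequency \<mu> (norm \<xi>)"
proof -
  have "discriminant \<mu> (norm \<xi>) < 0"
    using discriminant_low(1)[OF assms] assms(3) by (smt (verit) zero_less_power)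
  then show ?thesis
    unfolding kernel1_eq norm_of_real
    by (simp add: osc_def frequency_def damping_def abs_mult)
qed

text \<open>The norm is convex and lies above its linearisation at \<open>x\<close>; the inequality
  is Cauchy-Schwarz against \<open>x\<close>.\<close>

lemma norm_add_direction_ge:
  fixes x e :: "'a::real_inner"
  assumes "x \<noteq> 0"
  shows "norm x + h * (x \<bullet> e) / norm x \<le> norm (x + h *\<^sub>R e)"
proof -
  have "norm x * norm x + h * (x \<bullet> e) = x \<bullet> (x + h *\<^sub>R e)"
    by (simp add: inner_right_distrib power2_norm_eq_inner flip: power2_eq_square)
  also have "\<dots> \<le> norm x * norm (x + h *\<^sub>R e)"
    by (rule norm_cauchy_schwarz)
  finally show ?thesis
    using assms by (simp add: field_simps)
qed

text \<open>The sines at a point and at its shift by 2/t cannot both be small, so the annulus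
  receives a fixed share of the energy. \<open>1 / t \<le> \<rho>\<close> keeps the shift comparable
  to the annulus, \<open>7 * \<rho> \<le> 1 / 4\<close> puts all radii in the range of
  \<open>frequency_diff\<close>, and the last hypothesis keeps the squared damping factor above exp
  (- 2).\<close>

lemma kernel1_annulus_lower:
  fixes \<mu> t \<rho> :: real
  assumes \<mu>: "0 < \<mu>" "\<mu> < 1" and t: "0 < t" and \<rho>: "1 / t \<le> \<rho>" "7 * \<rho> \<le> 1 / 4" "(7 * \<rho>) ^ 4 * t \<le> 1"
  shows "ennreal (exp (- 2) * unit_ball_vol CARD('n) / 1568 * (\<rho> ^ CARD('n) / \<rho>\<^sup>2)) \<le>
    (\<integral>\<^sup>+\<xi>. indicator {\<xi> :: real ^ 'n. 3 * \<rho> \<le> norm \<xi> \<and> norm \<xi> \<le> 7 * \<rho>} \<xi> * ennreal ((norm (kernel1 \<mu> t \<xi>))\<^sup>2) \<partial>lborel)"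
proof -
  have "0 < \<rho>" using t \<rho>(1) by (smt (verit) zero_less_divide_1_iff)
  define h where "h = 2 / t"
  have h: "0 < h" "h \<le> 2 * \<rho>" using t \<rho>(1) by (auto simp: h_def)
  obtain e :: "real ^ 'n" where e: "norm e = 1"
    using vector_choose_size[of 1] by auto
  define A where "A = {\<xi> :: real ^ 'n. 3 * \<rho> \<le> norm \<xi> \<and> norm \<xi> \<le> 7 * \<rho>}"
  \<comment> \<open>Points of this ball have norm between 3 \<rho> and 5 \<rho>, and the shift adds
    at most 2 \<rho>, so both points stay in the annulus. Moreover \<xi> \<bullet> e \<ge> 3/5
    |\<xi>|, so the shift increases the radius by at least 3/5 h.\<close>
  define S where "S = ball ((4 * \<rho>) *\<^sub>R e) \<rho>"
  define s where "s \<xi> = (sin (frequency \<mu> (norm (\<xi> :: real ^ 'n)) * t))\<^sup>2" for \<xi>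
  have [measurable]: "s \<in> borel_measurable borel"
    unfolding s_def frequency_def discriminant_def by measurable
  have A[measurable]: "Measurable.pred borel (\<lambda>\<xi>. \<xi> \<in> A)"
    unfolding A_def by measurable
  have [measurable]: "Measurable.pred borel (\<lambda>\<xi>. \<xi> \<in> S)"
    unfolding S_def by measurable
  have S: "3 * \<rho> \<le> norm \<xi> \<and> norm \<xi> \<le> 5 * \<rho> \<and> 3 * \<rho> \<le> \<xi> \<bullet> e" if "\<xi> \<in> S" for \<xi>
  proof -
    have d: "norm (\<xi> - (4 * \<rho>) *\<^sub>R e) \<le> \<rho>"
      using that by (simp add: S_def dist_norm norm_minus_commute)
    have n: "norm ((4 * \<rho>) *\<^sub>R e) = 4 * \<rho>" using e \<open>0 < \<rho>\<close> by simp
    have "\<bar>(\<xi> - (4 * \<rho>) *\<^sub>R e) \<bullet> e\<bar> \<le> \<rho> * 1"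
      using Cauchy_Schwarz_ineq2[of "\<xi> - (4 * \<rho>) *\<^sub>R e" e] d e by simp
    moreover have "(\<xi> - (4 * \<rho>) *\<^sub>R e) \<bullet> e = \<xi> \<bullet> e - 4 * \<rho>"
      using e by (simp add: inner_diff_left norm_eq_1)
    moreover have "norm \<xi> \<le> norm (\<xi> - (4 * \<rho>) *\<^sub>R e) + norm ((4 * \<rho>) *\<^sub>R e)"
      using norm_triangle_ineq[of "\<xi> - (4 * \<rho>) *\<^sub>R e" "(4 * \<rho>) *\<^sub>R e"] by simp
    moreover have "norm ((4 * \<rho>) *\<^sub>R e) \<le> norm (\<xi> - (4 * \<rho>) *\<^sub>R e) + norm \<xi>"
      using norm_triangle_ineq4[of \<xi> "\<xi> - (4 * \<rho>) *\<^sub>R e"] by simp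
    ultimately show ?thesis using d n by linarith
  qed
  have shift: "norm \<xi> + 3 / 5 * h \<le> norm (h *\<^sub>R e + \<xi>) \<and> norm (h *\<^sub>R e + \<xi>) \<le> norm \<xi> + h" if "\<xi> \<in> S" for \<xi>
  proof
    have "\<xi> \<noteq> 0" using S[OF that] \<open>0 < \<rho>\<close> by auto
    have "3 / 5 * norm \<xi> \<le> \<xi> \<bullet> e" using S[OF that] by linarith
    then have "3 / 5 \<le> (\<xi> \<bullet> e) / norm \<xi>" using \<open>\<xi> \<noteq> 0\<close> by (simp add: field_simps)
    then have "h * (3 / 5) \<le> h * ((\<xi> \<bullet> e) / norm \<xi>)" using h by (intro mult_left_mono) auto
    then show "norm \<xi> + 3 / 5 * h \<le> norm (h *\<^sub>R e + \<xi>)"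
      using norm_add_direction_ge[OF \<open>\<xi> \<noteq> 0\<close>, of h e]
      unfolding add.commute[of "h *\<^sub>R e"] times_divide_eq_right[symmetric] by linarith
    show "norm (h *\<^sub>R e + \<xi>) \<le> norm \<xi> + h"
      using norm_triangle_ineq[of "h *\<^sub>R e" \<xi>] e h by simp
  qed
  have in_A: "\<xi> \<in> A \<and> h *\<^sub>R e + \<xi> \<in> A" if "\<xi> \<in> S" for \<xi>
    using S[OF that] shift[OF that] h \<open>0 < \<rho>\<close> by (auto simp: A_def)
  have ge: "1 / 8 \<le> s \<xi> + s (h *\<^sub>R e + \<xi>)" if "\<xi> \<in> S" for \<xi>
  proof -
    let ?r = "norm \<xi>" and ?r' = "norm (h *\<^sub>R e + \<xi>)"
    have r: "0 < ?r" "?r \<le> ?r'" "?r' \<le> 1 / 4"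
      using S[OF that] shift[OF that] h \<rho> \<open>0 < \<rho>\<close> by linarith+
    note f = frequency_diff[OF \<mu> r]
    \<comment> \<open>With h = 2/t the phase changes by at least 5/6 * 3/5 * 2 = 1 and by at most
      9/8 * 2 = 9/4, the range allowed by \<open>sin_square_add_ge\<close>.\<close>
    have "5 / 6 * (3 / 5 * h) \<le> 5 / 6 * (?r' - ?r)" "9 / 8 * (?r' - ?r) \<le> 9 / 8 * h"
      using shift[OF that] by auto
    with f have "1 / 2 * h \<le> frequency \<mu> ?r' - frequency \<mu> ?r" "frequency \<mu> ?r' - frequency \<mu> ?r \<le> 9 / 8 * h"
      by auto
    then have "1 / 2 * h * t \<le> (frequency \<mu> ?r' - frequency \<mu> ?r) * t" "(frequency \<mu> ?r' - frequency \<mu> ?r) * t \<le> 9 / 8 * h * t"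
      using t by (auto intro!: mult_right_mono)
    then show ?thesis
      unfolding s_def using t by (intro sin_square_add_ge) (auto simp: h_def algebra_simps)
  qed
  have "ennreal (1 / 8 * (unit_ball_vol CARD('n) * \<rho> ^ CARD('n))) = (\<integral>\<^sup>+\<xi>. ennreal (1 / 8) * indicator S \<xi> \<partial>lborel)"
    using \<open>0 < \<rho>\<close> by (subst nn_integral_cmult_indicator) (auto simp: S_def emeasure_ball ennreal_mult'[symmetric])
  also have "\<dots> \<le> (\<integral>\<^sup>+\<xi>. indicator A \<xi> * ennreal (s \<xi>) + indicator A (h *\<^sub>R e + \<xi>) * ennreal (s (h *\<^sub>R e + \<xi>)) \<partial>lborel)"
  proof (rule nn_integral_mono)
    fix \<xi> :: "real ^ 'n"
    show "ennreal (1 / 8) * indicator S \<xi> \<le> indicator A \<xi> * ennreal (s \<xi>) + indicator A (h *\<^sub>R e + \<xi>) * ennreal (s (h *\<^sub>R e + \<xi>))"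
    proof (cases "\<xi> \<in> S")
      case True
      have "ennreal (1 / 8) \<le> ennreal (s \<xi> + s (h *\<^sub>R e + \<xi>))"
        by (intro ennreal_leI ge True)
      also have "\<dots> = ennreal (s \<xi>) + ennreal (s (h *\<^sub>R e + \<xi>))"
        by (rule ennreal_plus) (auto simp: s_def)
      finally show ?thesis using in_A[OF True] True by simp
    qed simp
  qed
  also have "\<dots> = (\<integral>\<^sup>+\<xi>. indicator A \<xi> * ennreal (s \<xi>) \<partial>lborel) + (\<integral>\<^sup>+\<xi>. indicator A (h *\<^sub>R e + \<xi>) * ennreal (s (h *\<^sub>R e + \<xi>)) \<partial>lborel)"
    by (rule nn_integral_add) measurable
  also have "(\<integral>\<^sup>+\<xi>. indicator A (h *\<^sub>R e + \<xi>) * ennreal (s (h *\<^sub>R e + \<xi>)) \<partial>lborel) = (\<integral>\<^sup>+\<xi>. indicator A \<xi> * ennreal (s \<xi>) \<partial>lborel)"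
    by (rule nn_integral_lborel_translation) measurable
  also have "(\<integral>\<^sup>+\<xi>. indicator A \<xi> * ennreal (s \<xi>) \<partial>lborel) + (\<integral>\<^sup>+\<xi>. indicator A \<xi> * ennreal (s \<xi>) \<partial>lborel) =
      2 * (\<integral>\<^sup>+\<xi>. indicator A \<xi> * ennreal (s \<xi>) \<partial>lborel)"
    by (simp add: mult_2)
  finally have main: "ennreal (1 / 8 * (unit_ball_vol CARD('n) * \<rho> ^ CARD('n))) \<le> 2 * (\<integral>\<^sup>+\<xi>. indicator A \<xi> * ennreal (s \<xi>) \<partial>lborel)" .
  \<comment> \<open>The numerator bounds the squared damping from below and the denominator bounds
    \<omega>^2 from above. Only half of \<open>c\<close> is used, since the two translates count the
    annulus twice.\<close>
  define c where "c = exp (- 2) / (98 * \<rho>\<^sup>2)"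
  have "0 \<le> c" by (simp add: c_def)
  have "ennreal (c / 2) * ennreal (1 / 8 * (unit_ball_vol CARD('n) * \<rho> ^ CARD('n))) \<le>
      ennreal (c / 2) * (2 * (\<integral>\<^sup>+\<xi>. indicator A \<xi> * ennreal (s \<xi>) \<partial>lborel))"
    by (intro mult_left_mono main) simp
  also have "\<dots> = (ennreal (c / 2) * 2) * (\<integral>\<^sup>+\<xi>. indicator A \<xi> * ennreal (s \<xi>) \<partial>lborel)"
    by (simp add: mult.assoc)
  also have "ennreal (c / 2) * 2 = ennreal c"
    using two_mult_ennreal[of "c / 2"] by (simp add: mult.commute)
  also have "ennreal c * (\<integral>\<^sup>+\<xi>. indicator A \<xi> * ennreal (s \<xi>) \<partial>lborel) =
      (\<integral>\<^sup>+\<xi>. ennreal c * (indicator A \<xi> * ennreal (s \<xi>)) \<partial>lborel)"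
    by (rule nn_integral_cmult[symmetric]) measurable
  also have "\<dots> \<le> (\<integral>\<^sup>+\<xi>. indicator A \<xi> * ennreal ((norm (kernel1 \<mu> t \<xi>))\<^sup>2) \<partial>lborel)"
  proof (rule nn_integral_mono)
    fix \<xi> :: "real ^ 'n"
    have "c * s \<xi> \<le> (norm (kernel1 \<mu> t \<xi>))\<^sup>2" if "\<xi> \<in> A"
    proof -
      let ?r = "norm \<xi>"
      have r: "0 < ?r" "?r \<le> 1" "?r \<le> 7 * \<rho>" using that \<rho> \<open>0 < \<rho>\<close> by (auto simp: A_def)
      note w = frequency_bounds[OF \<mu> r(1,2)]
      have "?r ^ 4 * t \<le> (7 * \<rho>) ^ 4 * t"
        using r t by (intro mult_right_mono power_mono) auto
      then have "?r ^ 4 * t \<le> 1" using \<rho>(3) by (rule order_trans)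
      then have "\<mu> * (?r ^ 4 * t) \<le> 1 * 1"
        using \<mu> t by (intro mult_mono) auto
      then have "exp (- 1) \<le> exp (- \<mu> * ?r ^ 4 * t)" by (simp add: mult.assoc)
      then have "(exp (- 1))\<^sup>2 \<le> (exp (- \<mu> * ?r ^ 4 * t))\<^sup>2" by (intro power_mono) auto
      then have ex: "exp (- 2) \<le> (exp (- \<mu> * ?r ^ 4 * t))\<^sup>2"
        by (simp flip: exp_double)
      have "?r\<^sup>2 \<le> (7 * \<rho>)\<^sup>2" using r by (intro power_mono) auto
      with w(4) have fr: "(frequency \<mu> ?r)\<^sup>2 \<le> 98 * \<rho>\<^sup>2" by (simp add: power_mult_distrib)
      have f0: "0 < (frequency \<mu> ?r)\<^sup>2" using w(1) r by (intro zero_less_power) linarith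
      have "c * s \<xi> = exp (- 2) * s \<xi> / (98 * \<rho>\<^sup>2)" by (simp add: c_def)
      also have "\<dots> \<le> (exp (- \<mu> * ?r ^ 4 * t))\<^sup>2 * s \<xi> / (frequency \<mu> ?r)\<^sup>2"
        using ex fr f0 by (intro frac_le mult_right_mono) (auto simp: s_def)
      also have "\<dots> = (norm (kernel1 \<mu> t \<xi>))\<^sup>2"
        unfolding norm_kernel1_low[OF \<mu> r(1,2)] by (simp add: power_mult_distrib power_divide s_def)
      finally show ?thesis .
    qed
    then show "ennreal c * (indicator A \<xi> * ennreal (s \<xi>)) \<le> indicator A \<xi> * ennreal ((norm (kernel1 \<mu> t \<xi>))\<^sup>2)"
      using \<open>0 \<le> c\<close> by (auto simp: indicator_def ennreal_leI s_def simp flip: ennreal_mult)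
  qed
  also have "ennreal (c / 2) * ennreal (1 / 8 * (unit_ball_vol CARD('n) * \<rho> ^ CARD('n))) =
      ennreal (exp (- 2) * unit_ball_vol CARD('n) / 1568 * (\<rho> ^ CARD('n) / \<rho>\<^sup>2))"
    using \<open>0 \<le> c\<close> by (subst ennreal_mult'[symmetric]) (simp_all add: c_def mult.assoc)
  finally show ?thesis by (simp add: A_def)
qed

section \<open>Radial integrals\<close>

lemma nn_integral_power_gaussian_scaling:
  fixes \<beta> c t :: real
  assumes "0 < t"
  shows "(\<integral>\<^sup>+(\<xi> :: real ^ 'n). ennreal (norm \<xi> powr \<beta> * exp (- c * norm \<xi> ^ 4 * t)) \<partial>lborel) =
    ennreal (t powr (- (\<beta> + CARD('n)) / 4)) * (\<integral>\<^sup>+(\<xi> :: real ^ 'n). ennreal (norm \<xi> powr \<beta> * exp (- c * norm \<xi> ^ 4)) \<partial>lborel)"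
proof -
  define k where "k = t powr (- 1 / 4)"
  have "0 < k" using assms by (simp add: k_def)
  have "k ^ 4 = t powr (- 1)"
    using assms by (simp add: k_def powr_realpow[symmetric] powr_powr)
  then have k4: "k ^ 4 * t = 1" using assms by (simp add: powr_minus)
  have "(\<integral>\<^sup>+(\<xi> :: real ^ 'n). ennreal (norm \<xi> powr \<beta> * exp (- c * norm \<xi> ^ 4 * t)) \<partial>lborel) =
      ennreal (k ^ CARD('n)) * (\<integral>\<^sup>+(\<xi> :: real ^ 'n). ennreal (norm (k *\<^sub>R \<xi>) powr \<beta> * exp (- c * norm (k *\<^sub>R \<xi>) ^ 4 * t)) \<partial>lborel)"
    using nn_integral_lborel_scaleR[OF _ \<open>0 < k\<close>, of "\<lambda>\<xi> :: real ^ 'n. ennreal (norm \<xi> powr \<beta> * exp (- c * norm \<xi> ^ 4 * t))"]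
    by simp
  also have "(\<lambda>\<xi> :: real ^ 'n. ennreal (norm (k *\<^sub>R \<xi>) powr \<beta> * exp (- c * norm (k *\<^sub>R \<xi>) ^ 4 * t))) =
      (\<lambda>\<xi>. ennreal (k powr \<beta>) * ennreal (norm \<xi> powr \<beta> * exp (- c * norm \<xi> ^ 4)))"
  proof
    fix \<xi> :: "real ^ 'n"
    have "- c * norm (k *\<^sub>R \<xi>) ^ 4 * t = - c * norm \<xi> ^ 4 * (k ^ 4 * t)"
      using \<open>0 < k\<close> by (simp add: power_mult_distrib)
    then show "ennreal (norm (k *\<^sub>R \<xi>) powr \<beta> * exp (- c * norm (k *\<^sub>R \<xi>) ^ 4 * t)) =
        ennreal (k powr \<beta>) * ennreal (norm \<xi> powr \<beta> * exp (- c * norm \<xi> ^ 4))"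
      unfolding k4 using \<open>0 < k\<close> by (simp add: powr_mult mult.assoc flip: ennreal_mult)
  qed
  also have "(\<integral>\<^sup>+(\<xi> :: real ^ 'n). ennreal (k powr \<beta>) * ennreal (norm \<xi> powr \<beta> * exp (- c * norm \<xi> ^ 4)) \<partial>lborel) =
      ennreal (k powr \<beta>) * (\<integral>\<^sup>+(\<xi> :: real ^ 'n). ennreal (norm \<xi> powr \<beta> * exp (- c * norm \<xi> ^ 4)) \<partial>lborel)"
    by (rule nn_integral_cmult) measurable
  also have "ennreal (k ^ CARD('n)) * (ennreal (k powr \<beta>) * (\<integral>\<^sup>+(\<xi> :: real ^ 'n). ennreal (norm \<xi> powr \<beta> * exp (- c * norm \<xi> ^ 4)) \<partial>lborel)) =
     ennreal (k ^ CARD('n) * k powr \<beta>) * (\<integral>\<^sup>+(\<xi> :: real ^ 'n). ennreal (norm \<xi> powr \<beta> * exp (- c * norm \<xi> ^ 4)) \<partial>lborel)"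
    using \<open>0 < k\<close> by (simp add: ennreal_mult mult.assoc)
  also have "k ^ CARD('n) * k powr \<beta> = t powr (- (\<beta> + CARD('n)) / 4)"
  proof -
    have "k ^ CARD('n) * k powr \<beta> = k powr (\<beta> + CARD('n))"
      using \<open>0 < k\<close> by (simp add: powr_realpow[symmetric] powr_add add.commute)
    also have "\<dots> = t powr (- 1 / 4 * (\<beta> + CARD('n)))"
      by (simp only: k_def powr_powr)
    also have "- 1 / 4 * (\<beta> + CARD('n)) = - (\<beta> + CARD('n)) / 4"
      by (simp only: times_divide_eq_left mult_minus1)
    finally show ?thesis .
  qed
  finally show ?thesis .
qed

text \<open>The quartic exponential beats the Gaussian outside a ball, and inside it the power is
  bounded because \<beta> \<ge> 0. An indicator plus a multiple of \<open>gauss\<close> is the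
  majorant.\<close>

lemma nn_integral_power_gaussian_finite:
  fixes \<beta> c :: real
  assumes "0 \<le> \<beta>" "0 < c"
  shows "(\<integral>\<^sup>+(\<xi> :: real ^ 'n). ennreal (norm \<xi> powr \<beta> * exp (- c * norm \<xi> ^ 4)) \<partial>lborel) < \<infinity>"
proof -
  have "eventually (\<lambda>r::real. r powr \<beta> * exp (- c * r ^ 4) \<le> exp (- r\<^sup>2 / 2)) at_top"
    using assms(2) by real_asymp
  then obtain R where R: "\<And>r. R \<le> r \<Longrightarrow> r powr \<beta> * exp (- c * r ^ 4) \<le> exp (- r\<^sup>2 / 2)"
    by (auto simp: eventually_at_top_linorder)
  have le: "norm \<xi> powr \<beta> * exp (- c * norm \<xi> ^ 4) \<le>
      max 0 R powr \<beta> * indicator (cball 0 R) \<xi> + sqrt (2 * pi) ^ CARD('n) * gauss \<xi>" for \<xi> :: "real ^ 'n"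
  proof (cases "R \<le> norm \<xi>")
    case True
    then show ?thesis
      using R[OF True] by (intro order_trans[OF R[OF True]]) (simp add: gauss_def indicator_def)
  next
    case False
    then have "norm \<xi> powr \<beta> * exp (- c * norm \<xi> ^ 4) \<le> max 0 R powr \<beta> * 1"
      using assms by (intro mult_mono powr_mono2) auto
    moreover have "0 \<le> sqrt (2 * pi) ^ CARD('n) * gauss \<xi>" by simp
    moreover have "indicator (cball 0 R) \<xi> = (1 :: real)" using False by simp
    ultimately show ?thesis by (simp only:)
  qed
  have "integrable lborel (\<lambda>\<xi> :: real ^ 'n. max 0 R powr \<beta> * indicator (cball 0 R) \<xi> + sqrt (2 * pi) ^ CARD('n) * gauss \<xi>)"
    using emeasure_lborel_cball_finite[of "0 :: real ^ 'n" R] has_bochner_integral_gauss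
    by (intro Bochner_Integration.integrable_add integrable_mult_right integrable_real_indicator)
      (auto simp: has_bochner_integral_iff)
  then have "integrable lborel (\<lambda>\<xi> :: real ^ 'n. norm \<xi> powr \<beta> * exp (- c * norm \<xi> ^ 4))"
    by (rule Bochner_Integration.integrable_bound) (use le in \<open>auto intro: order_trans[OF _ abs_ge_self]\<close>)
  then show ?thesis
    by (simp add: integrable_iff_bounded)
qed

text \<open>On the shell from 2^-(k+1) to 2^-k the function 1 / r^2 is at most 4^(k+1). Whole balls
  replace shells, since their volumes are explicit and the overcounting only costs a constant
  factor.\<close>

lemma min_inverse_square_le_dyadic:
  fixes r :: real
  assumes "0 < r" "r \<le> 1"
  shows "min (4 ^ N) (1 / r\<^sup>2) \<le> (\<Sum>k\<le>N. 4 ^ Suc k * indicator {..(1 / 2) ^ k} r)"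
proof (induction N)
  case 0
  have "min 1 (1 / r\<^sup>2) \<le> 4" by (rule min.coboundedI1) simp
  then show ?case using assms by simp
next
  case (Suc N)
  have nn: "0 \<le> (4::real) ^ Suc (Suc N) * indicator {..(1 / 2) ^ Suc N} r" by simp
  show ?case
  proof (cases "r \<le> (1 / 2) ^ Suc N")
    case True
    have "min (4 ^ Suc N) (1 / r\<^sup>2) \<le> 4 ^ Suc (Suc N) * indicator {..(1 / 2) ^ Suc N} r"
    proof (rule min.coboundedI1)
      show "(4::real) ^ Suc N \<le> 4 ^ Suc (Suc N) * indicator {..(1 / 2) ^ Suc N} r"
        using True by simp
    qed
    moreover have "0 \<le> (\<Sum>k\<le>N. 4 ^ Suc k * indicator {..(1 / 2) ^ k} r :: real)"
      by (intro sum_nonneg) simp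
    ultimately show ?thesis by simp
  next
    case False
    have "((1 / 2) ^ Suc N)\<^sup>2 \<le> r\<^sup>2" using False by (intro power_mono) auto
    then have "1 / r\<^sup>2 \<le> 1 / ((1 / 2) ^ Suc N)\<^sup>2" by (intro divide_left_mono) (use assms in auto)
    also have "\<dots> = 4 ^ Suc N"
    proof -
      have "((1 / 2 :: real) ^ Suc N)\<^sup>2 = (1 / 4) ^ Suc N"
        by (simp add: power2_eq_square flip: power_mult_distrib)
      then show ?thesis by (simp add: power_one_over)
    qed
    finally have up: "1 / r\<^sup>2 \<le> 4 ^ Suc N" .
    show ?thesis
    proof (cases "1 / r\<^sup>2 \<le> 4 ^ N")
      case True
      show ?thesis
        using Suc nn unfolding sum.atMost_Suc min_absorb2[OF up] min_absorb2[OF True] by linarith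
    next
      case False
      \<comment> \<open>Here 1 / r^2 lies between 4^N and 4^(N+1), so the single summand with k = N
        already suffices.\<close>
      have "r \<le> (1 / 2) ^ N"
      proof (rule ccontr)
        assume "\<not> r \<le> (1 / 2) ^ N"
        then have "((1 / 2) ^ N)\<^sup>2 \<le> r\<^sup>2" by (intro power_mono) auto
        then have "1 / r\<^sup>2 \<le> 1 / ((1 / 2) ^ N)\<^sup>2" by (intro divide_left_mono) (use assms in auto)
        moreover have "((1 / 2 :: real) ^ N)\<^sup>2 = (1 / 4) ^ N"
          by (simp add: power2_eq_square flip: power_mult_distrib)
        ultimately show False using False by (simp add: power_one_over)
      qed
      then have "4 ^ Suc N \<le> (\<Sum>k\<in>{N}. 4 ^ Suc k * indicator {..(1 / 2) ^ k} r :: real)"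
        by simp
      also have "\<dots> \<le> (\<Sum>k\<le>N. 4 ^ Suc k * indicator {..(1 / 2) ^ k} r)"
        by (intro sum_mono2) auto
      finally show ?thesis
        using nn up unfolding sum.atMost_Suc min_absorb2[OF up] by linarith
    qed
  qed
qed

text \<open>Integrating the dyadic sum gives a geometric series whose ratio separates the
  dimensions: 2 for n = 1, 1 for n = 2, at most 1/2 from n = 3 on.\<close>

lemma nn_integral_min_inverse_square:
  "(\<integral>\<^sup>+(\<xi> :: real ^ 'n). indicator (cball 0 1) \<xi> * ennreal (min (4 ^ N) (1 / (norm \<xi>)\<^sup>2)) \<partial>lborel) \<le>
    ennreal (\<Sum>k\<le>N. 4 * unit_ball_vol CARD('n) * (4 / 2 ^ CARD('n)) ^ k)"
proof -
  have "AE \<xi> :: real ^ 'n in lborel. indicator (cball 0 1) \<xi> * ennreal (min (4 ^ N) (1 / (norm \<xi>)\<^sup>2)) \<le>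
      (\<Sum>k\<le>N. ennreal (4 ^ Suc k) * indicator (cball 0 ((1 / 2) ^ k)) \<xi>)"
    \<comment> \<open>The pointwise dyadic bound presupposes a positive radius; the origin is a null
      set.\<close>
    using AE_lborel_singleton[of "0 :: real ^ 'n"]
  proof eventually_elim
    case (elim \<xi>)
    show ?case
    proof (cases "norm \<xi> \<le> 1")
      case True
      have "ennreal (min (4 ^ N) (1 / (norm \<xi>)\<^sup>2)) \<le> ennreal (\<Sum>k\<le>N. 4 ^ Suc k * indicator {..(1 / 2) ^ k} (norm \<xi>))"
        using elim True by (intro ennreal_leI min_inverse_square_le_dyadic) auto
      also have "\<dots> = (\<Sum>k\<le>N. ennreal (4 ^ Suc k * indicator {..(1 / 2) ^ k} (norm \<xi>)))"
        by (rule sum_ennreal[symmetric]) simp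
      also have "\<dots> = (\<Sum>k\<le>N. ennreal (4 ^ Suc k) * indicator (cball 0 ((1 / 2) ^ k)) \<xi>)"
        by (intro sum.cong) (auto simp: indicator_def)
      finally show ?thesis using True by (simp add: indicator_def)
    qed (simp add: indicator_def)
  qed
  then have "(\<integral>\<^sup>+(\<xi> :: real ^ 'n). indicator (cball 0 1) \<xi> * ennreal (min (4 ^ N) (1 / (norm \<xi>)\<^sup>2)) \<partial>lborel) \<le>
      (\<integral>\<^sup>+(\<xi> :: real ^ 'n). (\<Sum>k\<le>N. ennreal (4 ^ Suc k) * indicator (cball 0 ((1 / 2) ^ k)) \<xi>) \<partial>lborel)"
    by (rule nn_integral_mono_AE)
  also have "\<dots> = (\<Sum>k\<le>N. (\<integral>\<^sup>+(\<xi> :: real ^ 'n). ennreal (4 ^ Suc k) * indicator (cball 0 ((1 / 2) ^ k)) \<xi> \<partial>lborel))"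
    by (rule nn_integral_sum) measurable
  also have "\<dots> = (\<Sum>k\<le>N. ennreal (4 * unit_ball_vol CARD('n) * (4 / 2 ^ CARD('n)) ^ k))"
  proof (intro sum.cong refl)
    fix k
    have "4 ^ Suc k * (unit_ball_vol CARD('n) * ((1 / 2) ^ k) ^ CARD('n)) =
        4 * unit_ball_vol CARD('n) * (4 / 2 ^ CARD('n)) ^ k"
      by (simp add: power_divide mult.commute[of k] flip: power_mult)
    then show "(\<integral>\<^sup>+(\<xi> :: real ^ 'n). ennreal (4 ^ Suc k) * indicator (cball 0 ((1 / 2) ^ k)) \<xi> \<partial>lborel) =
        ennreal (4 * unit_ball_vol CARD('n) * (4 / 2 ^ CARD('n)) ^ k)"
      by (subst nn_integral_cmult_indicator) (simp_all add: emeasure_cball ennreal_mult'[symmetric] del: power_Suc)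
  qed
  also have "\<dots> = ennreal (\<Sum>k\<le>N. 4 * unit_ball_vol CARD('n) * (4 / 2 ^ CARD('n)) ^ k)"
    by (rule sum_ennreal) simp
  finally show ?thesis .
qed

lemma nn_integral_inverse_square_cball:
  assumes "3 \<le> CARD('n)"
  shows "(\<integral>\<^sup>+(\<xi> :: real ^ 'n). indicator (cball 0 1) \<xi> * ennreal (1 / (norm \<xi>)\<^sup>2) \<partial>lborel) < \<infinity>"
proof -
  have "(\<lambda>N. \<integral>\<^sup>+(\<xi> :: real ^ 'n). indicator (cball 0 1) \<xi> * ennreal (min (4 ^ N) (1 / (norm \<xi>)\<^sup>2)) \<partial>lborel) \<longlonglongrightarrow>
      (\<integral>\<^sup>+(\<xi> :: real ^ 'n). indicator (cball 0 1) \<xi> * ennreal (1 / (norm \<xi>)\<^sup>2) \<partial>lborel)"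
  proof (rule nn_integral_LIMSEQ)
    show "incseq (\<lambda>N (\<xi> :: real ^ 'n). indicator (cball 0 1) \<xi> * ennreal (min (4 ^ N) (1 / (norm \<xi>)\<^sup>2)))"
    proof (intro incseq_SucI le_funI)
      fix N and \<xi> :: "real ^ 'n"
      have "min (4 ^ N) (1 / (norm \<xi>)\<^sup>2) \<le> min (4 ^ Suc N) (1 / (norm \<xi>)\<^sup>2)"
        by (rule min.mono) simp_all
      then show "indicator (cball 0 1) \<xi> * ennreal (min (4 ^ N) (1 / (norm \<xi>)\<^sup>2)) \<le>
          indicator (cball 0 1) \<xi> * ennreal (min (4 ^ Suc N) (1 / (norm \<xi>)\<^sup>2))"
        by (intro mult_left_mono ennreal_leI) simp_all
    qed
    fix \<xi> :: "real ^ 'n"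
    obtain N where N: "1 / (norm \<xi>)\<^sup>2 < 4 ^ N"
      using real_arch_pow[of 4 "1 / (norm \<xi>)\<^sup>2"] by auto
    have "eventually (\<lambda>N. min (4 ^ N) (1 / (norm \<xi>)\<^sup>2) = 1 / (norm \<xi>)\<^sup>2) sequentially"
      using eventually_ge_at_top[of N]
    proof eventually_elim
      case (elim M)
      have "(4::real) ^ N \<le> 4 ^ M" using elim by (intro power_increasing) auto
      then show ?case using N by (intro min_absorb2) linarith
    qed
    then have "eventually (\<lambda>N. indicator (cball 0 1) \<xi> * ennreal (min (4 ^ N) (1 / (norm \<xi>)\<^sup>2)) = indicator (cball 0 1) \<xi> * ennreal (1 / (norm \<xi>)\<^sup>2)) sequentially"
      by eventually_elim simp
    then show "(\<lambda>N. indicator (cball 0 1) \<xi> * ennreal (min (4 ^ N) (1 / (norm \<xi>)\<^sup>2))) \<longlonglongrightarrow> indicator (cball 0 1) \<xi> * ennreal (1 / (norm \<xi>)\<^sup>2)"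
      by (rule tendsto_eventually)
  qed measurable
  then have "(\<integral>\<^sup>+(\<xi> :: real ^ 'n). indicator (cball 0 1) \<xi> * ennreal (1 / (norm \<xi>)\<^sup>2) \<partial>lborel) \<le> ennreal (8 * unit_ball_vol CARD('n))"
  proof (rule LIMSEQ_le_const2, intro exI[of _ 0] allI impI)
    fix N :: nat assume "0 \<le> N"
    have q: "(4::real) / 2 ^ CARD('n) \<le> 1 / 2"
      using power_increasing[OF assms, of "2::real"] by (simp add: field_simps)
    have "(\<Sum>k\<le>N. 4 * unit_ball_vol CARD('n) * (4 / 2 ^ CARD('n)) ^ k) \<le> (\<Sum>k\<le>N. 4 * unit_ball_vol CARD('n) * (1 / 2) ^ k)"
      by (intro sum_mono mult_left_mono power_mono q) auto
    also have "\<dots> = 4 * unit_ball_vol CARD('n) * (\<Sum>k<Suc N. (1 / 2) ^ k)"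
      by (simp add: sum_distrib_left lessThan_Suc_atMost)
    also have "\<dots> \<le> 4 * unit_ball_vol CARD('n) * 2"
      by (intro mult_left_mono) (auto simp: geometric_sum)
    finally have "ennreal (\<Sum>k\<le>N. 4 * unit_ball_vol CARD('n) * (4 / 2 ^ CARD('n)) ^ k) \<le> ennreal (8 * unit_ball_vol CARD('n))"
      by (intro ennreal_leI) simp
    then show "(\<integral>\<^sup>+(\<xi> :: real ^ 'n). indicator (cball 0 1) \<xi> * ennreal (min (4 ^ N) (1 / (norm \<xi>)\<^sup>2)) \<partial>lborel) \<le> ennreal (8 * unit_ball_vol CARD('n))"
      by (rule order_trans[OF nn_integral_min_inverse_square])
  qed
  also have "\<dots> < \<infinity>" by simp
  finally show ?thesis .
qed

lemma nn_integral_inverse_square_gaussian_finite: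
  assumes "3 \<le> CARD('n)" "0 < c"
  shows "(\<integral>\<^sup>+(\<xi> :: real ^ 'n). ennreal (norm \<xi> powr (- 2) * exp (- c * norm \<xi> ^ 4)) \<partial>lborel) < \<infinity>"
proof -
  have "ennreal (norm \<xi> powr (- 2) * exp (- c * norm \<xi> ^ 4)) \<le>
      indicator (cball 0 1) \<xi> * ennreal (1 / (norm \<xi>)\<^sup>2) + ennreal (norm \<xi> powr 0 * exp (- c * norm \<xi> ^ 4))" for \<xi> :: "real ^ 'n"
  proof (cases "norm \<xi> \<le> 1")
    case True
    have "norm \<xi> powr (- 2) * exp (- c * norm \<xi> ^ 4) \<le> norm \<xi> powr (- 2) * 1"
      using assms by (intro mult_left_mono) auto
    \<comment> \<open>At the origin both sides are 0, by the conventions for \<open>powr\<close> and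
      for division.\<close>
    also have "\<dots> = 1 / (norm \<xi>)\<^sup>2"
      by (cases "\<xi> = 0") (auto simp: powr_minus powr_numeral divide_simps)
    finally have "ennreal (norm \<xi> powr (- 2) * exp (- c * norm \<xi> ^ 4)) \<le> ennreal (1 / (norm \<xi>)\<^sup>2)"
      by (rule ennreal_leI)
    with True show ?thesis by (simp add: indicator_def add_increasing2)
  next
    case False
    then have "norm \<xi> powr (- 2) * exp (- c * norm \<xi> ^ 4) \<le> norm \<xi> powr 0 * exp (- c * norm \<xi> ^ 4)"
      by (intro mult_right_mono powr_mono) auto
    from ennreal_leI[OF this] show ?thesis using False by (simp add: indicator_def)
  qed
  then have "(\<integral>\<^sup>+(\<xi> :: real ^ 'n). ennreal (norm \<xi> powr (- 2) * exp (- c * norm \<xi> ^ 4)) \<partial>lborel) \<le>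
     (\<integral>\<^sup>+(\<xi> :: real ^ 'n). indicator (cball 0 1) \<xi> * ennreal (1 / (norm \<xi>)\<^sup>2) + ennreal (norm \<xi> powr 0 * exp (- c * norm \<xi> ^ 4)) \<partial>lborel)"
    by (rule nn_integral_mono)
  also have "\<dots> = (\<integral>\<^sup>+(\<xi> :: real ^ 'n). indicator (cball 0 1) \<xi> * ennreal (1 / (norm \<xi>)\<^sup>2) \<partial>lborel) +
      (\<integral>\<^sup>+(\<xi> :: real ^ 'n). ennreal (norm \<xi> powr 0 * exp (- c * norm \<xi> ^ 4)) \<partial>lborel)"
    by (rule nn_integral_add) measurable
  also have "\<dots> < \<infinity>"
    using nn_integral_inverse_square_cball[OF assms(1)] nn_integral_power_gaussian_finite[OF order_refl assms(2)]
    by (simp add: less_top)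
  finally show ?thesis .
qed

section \<open>Low frequency energy of the kernels\<close>

text \<open>Note that \<open>weight 0 0 = 0\<close>, since \<open>0 powr 0 = 0\<close>.\<close>

abbreviation weight :: "real \<Rightarrow> real ^ 'n \<Rightarrow> real"
  where "weight \<sigma> \<xi> \<equiv> (norm \<xi> powr \<sigma>)\<^sup>2"

abbreviation energy :: "real \<Rightarrow> (real ^ 'n \<Rightarrow> complex) \<Rightarrow> ennreal"
  where "energy \<sigma> g \<equiv> \<integral>\<^sup>+\<xi>. ennreal (weight \<sigma> \<xi> * (norm (g \<xi>))\<^sup>2) \<partial>lborel"

abbreviation low_energy :: "real \<Rightarrow> real \<Rightarrow> (real ^ 'n \<Rightarrow> complex) \<Rightarrow> ennreal"
  where "low_energy \<sigma> r g \<equiv> \<integral>\<^sup>+\<xi>. indicator (cball 0 r) \<xi> * ennreal (weight \<sigma> \<xi> * (norm (g \<xi>))\<^sup>2) \<partial>lborel"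

abbreviation high_energy :: "real \<Rightarrow> (real ^ 'n \<Rightarrow> complex) \<Rightarrow> ennreal"
  where "high_energy \<sigma> g \<equiv> \<integral>\<^sup>+\<xi>. indicator (- ball 0 1) \<xi> * ennreal (weight \<sigma> \<xi> * (norm (g \<xi>))\<^sup>2) \<partial>lborel"

abbreviation multiplier :: "real \<Rightarrow> real \<Rightarrow> (real ^ 'n \<Rightarrow> complex) \<Rightarrow> (real ^ 'n \<Rightarrow> complex) \<Rightarrow> real ^ 'n \<Rightarrow> complex"
  where "multiplier \<mu> t F0 F1 \<xi> \<equiv> kernel0 \<mu> t \<xi> * F0 \<xi> + kernel1 \<mu> t \<xi> * F1 \<xi>"

lemma powr_square: "(x powr a)\<^sup>2 = x powr (2 * a)" for x a :: real
  by (simp add: power2_eq_square flip: powr_add)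

lemma low_energy_upper_if_gaussian_bound:
  fixes K :: "real \<Rightarrow> real ^ 'n \<Rightarrow> complex" and c \<beta> \<nu> \<sigma> :: real
  assumes Z: "(\<integral>\<^sup>+(\<xi> :: real ^ 'n). ennreal (norm \<xi> powr \<beta> * exp (- \<nu> * norm \<xi> ^ 4)) \<partial>lborel) < \<infinity>"
    and c: "0 \<le> c"
    and bound: "\<And>t \<xi>. 0 < t \<Longrightarrow> \<xi> \<noteq> 0 \<Longrightarrow> norm \<xi> \<le> 1 \<Longrightarrow>
      weight \<sigma> \<xi> * (norm (K t \<xi>))\<^sup>2 \<le> c * (norm \<xi> powr \<beta> * exp (- \<nu> * norm \<xi> ^ 4 * t))"
  shows "\<exists>C\<ge>0. \<forall>t>0. low_energy \<sigma> 1 (K t) \<le> ennreal (C * t powr (- (\<beta> + real CARD('n)) / 4))"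
proof -
  let ?Z = "\<integral>\<^sup>+(\<xi> :: real ^ 'n). ennreal (norm \<xi> powr \<beta> * exp (- \<nu> * norm \<xi> ^ 4)) \<partial>lborel"
  obtain z where z: "?Z = ennreal z" "0 \<le> z"
    using Z by (cases ?Z) auto
  have "low_energy \<sigma> 1 (K t) \<le> ennreal (c * z * t powr (- (\<beta> + real CARD('n)) / 4))" if t: "0 < t" for t
  proof -
    have "indicator (cball 0 1) \<xi> * ennreal (weight \<sigma> \<xi> * (norm (K t \<xi>))\<^sup>2) \<le>
        ennreal c * ennreal (norm \<xi> powr \<beta> * exp (- \<nu> * norm \<xi> ^ 4 * t))" for \<xi>
    proof (cases "\<xi> \<noteq> 0 \<and> norm \<xi> \<le> 1")
      case True
      with ennreal_leI[OF bound[OF t]] c show ?thesis by (simp add: ennreal_mult')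
    qed auto
    then have "low_energy \<sigma> 1 (K t) \<le>
        (\<integral>\<^sup>+(\<xi> :: real ^ 'n). ennreal c * ennreal (norm \<xi> powr \<beta> * exp (- \<nu> * norm \<xi> ^ 4 * t)) \<partial>lborel)"
      by (rule nn_integral_mono)
    also have "\<dots> = ennreal c * (\<integral>\<^sup>+(\<xi> :: real ^ 'n). ennreal (norm \<xi> powr \<beta> * exp (- \<nu> * norm \<xi> ^ 4 * t)) \<partial>lborel)"
      by (rule nn_integral_cmult) measurable
    also have "\<dots> = ennreal (c * z * t powr (- (\<beta> + real CARD('n)) / 4))"
      unfolding nn_integral_power_gaussian_scaling[OF t] z(1) using c z(2) by (simp add: mult_ac flip: ennreal_mult)
    finally show ?thesis .
  qed
  then show ?thesis
    using c z(2) by (intro exI[of _ "c * z"]) auto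
qed

text \<open>Compared with the second kernel the factor |\<xi>|^-2 is absent, which gains t^(-1/2) in
  the energy and makes this contribution of lower order.\<close>

lemma kernel0_low_frequency_upper:
  fixes \<mu> \<sigma> :: real
  assumes \<mu>: "0 < \<mu>" "\<mu> < 1" and "0 \<le> \<sigma>"
  shows "\<exists>C\<ge>0. \<forall>t>0. low_energy \<sigma> 1 (kernel0 \<mu> t :: real ^ 'n \<Rightarrow> complex) \<le>
    ennreal (C * t powr (- (2 * \<sigma> + real CARD('n)) / 4))"
proof (rule low_energy_upper_if_gaussian_bound)
  show "(\<integral>\<^sup>+(\<xi> :: real ^ 'n). ennreal (norm \<xi> powr (2 * \<sigma>) * exp (- (2 * \<mu>) * norm \<xi> ^ 4)) \<partial>lborel) < \<infinity>"
    using assms by (intro nn_integral_power_gaussian_finite) auto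
  fix t :: real and \<xi> :: "real ^ 'n" assume t: "0 < t" and \<xi>: "\<xi> \<noteq> 0" "norm \<xi> \<le> 1"
  have "(norm (kernel0 \<mu> t \<xi>))\<^sup>2 \<le> (2 * exp (- \<mu> * norm \<xi> ^ 4 * t))\<^sup>2"
    using \<xi> t by (intro power_mono kernel_low \<mu>) auto
  also have "\<dots> = 4 * exp (- (2 * \<mu>) * norm \<xi> ^ 4 * t)"
    by (simp add: power_mult_distrib mult.assoc flip: exp_double)
  finally have "weight \<sigma> \<xi> * (norm (kernel0 \<mu> t \<xi>))\<^sup>2 \<le> weight \<sigma> \<xi> * (4 * exp (- (2 * \<mu>) * norm \<xi> ^ 4 * t))"
    by (intro mult_left_mono) auto
  then show "weight \<sigma> \<xi> * (norm (kernel0 \<mu> t \<xi>))\<^sup>2 \<le> 4 * (norm \<xi> powr (2 * \<sigma>) * exp (- (2 * \<mu>) * norm \<xi> ^ 4 * t))"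
    by (simp only: powr_square mult.left_commute[of 4])
qed simp

text \<open>The squared kernel costs |\<xi>|^-2. This is compensated by the weight if \<sigma> \<ge>
  1, and without weight it is integrable at the origin from dimension 3 on.\<close>

lemma kernel1_low_frequency_upper:
  fixes \<mu> \<sigma> :: real
  assumes \<mu>: "0 < \<mu>" "\<mu> < 1" and \<sigma>: "1 \<le> \<sigma> \<or> \<sigma> = 0 \<and> 3 \<le> CARD('n)"
  shows "\<exists>C\<ge>0. \<forall>t>0. low_energy \<sigma> 1 (kernel1 \<mu> t :: real ^ 'n \<Rightarrow> complex) \<le>
    ennreal (C * t powr (- (2 * \<sigma> - 2 + real CARD('n)) / 4))"
proof (rule low_energy_upper_if_gaussian_bound)
  show "(\<integral>\<^sup>+(\<xi> :: real ^ 'n). ennreal (norm \<xi> powr (2 * \<sigma> - 2) * exp (- (2 * \<mu>) * norm \<xi> ^ 4)) \<partial>lborel) < \<infinity>"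
    using \<sigma> \<mu> nn_integral_power_gaussian_finite[of "2 * \<sigma> - 2" "2 * \<mu>", where 'n='n]
      nn_integral_inverse_square_gaussian_finite[of "2 * \<mu>", where 'n='n] by auto
  fix t :: real and \<xi> :: "real ^ 'n" assume t: "0 < t" and \<xi>: "\<xi> \<noteq> 0" "norm \<xi> \<le> 1"
  have "(norm (kernel1 \<mu> t \<xi>))\<^sup>2 \<le> (exp (- \<mu> * norm \<xi> ^ 4 * t) / norm \<xi>)\<^sup>2"
    using \<xi> t by (intro power_mono kernel_low \<mu>) auto
  also have "\<dots> = exp (- (2 * \<mu>) * norm \<xi> ^ 4 * t) / norm \<xi> powr 2"
    using \<xi> by (simp add: power_divide mult.assoc powr_numeral flip: exp_double)
  finally have "weight \<sigma> \<xi> * (norm (kernel1 \<mu> t \<xi>))\<^sup>2 \<le> weight \<sigma> \<xi> * (exp (- (2 * \<mu>) * norm \<xi> ^ 4 * t) / norm \<xi> powr 2)"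
    by (intro mult_left_mono) auto
  then show "weight \<sigma> \<xi> * (norm (kernel1 \<mu> t \<xi>))\<^sup>2 \<le> 1 * (norm \<xi> powr (2 * \<sigma> - 2) * exp (- (2 * \<mu>) * norm \<xi> ^ 4 * t))"
    by (simp add: powr_square powr_diff)
qed simp

text \<open>The unevaluated exponent is the one that the general statements take at \<sigma> = 0, so
  that they match literally.\<close>

lemma decay_square:
  assumes "1 \<le> t"
  shows "(decay n t)\<^sup>2 = (if n = 1 then t else if n = 2 then ln t else t powr (- (2 * 0 - 2 + real n) / 4))"
proof (cases "n = 1 \<or> n = 2")
  case True
  then show ?thesis using assms by (auto simp: decay_def)
next
  case False
  have "2 * (- (real n - 2) / 8) = - (2 * 0 - 2 + real n) / 4" by simp
  with False show ?thesis by (simp only: decay_def powr_square if_False de_Morgan_disj simp_thms)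
qed

lemma ln_ge_one: "3 \<le> t \<Longrightarrow> 1 \<le> ln t" for t :: real
  using exp_le by (subst ln_ge_iff) auto

text \<open>In dimensions 1 and 2 the damping is discarded and the squared kernel is bounded by the
  minimum of t^2 and |\<xi>|^-2. The dyadic sum then stops where 2^N is comparable to t. The
  threshold 3 ensures ln t \<ge> 1.\<close>

lemma kernel1_low_frequency_upper_decay:
  assumes \<mu>: "0 < \<mu>" "\<mu> < 1"
  shows "\<exists>C\<ge>0. \<forall>t\<ge>3. low_energy 0 1 (kernel1 \<mu> t :: real ^ 'n \<Rightarrow> complex) \<le>
    ennreal (C * (decay CARD('n) t)\<^sup>2)"
proof (cases "3 \<le> CARD('n)")
  case True
  obtain C where C: "0 \<le> C" "\<forall>t>0. low_energy 0 1 (kernel1 \<mu> t :: real ^ 'n \<Rightarrow> complex) \<le>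
      ennreal (C * t powr (- (2 * 0 - 2 + real CARD('n)) / 4))"
    using kernel1_low_frequency_upper[OF \<mu> disjI2[OF conjI[OF refl True]]] by (elim exE conjE)
  show ?thesis
  proof (intro exI[of _ C] conjI allI impI C(1))
    fix t :: real assume t: "3 \<le> t"
    show "low_energy 0 1 (kernel1 \<mu> t :: real ^ 'n \<Rightarrow> complex) \<le>
        ennreal (C * (decay CARD('n) t)\<^sup>2)"
      using C(2) t True by (subst decay_square) auto
  qed
next
  case False
  define V where "V = unit_ball_vol (real CARD('n))"
  have V: "0 \<le> V" by (simp add: V_def)
  have main: "low_energy 0 1 (kernel1 \<mu> t :: real ^ 'n \<Rightarrow> complex) \<le>
      ennreal (\<Sum>k\<le>N. 4 * V * (4 / 2 ^ CARD('n)) ^ k)" if t: "3 \<le> t" and N: "t \<le> 2 ^ N" for t N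
  proof -
    have "t\<^sup>2 \<le> (2 ^ N)\<^sup>2" using t N by (intro power_mono) auto
    also have "(2 ^ N)\<^sup>2 = (4::real) ^ N" by (simp add: power2_eq_square flip: power_mult_distrib)
    finally have tN: "t\<^sup>2 \<le> 4 ^ N" .
    have "indicator (cball 0 1) \<xi> * ennreal (weight 0 \<xi> * (norm (kernel1 \<mu> t \<xi>))\<^sup>2) \<le>
        indicator (cball 0 1) \<xi> * ennreal (min (4 ^ N) (1 / (norm \<xi>)\<^sup>2))" for \<xi> :: "real ^ 'n"
    proof (cases "\<xi> \<noteq> 0 \<and> norm \<xi> \<le> 1")
      case True
      have e: "exp (- \<mu> * norm \<xi> ^ 4 * t) \<le> 1" using \<mu> t by simp
      have "norm (kernel1 \<mu> t \<xi>) \<le> exp (- \<mu> * norm \<xi> ^ 4 * t) * t"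
        using True t by (intro kernel_low \<mu>) auto
      also have "\<dots> \<le> 1 * t" using e t by (intro mult_right_mono) auto
      finally have 1: "(norm (kernel1 \<mu> t \<xi>))\<^sup>2 \<le> t\<^sup>2" by (intro power_mono) auto
      have "norm (kernel1 \<mu> t \<xi>) \<le> exp (- \<mu> * norm \<xi> ^ 4 * t) / norm \<xi>"
        using True t by (intro kernel_low \<mu>) auto
      also have "\<dots> \<le> 1 / norm \<xi>" using e by (intro divide_right_mono) auto
      finally have "(norm (kernel1 \<mu> t \<xi>))\<^sup>2 \<le> (1 / norm \<xi>)\<^sup>2" by (intro power_mono) auto
      then have "weight 0 \<xi> * (norm (kernel1 \<mu> t \<xi>))\<^sup>2 \<le> min (4 ^ N) (1 / (norm \<xi>)\<^sup>2)"
        using 1 tN True by (simp add: power_divide)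
      then show ?thesis by (intro mult_left_mono ennreal_leI) simp_all
    qed auto
    then show ?thesis
      unfolding V_def by (rule order_trans[OF nn_integral_mono nn_integral_min_inverse_square])
  qed
  \<comment> \<open>The power of 2 just above t: a valid cap for the kernel, too large by at most a
    factor 2.\<close>
  have N: "t \<le> 2 ^ nat \<lceil>log 2 t\<rceil> \<and> 2 ^ nat \<lceil>log 2 t\<rceil> \<le> 2 * t \<and> real (nat \<lceil>log 2 t\<rceil>) \<le> log 2 t + 1" if t: "3 \<le> t" for t :: real
  proof -
    define N where "N = nat \<lceil>log 2 t\<rceil>"
    have "0 \<le> log 2 t" using t by simp
    then have N: "log 2 t \<le> real N" "real N \<le> log 2 t + 1" unfolding N_def by linarith+
    have "t = 2 powr (log 2 t)" using t by simp
    also have "\<dots> \<le> 2 powr real N" using N by (intro powr_mono) auto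
    finally have 1: "t \<le> 2 ^ N" by (simp add: powr_realpow)
    have "2 ^ N = (2::real) powr real N" by (simp add: powr_realpow)
    also have "\<dots> \<le> 2 powr (log 2 t + 1)" using N by (intro powr_mono) auto
    also have "\<dots> = 2 * t" using t by (simp add: powr_add)
    finally show ?thesis using 1 N unfolding N_def[symmetric] by simp
  qed
  from False have "CARD('n) = 1 \<or> CARD('n) = 2"
    using zero_less_card_finite[where 'a='n] by linarith
  then show ?thesis
  proof
    assume n: "CARD('n) = 1"
    show ?thesis
    proof (intro exI[of _ "16 * V"] conjI allI impI)
      fix t :: real assume t: "3 \<le> t"
      define N where "N = nat \<lceil>log 2 t\<rceil>"
      have tN: "t \<le> 2 ^ N" using N[OF t] by (simp add: N_def)
      have "(\<Sum>k\<le>N. 4 * V * (4 / 2 ^ CARD('n)) ^ k) = 4 * V * (\<Sum>k<Suc N. 2 ^ k)"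
        by (simp add: n sum_distrib_left lessThan_Suc_atMost)
      also have "\<dots> \<le> 4 * V * (2 * 2 ^ N)"
        using V by (intro mult_left_mono) (auto simp: geometric_sum)
      also have "\<dots> \<le> 4 * V * (2 * (2 * t))"
        using N[OF t] V unfolding N_def[symmetric] by (intro mult_left_mono) auto
      finally have "ennreal (\<Sum>k\<le>N. 4 * V * (4 / 2 ^ CARD('n)) ^ k) \<le> ennreal (16 * V * (decay CARD('n) t)\<^sup>2)"
        using t by (intro ennreal_leI) (simp add: decay_square n)
      then show "low_energy 0 1 (kernel1 \<mu> t :: real ^ 'n \<Rightarrow> complex) \<le>
          ennreal (16 * V * (decay CARD('n) t)\<^sup>2)"
        by (rule order_trans[OF main[OF t tN]])
    qed (use V in simp)
  next
    assume n: "CARD('n) = 2"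
    show ?thesis
    proof (intro exI[of _ "4 * V * (1 / ln 2 + 2)"] conjI allI impI)
      fix t :: real assume t: "3 \<le> t"
      define N where "N = nat \<lceil>log 2 t\<rceil>"
      have tN: "t \<le> 2 ^ N" using N[OF t] by (simp add: N_def)
      have "(\<Sum>k\<le>N. 4 * V * (4 / 2 ^ CARD('n)) ^ k) = 4 * V * (real N + 1)"
        by (simp add: n)
      \<comment> \<open>Here N + 1 \<le> ln t / ln 2 + 2, and the additive 2 is absorbed by ln t
        \<ge> 1.\<close>
      also have "\<dots> \<le> 4 * V * (1 / ln 2 * ln t + 2 * ln t)"
        using N[OF t] V ln_ge_one[OF t] unfolding N_def[symmetric]
        by (intro mult_left_mono) (auto simp: log_def)
      finally have "ennreal (\<Sum>k\<le>N. 4 * V * (4 / 2 ^ CARD('n)) ^ k) \<le> ennreal (4 * V * (1 / ln 2 + 2) * (decay CARD('n) t)\<^sup>2)"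
        using t by (intro ennreal_leI) (simp add: decay_square n algebra_simps)
      then show "low_energy 0 1 (kernel1 \<mu> t :: real ^ 'n \<Rightarrow> complex) \<le>
          ennreal (4 * V * (1 / ln 2 + 2) * (decay CARD('n) t)\<^sup>2)"
        by (rule order_trans[OF main[OF t tN]])
    qed (use V in simp)
  qed
qed

section \<open>Lower bounds for the low frequency energy of the second kernel\<close>

definition annulus :: "real \<Rightarrow> (real ^ 'n) set"
  where "annulus \<rho> = {\<xi>. 3 * \<rho> \<le> norm \<xi> \<and> norm \<xi> \<le> 7 * \<rho>}"

lemma pred_annulus [measurable]: "Measurable.pred borel (\<lambda>\<xi>. \<xi> \<in> annulus \<rho>)"
  unfolding annulus_def by measurable

text \<open>The factor \<open>1 / 1568\<close> collects \<open>1 / 16\<close> from the average of two squared sines and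
\<open>1 / 98\<close> from \<open>\<omega>\<^sup>2 \<le> 2 |\<xi>|\<^sup>2 \<le> 2 (7 \<rho>)\<^sup>2\<close>.\<close>

definition lower_const :: "nat \<Rightarrow> real"
  where "lower_const n = exp (- 2) * unit_ball_vol n / 1568"

lemma lower_const_pos: "0 < lower_const n"
  by (simp add: lower_const_def)

lemma kernel1_weighted_annulus_lower:
  fixes \<mu> \<sigma> t \<rho> :: real
  assumes \<mu>: "0 < \<mu>" "\<mu> < 1" and "0 \<le> \<sigma>" and t: "0 < t" and \<rho>: "1 / t \<le> \<rho>" "7 * \<rho> \<le> 1 / 4" "(7 * \<rho>) ^ 4 * t \<le> 1"
  shows "ennreal (lower_const CARD('n) * \<rho> powr (2 * \<sigma> - 2 + CARD('n))) \<le>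
    (\<integral>\<^sup>+\<xi>. indicator (annulus \<rho> :: (real ^ 'n) set) \<xi> * ennreal (weight \<sigma> \<xi> * (norm (kernel1 \<mu> t \<xi>))\<^sup>2) \<partial>lborel)"
proof -
  have "0 < \<rho>" using t \<rho>(1) by (smt (verit) zero_less_divide_1_iff)
  have "\<rho> powr (2 * \<sigma> - 2 + CARD('n)) = (\<rho> powr \<sigma>)\<^sup>2 * (\<rho> ^ CARD('n) / \<rho>\<^sup>2)"
    using \<open>0 < \<rho>\<close> by (simp add: powr_square powr_add powr_diff powr_realpow powr_numeral)
  then have "ennreal (lower_const CARD('n) * \<rho> powr (2 * \<sigma> - 2 + CARD('n))) =
      ennreal ((\<rho> powr \<sigma>)\<^sup>2) * ennreal (exp (- 2) * unit_ball_vol CARD('n) / 1568 * (\<rho> ^ CARD('n) / \<rho>\<^sup>2))"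
    by (simp add: lower_const_def mult_ac flip: ennreal_mult')
  also have "\<dots> \<le> ennreal ((\<rho> powr \<sigma>)\<^sup>2) * (\<integral>\<^sup>+\<xi>. indicator (annulus \<rho> :: (real ^ 'n) set) \<xi> * ennreal ((norm (kernel1 \<mu> t \<xi>))\<^sup>2) \<partial>lborel)"
    unfolding annulus_def by (intro mult_left_mono kernel1_annulus_lower \<mu> t \<rho>) simp
  also have "\<dots> = (\<integral>\<^sup>+\<xi>. ennreal ((\<rho> powr \<sigma>)\<^sup>2) * (indicator (annulus \<rho> :: (real ^ 'n) set) \<xi> * ennreal ((norm (kernel1 \<mu> t \<xi>))\<^sup>2)) \<partial>lborel)"
    by (rule nn_integral_cmult[symmetric]) measurable
  also have "\<dots> \<le> (\<integral>\<^sup>+\<xi>. indicator (annulus \<rho> :: (real ^ 'n) set) \<xi> * ennreal (weight \<sigma> \<xi> * (norm (kernel1 \<mu> t \<xi>))\<^sup>2) \<partial>lborel)"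
  proof (rule nn_integral_mono)
    fix \<xi> :: "real ^ 'n"
    show "ennreal ((\<rho> powr \<sigma>)\<^sup>2) * (indicator (annulus \<rho>) \<xi> * ennreal ((norm (kernel1 \<mu> t \<xi>))\<^sup>2)) \<le>
        indicator (annulus \<rho>) \<xi> * ennreal (weight \<sigma> \<xi> * (norm (kernel1 \<mu> t \<xi>))\<^sup>2)"
    proof (cases "\<xi> \<in> annulus \<rho>")
      case True
      then have "(\<rho> powr \<sigma>)\<^sup>2 \<le> weight \<sigma> \<xi>"
        using \<open>0 < \<rho>\<close> \<open>0 \<le> \<sigma>\<close> by (intro power_mono powr_mono2) (auto simp: annulus_def)
      then have "(\<rho> powr \<sigma>)\<^sup>2 * (norm (kernel1 \<mu> t \<xi>))\<^sup>2 \<le> weight \<sigma> \<xi> * (norm (kernel1 \<mu> t \<xi>))\<^sup>2"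
        by (intro mult_right_mono) auto
      from ennreal_leI[OF this] True show ?thesis by (simp add: ennreal_mult)
    qed simp
  qed
  finally show ?thesis .
qed

text \<open>The annulus sits at \<rho> = t^(-1/4) / 7, the largest scale with (7 \<rho>)^4 t \<le>
  1. The constant precedes \<open>\<delta>\<close>, since \<open>\<delta>\<close> will depend on the
  data while the final constant must not; a small \<open>\<delta>\<close> only delays the time from
  which the annulus fits into the ball.\<close>

lemma kernel1_low_frequency_lower:
  fixes \<mu> \<sigma> :: real
  assumes \<mu>: "0 < \<mu>" "\<mu> < 1" and "0 \<le> \<sigma>"
  shows "\<exists>\<kappa>>0. \<forall>\<delta>>0. \<exists>t0. \<forall>t\<ge>t0. ennreal (\<kappa> * t powr (- (2 * \<sigma> - 2 + CARD('n)) / 4)) \<le>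
    low_energy \<sigma> \<delta> (kernel1 \<mu> t :: real ^ 'n \<Rightarrow> complex)"
proof -
  have "\<exists>t0. \<forall>t\<ge>t0. ennreal (lower_const CARD('n) * (1 / 7) powr (2 * \<sigma> - 2 + CARD('n)) * t powr (- (2 * \<sigma> - 2 + CARD('n)) / 4)) \<le>
    low_energy \<sigma> \<delta> (kernel1 \<mu> t :: real ^ 'n \<Rightarrow> complex)"
    if "0 < \<delta>" for \<delta> :: real
  proof -
  have "eventually (\<lambda>t::real. 0 < t) at_top" by (rule eventually_gt_at_top)
  moreover have "eventually (\<lambda>t::real. 1 / t \<le> t powr (- 1 / 4) / 7) at_top" by real_asymp
  moreover have "eventually (\<lambda>t::real. t powr (- 1 / 4) \<le> 1 / 4) at_top" by real_asymp
  moreover have "eventually (\<lambda>t::real. t powr (- 1 / 4) \<le> \<delta>) at_top" using \<open>0 < \<delta>\<close> by real_asymp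
  ultimately have "eventually (\<lambda>t. ennreal (lower_const CARD('n) * (1 / 7) powr (2 * \<sigma> - 2 + CARD('n)) * t powr (- (2 * \<sigma> - 2 + CARD('n)) / 4)) \<le>
    low_energy \<sigma> \<delta> (kernel1 \<mu> t :: real ^ 'n \<Rightarrow> complex)) at_top"
  proof eventually_elim
    case (elim t)
    define \<rho> where "\<rho> = t powr (- 1 / 4) / 7"
    have "(t powr (- 1 / 4)) ^ 4 = t powr (- 1)"
      using elim by (simp add: powr_realpow[symmetric] powr_powr)
    then have 4: "(7 * \<rho>) ^ 4 * t \<le> 1"
      using elim by (simp add: \<rho>_def powr_minus)
    have "\<rho> powr (2 * \<sigma> - 2 + CARD('n)) = (1 / 7) powr (2 * \<sigma> - 2 + CARD('n)) * (t powr (- 1 / 4)) powr (2 * \<sigma> - 2 + CARD('n))"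
      unfolding \<rho>_def by (subst powr_mult[symmetric]) simp_all
    also have "(t powr (- 1 / 4)) powr (2 * \<sigma> - 2 + CARD('n)) = t powr (- (2 * \<sigma> - 2 + CARD('n)) / 4)"
      unfolding powr_powr by (simp only: times_divide_eq_left mult_minus1)
    finally have "ennreal (lower_const CARD('n) * (1 / 7) powr (2 * \<sigma> - 2 + CARD('n)) * t powr (- (2 * \<sigma> - 2 + CARD('n)) / 4)) =
        ennreal (lower_const CARD('n) * \<rho> powr (2 * \<sigma> - 2 + CARD('n)))"
      by (simp only: mult.assoc)
    also have "\<dots> \<le> (\<integral>\<^sup>+(\<xi> :: real ^ 'n). indicator (annulus \<rho>) \<xi> * ennreal (weight \<sigma> \<xi> * (norm (kernel1 \<mu> t \<xi>))\<^sup>2) \<partial>lborel)"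
      using elim 4 by (intro kernel1_weighted_annulus_lower \<mu> \<open>0 \<le> \<sigma>\<close>) (auto simp: \<rho>_def)
    also have "\<dots> \<le> low_energy \<sigma> \<delta> (kernel1 \<mu> t :: real ^ 'n \<Rightarrow> complex)"
      using elim by (intro nn_integral_mono mult_right_mono) (auto simp: annulus_def \<rho>_def indicator_def)
    finally show ?case .
  qed
  then show ?thesis
    by (simp add: eventually_at_top_linorder)
  qed
  moreover have "0 < lower_const CARD('n) * (1 / 7) powr (2 * \<sigma> - 2 + CARD('n))"
    using lower_const_pos by simp
  ultimately show ?thesis by blast
qed

text \<open>In one dimension the energy concentrates near the origin, so the smallest admissible
  annulus, \<rho> = 1 / t, is the right one.\<close>

lemma kernel1_low_frequency_lower_one:
  fixes \<mu> :: real
  assumes \<mu>: "0 < \<mu>" "\<mu> < 1" and n: "CARD('n) = 1" and "0 < \<delta>"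
  shows "eventually (\<lambda>t. ennreal (lower_const CARD('n) * t) \<le>
    low_energy 0 \<delta> (kernel1 \<mu> t :: real ^ 'n \<Rightarrow> complex)) at_top"
proof -
  have "eventually (\<lambda>t::real. 0 < t) at_top" by (rule eventually_gt_at_top)
  moreover have "eventually (\<lambda>t::real. 7 * (1 / t) \<le> 1 / 4) at_top" by real_asymp
  moreover have "eventually (\<lambda>t::real. 7 * (1 / t) \<le> \<delta>) at_top" using \<open>0 < \<delta>\<close> by real_asymp
  moreover have "eventually (\<lambda>t::real. (7 * (1 / t)) ^ 4 * t \<le> 1) at_top" by real_asymp
  ultimately show ?thesis
  proof eventually_elim
    case (elim t)
    have "ennreal (lower_const CARD('n) * t) = ennreal (lower_const CARD('n) * (1 / t) powr (2 * 0 - 2 + real CARD('n)))"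
      using elim by (simp add: n powr_minus)
    also have "\<dots> \<le> (\<integral>\<^sup>+(\<xi> :: real ^ 'n). indicator (annulus (1 / t)) \<xi> * ennreal (weight 0 \<xi> * (norm (kernel1 \<mu> t \<xi>))\<^sup>2) \<partial>lborel)"
      using elim by (intro kernel1_weighted_annulus_lower \<mu>) auto
    also have "\<dots> \<le> low_energy 0 \<delta> (kernel1 \<mu> t :: real ^ 'n \<Rightarrow> complex)"
      using elim by (intro nn_integral_mono mult_right_mono) (auto simp: annulus_def indicator_def)
    finally show ?case .
  qed
qed

text \<open>In two dimensions each annulus contributes a constant. The disjoint annuli with radii
\<open>\<rho> = 3\<^sup>j / t\<close>, \<open>j \<le> ln t / 4\<close>, therefore produce the logarithm.\<close>

lemma kernel1_low_frequency_lower_two: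
  fixes \<mu> :: real
  assumes \<mu>: "0 < \<mu>" "\<mu> < 1" and n: "CARD('n) = 2" and "0 < \<delta>"
  shows "eventually (\<lambda>t. ennreal (lower_const CARD('n) / 4 * ln t) \<le>
    low_energy 0 \<delta> (kernel1 \<mu> t :: real ^ 'n \<Rightarrow> complex)) at_top"
proof -
  have "eventually (\<lambda>t::real. 1 < t) at_top" by (rule eventually_gt_at_top)
  moreover have "eventually (\<lambda>t::real. 7 * t powr (- 1 / 2) \<le> 1 / 4) at_top" by real_asymp
  moreover have "eventually (\<lambda>t::real. 7 * t powr (- 1 / 2) \<le> \<delta>) at_top" using \<open>0 < \<delta>\<close> by real_asymp
  moreover have "eventually (\<lambda>t::real. (7 * t powr (- 1 / 2)) ^ 4 * t \<le> 1) at_top" by real_asymp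
  ultimately show ?thesis
  proof eventually_elim
    case (elim t)
    \<comment> \<open>Since 3 \<le> exp 2, the choice j \<le> ln t / 4 gives 3^j \<le> t^(1/2). All
      radii thus stay below t^(-1/2), where the damping is negligible.\<close>
    define J where "J = nat \<lfloor>ln t / 4\<rfloor>"
    define \<rho> where "\<rho> j = 3 ^ j / t" for j :: nat
    define I where "I j = (\<integral>\<^sup>+(\<xi> :: real ^ 'n). indicator (annulus (\<rho> j)) \<xi> * ennreal (weight 0 \<xi> * (norm (kernel1 \<mu> t \<xi>))\<^sup>2) \<partial>lborel)" for j
    have J: "real J \<le> ln t / 4" "ln t / 4 \<le> real J + 1"
      unfolding J_def using elim(1) by (simp_all add: of_nat_floor) linarith
    have \<rho>: "1 / t \<le> \<rho> j" "\<rho> j \<le> t powr (- 1 / 2)" if "j \<le> J" for j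
    proof -
      show "1 / t \<le> \<rho> j" unfolding \<rho>_def using elim(1) by (intro divide_right_mono) auto
      have "(3::real) \<le> exp 2" using exp_ge_add_one_self[of 2] by simp
      then have "3 ^ j \<le> (exp 2 :: real) ^ j" by (intro power_mono) auto
      also have "\<dots> = exp (real j * 2)" by (simp add: exp_of_nat_mult)
      also have "\<dots> \<le> exp (1 / 2 * ln t)" using that J(1) by simp
      also have "\<dots> = t powr (1 / 2)" using elim(1) by (simp add: powr_def)
      finally have "\<rho> j \<le> t powr (1 / 2) / t" unfolding \<rho>_def using elim(1) by (intro divide_right_mono) auto
      also have "\<dots> = t powr (1 / 2 - 1)" unfolding powr_diff using elim(1) by simp
      finally show "\<rho> j \<le> t powr (- 1 / 2)" by simp
    qed
    have \<rho>': "7 * \<rho> j \<le> 1 / 4" "7 * \<rho> j \<le> \<delta>" "(7 * \<rho> j) ^ 4 * t \<le> 1" if "j \<le> J" for j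
    proof -
      show "7 * \<rho> j \<le> 1 / 4" "7 * \<rho> j \<le> \<delta>" using \<rho>[OF that] elim(2,3) by linarith+
      have "0 \<le> \<rho> j" using elim(1) by (simp add: \<rho>_def)
      then have "(7 * \<rho> j) ^ 4 * t \<le> (7 * t powr (- 1 / 2)) ^ 4 * t"
        using \<rho>[OF that] elim(1) by (intro mult_right_mono power_mono) auto
      with elim(4) show "(7 * \<rho> j) ^ 4 * t \<le> 1" by linarith
    qed
    have I: "ennreal (lower_const CARD('n)) \<le> I j" if "j \<le> J" for j
    proof -
      have "0 < \<rho> j" using elim(1) by (simp add: \<rho>_def)
      then have "ennreal (lower_const CARD('n)) = ennreal (lower_const CARD('n) * \<rho> j powr (2 * 0 - 2 + real CARD('n)))"
        by (simp add: n)
      also have "\<dots> \<le> I j"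
        unfolding I_def using elim(1) \<rho>[OF that] \<rho>'[OF that] by (intro kernel1_weighted_annulus_lower \<mu>) auto
      finally show ?thesis .
    qed
    have "disjoint_family_on (\<lambda>j. annulus (\<rho> j) :: (real ^ 'n) set) {..J}"
    proof -
      \<comment> \<open>The radii grow by the factor 3, so the inner radius of a later annulus is at
        least 9 \<open>\<rho> i\<close>, beyond the outer radius 7 \<open>\<rho> i\<close>.\<close>
      have "annulus (\<rho> i) \<inter> (annulus (\<rho> j) :: (real ^ 'n) set) = {}" if "i < j" for i j
      proof -
        have "(3::real) ^ Suc i \<le> 3 ^ j" using that by (intro power_increasing) auto
        then have "3 * \<rho> i \<le> \<rho> j" unfolding \<rho>_def using elim(1) by (simp add: divide_right_mono)
        moreover have "0 < \<rho> i" using elim(1) by (simp add: \<rho>_def)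
        ultimately show ?thesis by (auto simp: annulus_def)
      qed
      then show ?thesis unfolding disjoint_family_on_def by (metis inf_commute nat_neq_iff)
    qed
    then have ind: "(\<Sum>j\<le>J. 1 * indicator (annulus (\<rho> j)) \<xi>) \<le> (indicator (cball 0 \<delta>) \<xi> :: ennreal)" for \<xi> :: "real ^ 'n"
    proof (cases "\<exists>j\<le>J. \<xi> \<in> annulus (\<rho> j)")
      case True
      then obtain j where j: "j \<le> J" "\<xi> \<in> annulus (\<rho> j)" by auto
      then have "\<xi> \<in> cball 0 \<delta>" using \<rho>'(2)[of j] by (auto simp: annulus_def)
      then show ?thesis
        using sum_indicator_disjoint_family[OF \<open>disjoint_family_on _ _\<close> j(2), of "\<lambda>_. 1 :: ennreal"] j(1) by simp
    next
      case False
      then have "(\<Sum>j\<le>J. 1 * indicator (annulus (\<rho> j)) \<xi> :: ennreal) = 0"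
        by (intro sum.neutral) (auto simp: indicator_def)
      then show ?thesis by simp
    qed
    have "ennreal (lower_const CARD('n) / 4 * ln t) \<le> ennreal (real (Suc J) * lower_const CARD('n))"
      using mult_left_mono[OF J(2), of "lower_const CARD('n)"] lower_const_pos[of "CARD('n)"]
      by (intro ennreal_leI) (simp add: algebra_simps)
    also have "\<dots> = (\<Sum>j\<le>J. ennreal (lower_const CARD('n)))"
      using lower_const_pos[of "CARD('n)"] by (subst sum_ennreal) auto
    also have "\<dots> \<le> (\<Sum>j\<le>J. I j)"
      by (intro sum_mono I) auto
    also have "\<dots> = (\<integral>\<^sup>+(\<xi> :: real ^ 'n). (\<Sum>j\<le>J. indicator (annulus (\<rho> j)) \<xi> * ennreal (weight 0 \<xi> * (norm (kernel1 \<mu> t \<xi>))\<^sup>2)) \<partial>lborel)"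
      unfolding I_def by (rule nn_integral_sum[symmetric]) measurable
    also have "\<dots> \<le> low_energy 0 \<delta> (kernel1 \<mu> t :: real ^ 'n \<Rightarrow> complex)"
      unfolding sum_distrib_right[symmetric] using ind by (intro nn_integral_mono mult_right_mono) auto
    finally show ?case .
  qed
qed

lemma kernel1_low_frequency_lower_decay:
  fixes \<mu> :: real
  assumes \<mu>: "0 < \<mu>" "\<mu> < 1"
  shows "\<exists>\<kappa>>0. \<forall>\<delta>>0. \<exists>t0. \<forall>t\<ge>t0. ennreal (\<kappa> * (decay CARD('n) t)\<^sup>2) \<le>
    low_energy 0 \<delta> (kernel1 \<mu> t :: real ^ 'n \<Rightarrow> complex)"
proof -
  have "\<exists>\<kappa>>0. \<forall>\<delta>>0. eventually (\<lambda>t. ennreal (\<kappa> * (decay CARD('n) t)\<^sup>2) \<le>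
    low_energy 0 \<delta> (kernel1 \<mu> t :: real ^ 'n \<Rightarrow> complex)) at_top"
  proof -
    have "CARD('n) = 1 \<or> CARD('n) = 2 \<or> 3 \<le> CARD('n)"
      using zero_less_card_finite[where 'a='n] by linarith
    then consider "CARD('n) = 1" | "CARD('n) = 2" | "3 \<le> CARD('n)" by blast
    then show ?thesis
    proof cases
      case 1
      show ?thesis
      proof (intro exI[of _ "lower_const CARD('n)"] conjI allI impI lower_const_pos)
        fix \<delta> :: real assume "0 < \<delta>"
        show "eventually (\<lambda>t. ennreal (lower_const CARD('n) * (decay CARD('n) t)\<^sup>2) \<le>
          low_energy 0 \<delta> (kernel1 \<mu> t :: real ^ 'n \<Rightarrow> complex)) at_top"
          using kernel1_low_frequency_lower_one[OF \<mu> 1 \<open>0 < \<delta>\<close>] eventually_ge_at_top[of 1]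
        proof eventually_elim
          case (elim t)
          show ?case
            using elim(1) 1 by (subst decay_square[OF elim(2)]) simp
        qed
      qed
    next
      case 2
      show ?thesis
      proof (intro exI[of _ "lower_const CARD('n) / 4"] conjI allI impI)
        fix \<delta> :: real assume "0 < \<delta>"
        show "eventually (\<lambda>t. ennreal (lower_const CARD('n) / 4 * (decay CARD('n) t)\<^sup>2) \<le>
          low_energy 0 \<delta> (kernel1 \<mu> t :: real ^ 'n \<Rightarrow> complex)) at_top"
          using kernel1_low_frequency_lower_two[OF \<mu> 2 \<open>0 < \<delta>\<close>] eventually_ge_at_top[of 1]
        proof eventually_elim
          case (elim t)
          show ?case
            using elim(1) 2 by (subst decay_square[OF elim(2)]) simp
        qed
      qed (use lower_const_pos in simp)
    next
      case 3
      obtain \<kappa> where \<kappa>: "0 < \<kappa>" "\<forall>\<delta>>0. \<exists>t0. \<forall>t\<ge>t0. ennreal (\<kappa> * t powr (- (2 * 0 - 2 + real CARD('n)) / 4)) \<le>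
          low_energy 0 \<delta> (kernel1 \<mu> t :: real ^ 'n \<Rightarrow> complex)"
        using kernel1_low_frequency_lower[OF \<mu> order_refl] by (elim exE conjE)
      show ?thesis
      proof (intro exI[of _ \<kappa>] conjI allI impI \<kappa>(1))
        fix \<delta> :: real assume "0 < \<delta>"
        then have "eventually (\<lambda>t. ennreal (\<kappa> * t powr (- (2 * 0 - 2 + real CARD('n)) / 4)) \<le>
          low_energy 0 \<delta> (kernel1 \<mu> t :: real ^ 'n \<Rightarrow> complex)) at_top"
          unfolding eventually_at_top_linorder by (rule \<kappa>(2)[rule_format])
        then show "eventually (\<lambda>t. ennreal (\<kappa> * (decay CARD('n) t)\<^sup>2) \<le>
          low_energy 0 \<delta> (kernel1 \<mu> t :: real ^ 'n \<Rightarrow> complex)) at_top"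
          using eventually_ge_at_top[of 1]
        proof eventually_elim
          case (elim t)
          show ?case
            using elim(1) 3 by (subst decay_square[OF elim(2)]) simp
        qed
      qed
    qed
  qed
  then show ?thesis unfolding eventually_at_top_linorder .
qed

section \<open>Estimates for the solution\<close>

lemma norm_add_square_le: "(norm (a + b))\<^sup>2 \<le> 2 * (norm a)\<^sup>2 + 2 * (norm b)\<^sup>2"
  for a b :: "'a::real_normed_vector"
proof -
  have "(norm (a + b))\<^sup>2 \<le> (norm a + norm b)\<^sup>2"
    by (intro power_mono norm_triangle_ineq) simp
  also have "\<dots> \<le> 2 * (norm a)\<^sup>2 + 2 * (norm b)\<^sup>2"
    using sum_squares_bound[of "norm a" "norm b"] by (simp add: power2_eq_square algebra_simps)
  finally show ?thesis .
qed

lemma ennreal_sum_of_products: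
  "0 \<le> a \<Longrightarrow> 0 \<le> b \<Longrightarrow> 0 \<le> c \<Longrightarrow> 0 \<le> d \<Longrightarrow> ennreal (a * b + c * d) = ennreal a * ennreal b + ennreal c * ennreal d"
  by (simp add: ennreal_mult)

text \<open>The roles of kernel and data are exchanged at |\<xi>| = 1: below, the data are bounded
  pointwise and the kernels integrated; above, the kernels are bounded pointwise and the data
  integrated. The order \<sigma> - 4 reflects the gain in the second kernel, and 50 and 32 are twice
  the squares of the constants 5 and 4 there.\<close>

lemma multiplier_energy_upper:
  fixes F0 F1 :: "real ^ 'n \<Rightarrow> complex" and \<mu> \<sigma> t :: real
  assumes \<mu>: "0 < \<mu>" "\<mu> < 1" and t: "0 \<le> t"
    and [measurable]: "F0 \<in> borel_measurable borel" "F1 \<in> borel_measurable borel"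
    and m0: "AE \<xi> in lborel. norm (F0 \<xi>) \<le> m0" and m1: "AE \<xi> in lborel. norm (F1 \<xi>) \<le> m1"
    and n0: "energy \<sigma> F0 \<le> ennreal n0"
    and n1: "high_energy (\<sigma> - 4) F1 \<le> ennreal n1"
    and a0: "low_energy \<sigma> 1 (kernel0 \<mu> t :: real ^ 'n \<Rightarrow> complex) \<le> ennreal a0"
    and a1: "low_energy \<sigma> 1 (kernel1 \<mu> t :: real ^ 'n \<Rightarrow> complex) \<le> ennreal a1"
    and nn: "0 \<le> n0" "0 \<le> n1" "0 \<le> a0" "0 \<le> a1"
  shows "energy \<sigma> (multiplier \<mu> t F0 F1) \<le>
    ennreal (2 * m0\<^sup>2 * a0 + 2 * m1\<^sup>2 * a1 + 50 * exp (- \<mu> * t / 2) * n0 + 32 / \<mu>\<^sup>2 * exp (- \<mu> * t / 2) * n1)"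
proof -
  define E where "E = exp (- \<mu> * t / 4)"
  have E2: "E\<^sup>2 = exp (- \<mu> * t / 2)" by (simp add: E_def flip: exp_double)
  let ?A = "\<lambda>\<xi> :: real ^ 'n. indicator (cball 0 1) \<xi> * ennreal (weight \<sigma> \<xi> * (norm (kernel0 \<mu> t \<xi>))\<^sup>2)"
  let ?B = "\<lambda>\<xi> :: real ^ 'n. indicator (cball 0 1) \<xi> * ennreal (weight \<sigma> \<xi> * (norm (kernel1 \<mu> t \<xi>))\<^sup>2)"
  let ?C = "\<lambda>\<xi>. ennreal (weight \<sigma> \<xi> * (norm (F0 \<xi>))\<^sup>2)"
  let ?D = "\<lambda>\<xi>. indicator (- ball 0 1) \<xi> * ennreal (weight (\<sigma> - 4) \<xi> * (norm (F1 \<xi>))\<^sup>2)"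
  have "AE \<xi> in lborel. ennreal (weight \<sigma> \<xi> * (norm (multiplier \<mu> t F0 F1 \<xi>))\<^sup>2) \<le>
      ennreal (2 * m0\<^sup>2) * ?A \<xi> + ennreal (2 * m1\<^sup>2) * ?B \<xi> + ennreal (50 * E\<^sup>2) * ?C \<xi> + ennreal (32 / \<mu>\<^sup>2 * E\<^sup>2) * ?D \<xi>"
    using m0 m1
  proof eventually_elim
    case (elim \<xi>)
    let ?k0 = "norm (kernel0 \<mu> t \<xi>)" and ?k1 = "norm (kernel1 \<mu> t \<xi>)"
    let ?f0 = "norm (F0 \<xi>)" and ?f1 = "norm (F1 \<xi>)"
    have "(norm (multiplier \<mu> t F0 F1 \<xi>))\<^sup>2 \<le> 2 * (?k0\<^sup>2 * ?f0\<^sup>2) + 2 * (?k1\<^sup>2 * ?f1\<^sup>2)"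
      using norm_add_square_le[of "kernel0 \<mu> t \<xi> * F0 \<xi>" "kernel1 \<mu> t \<xi> * F1 \<xi>"]
      by (simp add: norm_mult power_mult_distrib)
    then have "weight \<sigma> \<xi> * (norm (multiplier \<mu> t F0 F1 \<xi>))\<^sup>2 \<le>
        weight \<sigma> \<xi> * (2 * (?k0\<^sup>2 * ?f0\<^sup>2) + 2 * (?k1\<^sup>2 * ?f1\<^sup>2))"
      by (intro mult_left_mono) auto
    then have le: "weight \<sigma> \<xi> * (norm (multiplier \<mu> t F0 F1 \<xi>))\<^sup>2 \<le>
        2 * (weight \<sigma> \<xi> * ?k0\<^sup>2 * ?f0\<^sup>2) + 2 * (weight \<sigma> \<xi> * ?k1\<^sup>2 * ?f1\<^sup>2)"
      by (simp add: algebra_simps)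
    show ?case
    proof (cases "norm \<xi> \<le> 1")
      case True
      have "?f0\<^sup>2 \<le> m0\<^sup>2" "?f1\<^sup>2 \<le> m1\<^sup>2" using elim by (auto intro: power_mono)
      then have "weight \<sigma> \<xi> * ?k0\<^sup>2 * ?f0\<^sup>2 \<le> weight \<sigma> \<xi> * ?k0\<^sup>2 * m0\<^sup>2"
        "weight \<sigma> \<xi> * ?k1\<^sup>2 * ?f1\<^sup>2 \<le> weight \<sigma> \<xi> * ?k1\<^sup>2 * m1\<^sup>2"
        by (auto intro!: mult_left_mono)
      with le have "weight \<sigma> \<xi> * (norm (multiplier \<mu> t F0 F1 \<xi>))\<^sup>2 \<le>
          2 * m0\<^sup>2 * (weight \<sigma> \<xi> * ?k0\<^sup>2) + 2 * m1\<^sup>2 * (weight \<sigma> \<xi> * ?k1\<^sup>2)"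
        by (simp add: algebra_simps)
      from ennreal_leI[OF this]
      have "ennreal (weight \<sigma> \<xi> * (norm (multiplier \<mu> t F0 F1 \<xi>))\<^sup>2) \<le>
          ennreal (2 * m0\<^sup>2) * ?A \<xi> + ennreal (2 * m1\<^sup>2) * ?B \<xi>"
        using True by (simp add: ennreal_mult ennreal_plus[symmetric] del: ennreal_plus) (simp add: ennreal_mult)
      then show ?thesis by (rule add_increasing2[OF zero_le add_increasing2[OF zero_le]])
    next
      case False
      then have r: "1 \<le> norm \<xi>" "0 < norm \<xi>" by auto
      note k = kernel_high[OF \<mu> r(1) t, folded E_def]
      have "?k0\<^sup>2 \<le> (5 * E)\<^sup>2" "?k1\<^sup>2 \<le> (4 / (\<mu> * norm \<xi> ^ 4) * E)\<^sup>2"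
        by (rule power_mono[OF k(2) norm_ge_zero], rule power_mono[OF k(1) norm_ge_zero])
      then have x: "weight \<sigma> \<xi> * ?k0\<^sup>2 * ?f0\<^sup>2 \<le> weight \<sigma> \<xi> * (5 * E)\<^sup>2 * ?f0\<^sup>2"
        and y: "weight \<sigma> \<xi> * ?k1\<^sup>2 * ?f1\<^sup>2 \<le> weight \<sigma> \<xi> * (4 / (\<mu> * norm \<xi> ^ 4) * E)\<^sup>2 * ?f1\<^sup>2"
        by (auto intro!: mult_left_mono mult_right_mono)
      have e: "weight \<sigma> \<xi> * (4 / (\<mu> * norm \<xi> ^ 4) * E)\<^sup>2 = 16 / \<mu>\<^sup>2 * E\<^sup>2 * weight (\<sigma> - 4) \<xi>"
      proof -
        have "norm \<xi> powr (\<sigma> - 4) = norm \<xi> powr \<sigma> / norm \<xi> ^ 4"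
          using r by (simp add: powr_diff powr_numeral)
        then show ?thesis using \<mu> r by (simp add: power_mult_distrib power_divide)
      qed
      have "2 * (weight \<sigma> \<xi> * (5 * E)\<^sup>2 * ?f0\<^sup>2) = 50 * E\<^sup>2 * (weight \<sigma> \<xi> * ?f0\<^sup>2)"
        by (simp add: power_mult_distrib)
      moreover have "2 * (16 / \<mu>\<^sup>2 * E\<^sup>2 * weight (\<sigma> - 4) \<xi> * ?f1\<^sup>2) = 32 / \<mu>\<^sup>2 * E\<^sup>2 * (weight (\<sigma> - 4) \<xi> * ?f1\<^sup>2)"
        by simp
      ultimately have "weight \<sigma> \<xi> * (norm (multiplier \<mu> t F0 F1 \<xi>))\<^sup>2 \<le>
          50 * E\<^sup>2 * (weight \<sigma> \<xi> * ?f0\<^sup>2) + 32 / \<mu>\<^sup>2 * E\<^sup>2 * (weight (\<sigma> - 4) \<xi> * ?f1\<^sup>2)"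
        using le x y[unfolded e] by linarith
      moreover have "ennreal (50 * E\<^sup>2 * (weight \<sigma> \<xi> * ?f0\<^sup>2) + 32 / \<mu>\<^sup>2 * E\<^sup>2 * (weight (\<sigma> - 4) \<xi> * ?f1\<^sup>2)) =
          ennreal (50 * E\<^sup>2) * ?C \<xi> + ennreal (32 / \<mu>\<^sup>2 * E\<^sup>2) * ennreal (weight (\<sigma> - 4) \<xi> * ?f1\<^sup>2)"
        by (rule ennreal_sum_of_products) auto
      ultimately have "ennreal (weight \<sigma> \<xi> * (norm (multiplier \<mu> t F0 F1 \<xi>))\<^sup>2) \<le>
          ennreal (50 * E\<^sup>2) * ?C \<xi> + ennreal (32 / \<mu>\<^sup>2 * E\<^sup>2) * ennreal (weight (\<sigma> - 4) \<xi> * ?f1\<^sup>2)"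
        using ennreal_leI by metis
      then show ?thesis using False by simp
    qed
  qed
  then have "energy \<sigma> (multiplier \<mu> t F0 F1) \<le>
    (\<integral>\<^sup>+\<xi>. ennreal (2 * m0\<^sup>2) * ?A \<xi> + ennreal (2 * m1\<^sup>2) * ?B \<xi> + ennreal (50 * E\<^sup>2) * ?C \<xi> + ennreal (32 / \<mu>\<^sup>2 * E\<^sup>2) * ?D \<xi> \<partial>lborel)"
    by (rule nn_integral_mono_AE)
  also have "\<dots> = ennreal (2 * m0\<^sup>2) * (\<integral>\<^sup>+\<xi>. ?A \<xi> \<partial>lborel) + ennreal (2 * m1\<^sup>2) * (\<integral>\<^sup>+\<xi>. ?B \<xi> \<partial>lborel) +
      ennreal (50 * E\<^sup>2) * (\<integral>\<^sup>+\<xi>. ?C \<xi> \<partial>lborel) + ennreal (32 / \<mu>\<^sup>2 * E\<^sup>2) * (\<integral>\<^sup>+\<xi>. ?D \<xi> \<partial>lborel)"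
    by (simp add: nn_integral_add nn_integral_cmult)
  also have "\<dots> \<le> ennreal (2 * m0\<^sup>2) * ennreal a0 + ennreal (2 * m1\<^sup>2) * ennreal a1 +
      ennreal (50 * E\<^sup>2) * ennreal n0 + ennreal (32 / \<mu>\<^sup>2 * E\<^sup>2) * ennreal n1"
    by (intro add_mono mult_left_mono a0 a1 n0 n1) simp_all
  also have "\<dots> = ennreal (2 * m0\<^sup>2 * a0 + 2 * m1\<^sup>2 * a1 + 50 * E\<^sup>2 * n0 + 32 / \<mu>\<^sup>2 * E\<^sup>2 * n1)"
    using nn \<mu> by (simp add: ennreal_mult[symmetric] ennreal_plus[symmetric] del: ennreal_plus)
  finally show ?thesis unfolding E2 .
qed

text \<open>The second term is recovered from the sum by subtracting the first. The error is kept on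
  the right-hand side, which avoids subtraction in \<open>ennreal\<close>; \<delta> \<le> 1 keeps
  the ball inside the region where the first kernel is controlled.\<close>

lemma multiplier_energy_lower:
  fixes F0 F1 :: "real ^ 'n \<Rightarrow> complex" and \<mu> \<sigma> t :: real
  assumes [measurable]: "F0 \<in> borel_measurable borel" "F1 \<in> borel_measurable borel"
    and m0: "AE \<xi> in lborel. norm (F0 \<xi>) \<le> m0"
    and P: "AE \<xi> in lborel. norm \<xi> \<le> \<delta> \<longrightarrow> P \<le> norm (F1 \<xi>)" "0 \<le> P" and \<delta>: "\<delta> \<le> 1"
    and a0: "low_energy \<sigma> 1 (kernel0 \<mu> t :: real ^ 'n \<Rightarrow> complex) \<le> ennreal a0"
    and l: "ennreal l \<le> low_energy \<sigma> \<delta> (kernel1 \<mu> t :: real ^ 'n \<Rightarrow> complex)"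
    and nn: "0 \<le> a0"
  shows "ennreal (P\<^sup>2 * l) \<le>
    2 * energy \<sigma> (multiplier \<mu> t F0 F1) + ennreal (2 * m0\<^sup>2 * a0)"
proof -
  let ?A = "\<lambda>\<xi> :: real ^ 'n. indicator (cball 0 1) \<xi> * ennreal (weight \<sigma> \<xi> * (norm (kernel0 \<mu> t \<xi>))\<^sup>2)"
  let ?B = "\<lambda>\<xi> :: real ^ 'n. indicator (cball 0 \<delta>) \<xi> * ennreal (weight \<sigma> \<xi> * (norm (kernel1 \<mu> t \<xi>))\<^sup>2)"
  let ?v = "\<lambda>\<xi>. kernel0 \<mu> t \<xi> * F0 \<xi> + kernel1 \<mu> t \<xi> * F1 \<xi>"
  let ?I = "\<lambda>\<xi>. ennreal (weight \<sigma> \<xi> * (norm (?v \<xi>))\<^sup>2)"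
  have "ennreal (P\<^sup>2 * l) = ennreal (P\<^sup>2) * ennreal l" by (simp add: ennreal_mult')
  also have "\<dots> \<le> ennreal (P\<^sup>2) * (\<integral>\<^sup>+\<xi>. ?B \<xi> \<partial>lborel)"
    by (intro mult_left_mono l) simp
  also have "\<dots> = (\<integral>\<^sup>+\<xi>. ennreal (P\<^sup>2) * ?B \<xi> \<partial>lborel)"
    by (rule nn_integral_cmult[symmetric]) measurable
  also have "\<dots> \<le> (\<integral>\<^sup>+\<xi>. 2 * ?I \<xi> + ennreal (2 * m0\<^sup>2) * ?A \<xi> \<partial>lborel)"
  proof (rule nn_integral_mono_AE, use m0 P(1) in eventually_elim)
    case (elim \<xi>)
    show ?case
    proof (cases "norm \<xi> \<le> \<delta>")
      case True
      let ?k0 = "norm (kernel0 \<mu> t \<xi>)" and ?k1 = "norm (kernel1 \<mu> t \<xi>)"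
      have "P\<^sup>2 \<le> (norm (F1 \<xi>))\<^sup>2" "(norm (F0 \<xi>))\<^sup>2 \<le> m0\<^sup>2" using elim True P(2) by (auto intro: power_mono)
      then have 1: "?k1\<^sup>2 * P\<^sup>2 \<le> ?k1\<^sup>2 * (norm (F1 \<xi>))\<^sup>2" "?k0\<^sup>2 * (norm (F0 \<xi>))\<^sup>2 \<le> ?k0\<^sup>2 * m0\<^sup>2"
        by (auto intro: mult_left_mono)
      have "?k1\<^sup>2 * (norm (F1 \<xi>))\<^sup>2 \<le> 2 * (norm (?v \<xi>))\<^sup>2 + 2 * (?k0\<^sup>2 * (norm (F0 \<xi>))\<^sup>2)"
        using norm_add_square_le[of "?v \<xi>" "- (kernel0 \<mu> t \<xi> * F0 \<xi>)"]
        by (simp add: norm_mult power_mult_distrib)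
      with 1 have "?k1\<^sup>2 * P\<^sup>2 \<le> 2 * (norm (?v \<xi>))\<^sup>2 + 2 * (?k0\<^sup>2 * m0\<^sup>2)" by linarith
      then have "weight \<sigma> \<xi> * (?k1\<^sup>2 * P\<^sup>2) \<le> weight \<sigma> \<xi> * (2 * (norm (?v \<xi>))\<^sup>2 + 2 * (?k0\<^sup>2 * m0\<^sup>2))"
        by (intro mult_left_mono) auto
      then have "P\<^sup>2 * (weight \<sigma> \<xi> * ?k1\<^sup>2) \<le> 2 * (weight \<sigma> \<xi> * (norm (?v \<xi>))\<^sup>2) + 2 * m0\<^sup>2 * (weight \<sigma> \<xi> * ?k0\<^sup>2)"
        by (simp add: algebra_simps)
      from ennreal_leI[OF this] show ?thesis
        using True \<delta> by (simp add: ennreal_mult)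
    qed simp
  qed
  also have "\<dots> = 2 * (\<integral>\<^sup>+\<xi>. ?I \<xi> \<partial>lborel) + ennreal (2 * m0\<^sup>2) * (\<integral>\<^sup>+\<xi>. ?A \<xi> \<partial>lborel)"
    by (simp add: nn_integral_add nn_integral_cmult)
  also have "\<dots> \<le> 2 * (\<integral>\<^sup>+\<xi>. ?I \<xi> \<partial>lborel) + ennreal (2 * m0\<^sup>2) * ennreal a0"
    by (intro add_mono mult_left_mono a0 order_refl) simp
  also have "ennreal (2 * m0\<^sup>2) * ennreal a0 = ennreal (2 * m0\<^sup>2 * a0)"
    using nn by (simp add: ennreal_mult)
  finally show ?thesis .
qed

text \<open>Each of the four contributions is at most a constant times r^2 times the square of the
  sum of all norms, so the total is a perfect square and can be read as a norm bound.\<close>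

lemma energy_upper:
  fixes F0 F1 :: "real ^ 'n \<Rightarrow> complex" and \<mu> \<sigma> t r :: real
  assumes \<mu>: "0 < \<mu>" "\<mu> < 1" and "0 \<le> t" "0 \<le> c" "0 \<le> r"
    and low: "low_energy \<sigma> 1 (kernel0 \<mu> t :: real ^ 'n \<Rightarrow> complex) \<le> ennreal (c * r\<^sup>2)"
      "low_energy \<sigma> 1 (kernel1 \<mu> t :: real ^ 'n \<Rightarrow> complex) \<le> ennreal (c * r\<^sup>2)"
    and E: "exp (- \<mu> * t / 2) \<le> r\<^sup>2"
    and F: "F0 \<in> borel_measurable borel" "F1 \<in> borel_measurable borel"
    and m: "AE \<xi> in lborel. norm (F0 \<xi>) \<le> m0" "AE \<xi> in lborel. norm (F1 \<xi>) \<le> m1"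
    and n: "energy \<sigma> F0 \<le> ennreal (n0\<^sup>2)" "high_energy (\<sigma> - 4) F1 \<le> ennreal (n1\<^sup>2)"
    and nn: "0 \<le> m0" "0 \<le> m1" "0 \<le> n0" "0 \<le> n1"
  shows "energy \<sigma> (multiplier \<mu> t F0 F1) \<le>
    ennreal ((sqrt (4 * c + 50 + 32 / \<mu>\<^sup>2) * r * ((n0 + m0) + (n1 + m1)))\<^sup>2)"
proof -
  define S where "S = (n0 + m0) + (n1 + m1)"
  have S: "m0\<^sup>2 \<le> S\<^sup>2" "m1\<^sup>2 \<le> S\<^sup>2" "n0\<^sup>2 \<le> S\<^sup>2" "n1\<^sup>2 \<le> S\<^sup>2"
    using nn by (auto simp: S_def intro!: power_mono)
  have "energy \<sigma> (multiplier \<mu> t F0 F1) \<le> ennreal (2 * m0\<^sup>2 * (c * r\<^sup>2) + 2 * m1\<^sup>2 * (c * r\<^sup>2) +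
      50 * exp (- \<mu> * t / 2) * n0\<^sup>2 + 32 / \<mu>\<^sup>2 * exp (- \<mu> * t / 2) * n1\<^sup>2)"
    using assms(3,4) by (intro multiplier_energy_upper \<mu> F m n low) auto
  also have "\<dots> \<le> ennreal (2 * S\<^sup>2 * (c * r\<^sup>2) + 2 * S\<^sup>2 * (c * r\<^sup>2) + 50 * r\<^sup>2 * S\<^sup>2 + 32 / \<mu>\<^sup>2 * r\<^sup>2 * S\<^sup>2)"
    using S E assms(4) by (intro ennreal_leI add_mono mult_mono order_refl) auto
  also have "\<dots> = ennreal ((sqrt (4 * c + 50 + 32 / \<mu>\<^sup>2) * r * S)\<^sup>2)"
    using assms(4) by (simp add: power_mult_distrib algebra_simps)
  finally show ?thesis unfolding S_def .
qed

text \<open>The first kernel contributes o(\<rho>^2), eventually less than half of the main term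
  \<kappa> P^2 \<rho>^2. The other half bounds twice the energy, and the square root of \<kappa> / 4
  gives the constant.\<close>

lemma energy_lower:
  fixes F0 F1 :: "real ^ 'n \<Rightarrow> complex" and \<mu> \<sigma> :: real and \<rho> :: "real \<Rightarrow> real"
  assumes \<mu>: "0 < \<mu>" "\<mu> < 1" and \<sigma>: "0 \<le> \<sigma>" and \<rho>: "eventually (\<lambda>t. 0 < \<rho> t) at_top"
    and H1: "0 < \<kappa>" "\<forall>\<delta>>0. \<exists>t0. \<forall>t\<ge>t0. ennreal (\<kappa> * (\<rho> t)\<^sup>2) \<le>
      low_energy \<sigma> \<delta> (kernel1 \<mu> t :: real ^ 'n \<Rightarrow> complex)"
    and H0: "((\<lambda>t. t powr (- (2 * \<sigma> + real CARD('n)) / 4) / (\<rho> t)\<^sup>2) \<longlongrightarrow> 0) at_top"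
    and F: "F0 \<in> borel_measurable borel" "F1 \<in> borel_measurable borel"
    and m0: "AE \<xi> in lborel. norm (F0 \<xi> :: complex) \<le> m0"
    and P: "AE \<xi> in lborel. norm \<xi> \<le> \<delta> \<longrightarrow> P \<le> norm (F1 \<xi> :: complex)" "0 < P" and \<delta>: "0 < \<delta>" "\<delta> \<le> 1"
  shows "eventually (\<lambda>t. 0 < \<rho> t \<and> ennreal ((sqrt \<kappa> / 2 * \<rho> t * P)\<^sup>2) \<le>
    energy \<sigma> (multiplier \<mu> t F0 F1)) at_top"
proof -
  obtain C0 where C0: "0 \<le> C0" "\<forall>t>0. low_energy \<sigma> 1 (kernel0 \<mu> t :: real ^ 'n \<Rightarrow> complex) \<le>
      ennreal (C0 * t powr (- (2 * \<sigma> + real CARD('n)) / 4))"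
    using kernel0_low_frequency_upper[OF \<mu> \<sigma>] by (elim exE conjE)
  define c where "c = 2 * m0\<^sup>2 * C0"
  have "((\<lambda>t. c * (t powr (- (2 * \<sigma> + real CARD('n)) / 4) / (\<rho> t)\<^sup>2)) \<longlongrightarrow> c * 0) at_top"
    by (intro tendsto_intros H0)
  then have small: "eventually (\<lambda>t. c * (t powr (- (2 * \<sigma> + real CARD('n)) / 4) / (\<rho> t)\<^sup>2) < \<kappa> * P\<^sup>2 / 2) at_top"
    using H1(1) P(2) by (intro order_tendstoD(2)[of _ 0]) auto
  have "eventually (\<lambda>t. ennreal (\<kappa> * (\<rho> t)\<^sup>2) \<le>
      low_energy \<sigma> \<delta> (kernel1 \<mu> t :: real ^ 'n \<Rightarrow> complex)) at_top"
    unfolding eventually_at_top_linorder using \<delta>(1) by (rule H1(2)[rule_format])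
  with small \<rho> eventually_gt_at_top[of 0] show ?thesis
  proof eventually_elim
    case (elim t)
    let ?I = "energy \<sigma> (multiplier \<mu> t F0 F1)"
    define q where "q = t powr (- (2 * \<sigma> + real CARD('n)) / 4)"
    have "ennreal (P\<^sup>2 * (\<kappa> * (\<rho> t)\<^sup>2)) \<le> 2 * ?I + ennreal (2 * m0\<^sup>2 * (C0 * q))"
      using C0 elim P(2) unfolding q_def
      by (intro multiplier_energy_lower[OF F m0 P(1) _ \<delta>(2)]) auto
    then have le: "ennreal (P\<^sup>2 * (\<kappa> * (\<rho> t)\<^sup>2)) \<le> 2 * ?I + ennreal (c * q)"
      by (simp only: c_def mult.assoc)
    have "c * q / (\<rho> t)\<^sup>2 < \<kappa> * P\<^sup>2 / 2" using elim(1) by (simp add: q_def)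
    then have cq: "c * q < \<kappa> * P\<^sup>2 / 2 * (\<rho> t)\<^sup>2" using elim(2) by (simp add: divide_less_eq)
    have "0 \<le> c * q" using C0(1) by (simp add: c_def q_def)
    have "ennreal ((sqrt \<kappa> / 2 * \<rho> t * P)\<^sup>2) \<le> ?I"
    \<comment> \<open>An infinite energy satisfies the bound trivially; otherwise the inequality is
      one between reals.\<close>
    proof (cases ?I)
      case (real i)
      then have "ennreal (P\<^sup>2 * (\<kappa> * (\<rho> t)\<^sup>2)) \<le> ennreal (2 * i + c * q)"
        using le \<open>0 \<le> c * q\<close> by (simp add: two_mult_ennreal)
      then have "P\<^sup>2 * (\<kappa> * (\<rho> t)\<^sup>2) \<le> 2 * i + c * q"
        using real \<open>0 \<le> c * q\<close> by (subst (asm) ennreal_le_iff) auto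
      with cq have "\<kappa> / 4 * (\<rho> t)\<^sup>2 * P\<^sup>2 \<le> i" by (simp add: algebra_simps)
      then have "(sqrt \<kappa> / 2 * \<rho> t * P)\<^sup>2 \<le> i"
        using H1(1) by (simp add: power_mult_distrib power_divide)
      then show ?thesis using real by (simp add: ennreal_leI)
    qed simp
    with elim(2) show ?case by simp
  qed
qed

section \<open>Norms and transforms of the data\<close>

lemma L2_norm_nonneg [simp]: "0 \<le> L2_norm f"
  by (simp add: L2_norm_def)

lemma nn_integral_L2_norm:
  assumes "f \<in> L2"
  shows "sq_norm_integral f = ennreal ((L2_norm f)\<^sup>2)"
  using L2D(2)[OF assms] by (simp add: L2_norm_def nn_integral_eq_integral)

text \<open>A diverging integral makes \<open>L2_norm\<close> zero, so a bound on the norm alone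
  carries no information. The hypothesis is therefore a nonnegative integral, and membership is part
  of the conclusion.\<close>

lemma L2_norm_leI:
  assumes "f \<in> borel_measurable borel" and "0 \<le> B"
    and le: "sq_norm_integral f \<le> ennreal (B\<^sup>2)"
  shows "f \<in> L2" "L2_norm f \<le> B"
proof -
  show f: "f \<in> L2"
    using assms(1) le_less_trans[OF le] by (intro L2I) auto
  have "(L2_norm f)\<^sup>2 \<le> B\<^sup>2"
    using le unfolding nn_integral_L2_norm[OF f] by (simp add: ennreal_le_iff)
  then show "L2_norm f \<le> B"
    using \<open>0 \<le> B\<close> by (rule power2_le_imp_le)
qed

lemma L2_norm_geI:
  assumes "f \<in> L2" and le: "ennreal (B\<^sup>2) \<le> sq_norm_integral f"
  shows "B \<le> L2_norm f"
proof -
  have "B\<^sup>2 \<le> (L2_norm f)\<^sup>2"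
    using le unfolding nn_integral_L2_norm[OF assms(1)] by (simp add: ennreal_le_iff)
  then show ?thesis
    by (rule power2_le_imp_le) simp
qed

lemma L1_norm_nonneg [simp]: "0 \<le> L1_norm f"
  by (simp add: L1_norm_def)

lemma L2_norm_fourier:
  assumes "f \<in> L2"
  shows "L2_norm (fourier f) = L2_norm f"
proof -
  have "ennreal ((L2_norm (fourier f))\<^sup>2) = ennreal ((L2_norm f)\<^sup>2)"
    using plancherel[OF assms] nn_integral_L2_norm[OF assms] nn_integral_L2_norm[OF fourier_in_L2[OF assms]]
    by simp
  then show ?thesis by simp
qed

lemma fourier_AE_le_L1_norm:
  fixes f :: "real ^ 'n \<Rightarrow> real"
  assumes "f \<in> L2" "f \<in> L1"
  shows "AE \<xi> in lborel. norm (fourier f \<xi>) \<le> L1_norm f"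
proof -
  have "1 \<le> sqrt (2 * pi)" using pi_gt3 by simp
  then have "1 \<le> sqrt (2 * pi) ^ CARD('n)" by (rule one_le_power)
  then have "L1_norm f / sqrt (2 * pi) ^ CARD('n) \<le> L1_norm f / 1"
    by (intro divide_left_mono) auto
  then have "norm (fourier_integral f \<xi>) \<le> L1_norm f" for \<xi>
    using fourier_integral_norm_le[of f \<xi>] by (simp add: L1_norm_def)
  then show ?thesis
    using fourier_AE_eq_fourier_integral[of f] assms by (auto simp: L1_def)
qed

lemma isCont_fourier_integral:
  fixes f :: "real ^ 'n \<Rightarrow> real"
  assumes f: "integrable lborel f"
  shows "isCont (fourier_integral f) \<xi>"
  unfolding continuous_at_sequentially
proof (intro allI impI)
  fix X :: "nat \<Rightarrow> real ^ 'n" assume X: "X \<longlonglongrightarrow> \<xi>"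
  have [measurable]: "f \<in> borel_measurable borel" using f by auto
  have "(\<lambda>n. LINT x|lborel. f x *\<^sub>R cis (- (x \<bullet> X n))) \<longlonglongrightarrow> (LINT x|lborel. f x *\<^sub>R cis (- (x \<bullet> \<xi>)))"
  proof (rule integral_dominated_convergence[where w="\<lambda>x. norm (f x)"])
    have "(\<lambda>n. f x *\<^sub>R cis (- (x \<bullet> X n))) \<longlonglongrightarrow> f x *\<^sub>R cis (- (x \<bullet> \<xi>))" for x
      unfolding cis_conv_exp by (intro tendsto_intros X)
    then show "AE x in lborel. (\<lambda>n. f x *\<^sub>R cis (- (x \<bullet> X n))) \<longlonglongrightarrow> f x *\<^sub>R cis (- (x \<bullet> \<xi>))"
      by simp
  qed (use f in auto)
  then show "(fourier_integral f \<circ> X) \<longlonglongrightarrow> fourier_integral f \<xi>"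
    unfolding fourier_integral_def o_def by (intro tendsto_intros)
qed

lemma fourier_lower_near_zero:
  fixes f :: "real ^ 'n \<Rightarrow> real"
  assumes f: "f \<in> L2" "f \<in> L1" and "mass f \<noteq> 0"
  shows "\<exists>\<delta>. 0 < \<delta> \<and> \<delta> \<le> 1 \<and>
    (AE \<xi> in lborel. norm \<xi> \<le> \<delta> \<longrightarrow> \<bar>mass f\<bar> / (2 * sqrt (2 * pi) ^ CARD('n)) \<le> norm (fourier f \<xi>))"
proof -
  \<comment> \<open>Half of the modulus of the transform at the origin; continuity keeps the
    transform above it nearby.\<close>
  define P where "P = \<bar>mass f\<bar> / (2 * sqrt (2 * pi) ^ CARD('n))"
  have "0 < P" using assms(3) by (simp add: P_def)
  have f1: "integrable lborel f" using f by (simp add: L1_def)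
  have "fourier_integral f 0 = of_real (mass f / sqrt (2 * pi) ^ CARD('n))"
    by (simp add: fourier_integral_def mass_def scaleR_conv_of_real divide_inverse mult.commute)
  then have z: "norm (fourier_integral f 0) = 2 * P"
    by (simp add: P_def norm_divide norm_power)
  obtain d where d: "0 < d" "\<And>\<xi>. dist \<xi> 0 < d \<Longrightarrow> dist (fourier_integral f \<xi>) (fourier_integral f 0) < P"
    using isCont_fourier_integral[OF f1, of 0] \<open>0 < P\<close> unfolding continuous_at_eps_delta by blast
  have *: "P \<le> norm (fourier_integral f \<xi>)" if "norm \<xi> < d" for \<xi>
  proof -
    have "norm (fourier_integral f \<xi> - fourier_integral f 0) < P"
      using d(2)[of \<xi>] that by (simp add: dist_norm)
    then show ?thesis
      using norm_triangle_ineq2[of "fourier_integral f 0" "fourier_integral f \<xi>"] z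
      by (simp add: norm_minus_commute)
  qed
  \<comment> \<open>Halving \<open>d\<close> turns the open ball of continuity into a closed one,
    and the cap 1 keeps it in the low frequency region.\<close>
  have "AE \<xi> in lborel. norm \<xi> \<le> min 1 (d / 2) \<longrightarrow> P \<le> norm (fourier f \<xi>)"
    using fourier_AE_eq_fourier_integral[OF f(1) f1]
  proof eventually_elim
    case (elim \<xi>)
    then show ?case using *[of \<xi>] d(1) by auto
  qed
  then show ?thesis
    using d(1) unfolding P_def by (intro exI[of _ "min 1 (d / 2)"]) auto
qed

lemma sobolev_norm_weight:
  assumes "f \<in> sobolev \<sigma>"
  shows "(\<integral>\<^sup>+\<xi>. ennreal ((sqrt (1 + (norm \<xi>)\<^sup>2) powr \<sigma>)\<^sup>2 * (norm (fourier f \<xi>))\<^sup>2) \<partial>lborel) = ennreal ((sobolev_norm \<sigma> f)\<^sup>2)"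
  using nn_integral_L2_norm[of "\<lambda>\<xi>. (sqrt (1 + (norm \<xi>)\<^sup>2) powr \<sigma>) *\<^sub>R fourier f \<xi>"] assms
  by (simp add: sobolev_def sobolev_norm_def power_mult_distrib)

lemma weight_zero: "AE \<xi> in lborel. weight 0 \<xi> = 1"
  using AE_lborel_singleton[of 0] by eventually_elim simp

lemma nn_integral_weight_zero:
  "(\<integral>\<^sup>+\<xi>. ennreal (weight 0 \<xi> * (norm (g \<xi>))\<^sup>2) \<partial>lborel) = sq_norm_integral g"
  by (rule nn_integral_cong_AE) (use weight_zero in eventually_elim, simp)

lemma weight_le_sobolev_weight:
  fixes \<xi> :: "real ^ 'n"
  assumes "0 \<le> \<sigma>"
  shows "weight \<sigma> \<xi> \<le> (sqrt (1 + (norm \<xi>)\<^sup>2) powr \<sigma>)\<^sup>2"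
proof -
  have "norm \<xi> \<le> sqrt (1 + (norm \<xi>)\<^sup>2)" by (rule real_le_rsqrt) simp
  then show ?thesis using assms by (intro power_mono powr_mono2) auto
qed

text \<open>Above frequency 1, raising a negative exponent to 0 only increases the weight. This is
  what makes the positive part of s - 3 the right order for \<open>v1\<close>.\<close>

lemma weight_le_sobolev_weight_high:
  fixes \<xi> :: "real ^ 'n"
  assumes "1 \<le> norm \<xi>"
  shows "weight \<sigma> \<xi> \<le> (sqrt (1 + (norm \<xi>)\<^sup>2) powr max \<sigma> 0)\<^sup>2"
proof -
  have "norm \<xi> powr \<sigma> \<le> norm \<xi> powr max \<sigma> 0" using assms by (intro powr_mono) auto
  then have "weight \<sigma> \<xi> \<le> weight (max \<sigma> 0) \<xi>" by (intro power_mono) auto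
  also have "\<dots> \<le> (sqrt (1 + (norm \<xi>)\<^sup>2) powr max \<sigma> 0)\<^sup>2"
    by (rule weight_le_sobolev_weight) simp
  finally show ?thesis .
qed

section \<open>Transfer to the solution and comparison of rates\<close>

lemma boussinesq_energy:
  assumes "boussinesq_solution \<mu> v0 v1 v" "0 \<le> t"
  shows "v t \<in> L2"
    "energy \<sigma> (fourier (v t)) =
      energy \<sigma> (multiplier \<mu> t (fourier v0) (fourier v1))"
proof -
  show "v t \<in> L2" using assms by (simp add: boussinesq_solution_def)
  have "AE \<xi> in lborel. fourier (v t) \<xi> = kernel0 \<mu> t \<xi> * fourier v0 \<xi> + kernel1 \<mu> t \<xi> * fourier v1 \<xi>"
    using assms by (simp add: boussinesq_solution_def)
  then show "energy \<sigma> (fourier (v t)) =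
      energy \<sigma> (multiplier \<mu> t (fourier v0) (fourier v1))"
    by (intro nn_integral_cong_AE) (auto elim: eventually_mono)
qed

text \<open>What the energy estimates ask of a rate: it is eventually positive, the first kernel is
  negligible against it, and so is the exponentially small high frequency part.\<close>

lemma decay_rate:
  fixes \<mu> :: real
  assumes "0 < \<mu>" and "1 \<le> n"
  shows "eventually (\<lambda>t. 0 < decay n t) at_top"
    "((\<lambda>t. t powr (- (2 * 0 + real n) / 4) / (decay n t)\<^sup>2) \<longlongrightarrow> 0) at_top"
    "eventually (\<lambda>t. exp (- \<mu> * t / 2) \<le> (decay n t)\<^sup>2) at_top"
proof -
  consider "n = 1" | "n = 2" | "3 \<le> n" using assms(2) by linarith
  then have "eventually (\<lambda>t. 0 < decay n t) at_top \<and>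
    ((\<lambda>t. t powr (- (2 * 0 + real n) / 4) / (decay n t)\<^sup>2) \<longlongrightarrow> 0) at_top \<and>
    eventually (\<lambda>t. exp (- \<mu> * t / 2) \<le> (decay n t)\<^sup>2) at_top"
  proof cases
    case 1
    have "eventually (\<lambda>t. 0 < sqrt t) at_top" "((\<lambda>t. t powr (- (2 * 0 + 1) / 4) / (sqrt t)\<^sup>2) \<longlongrightarrow> 0) at_top"
      "eventually (\<lambda>t. exp (- \<mu> * t / 2) \<le> (sqrt t)\<^sup>2) at_top"
      using assms(1) by real_asymp+
    then show ?thesis by (simp add: 1 decay_def)
  next
    case 2
    have "eventually (\<lambda>t::real. 0 < sqrt (ln t)) at_top" "((\<lambda>t::real. t powr (- (2 * 0 + 2) / 4) / (sqrt (ln t))\<^sup>2) \<longlongrightarrow> 0) at_top"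
      "eventually (\<lambda>t. exp (- \<mu> * t / 2) \<le> (sqrt (ln t))\<^sup>2) at_top"
      using assms(1) by real_asymp+
    then show ?thesis by (simp add: 2 decay_def)
  next
    case 3
    \<comment> \<open>The rate of the first kernel is t^(-1/2) times the square of this one, so the
      quotient tends to 0 for any value of \<open>a\<close>.\<close>
    define a where "a = - (real n - 2) / 8"
    have "eventually (\<lambda>t::real. 0 < t powr a) at_top" "((\<lambda>t::real. t powr (2 * a - 1 / 2) / (t powr a)\<^sup>2) \<longlongrightarrow> 0) at_top"
      "eventually (\<lambda>t. exp (- \<mu> * t / 2) \<le> (t powr a)\<^sup>2) at_top"
      using assms(1) by real_asymp+
    moreover have "2 * a - 1 / 2 = - (2 * 0 + real n) / 4" by (simp add: a_def field_simps)
    moreover have "decay n = (\<lambda>t. t powr a)" using 3 by (auto simp: decay_def a_def)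
    ultimately show ?thesis by simp
  qed
  then show "eventually (\<lambda>t. 0 < decay n t) at_top"
    "((\<lambda>t. t powr (- (2 * 0 + real n) / 4) / (decay n t)\<^sup>2) \<longlongrightarrow> 0) at_top"
    "eventually (\<lambda>t. exp (- \<mu> * t / 2) \<le> (decay n t)\<^sup>2) at_top"
    by auto
qed

lemma power_rate:
  fixes \<mu> s :: real
  assumes "0 < \<mu>"
  shows "eventually (\<lambda>t. 0 < t powr (- (2 * s + real n) / 8)) at_top"
    "((\<lambda>t. t powr (- (2 * (s + 1) + real n) / 4) / (t powr (- (2 * s + real n) / 8))\<^sup>2) \<longlongrightarrow> 0) at_top"
    "eventually (\<lambda>t. exp (- \<mu> * t / 2) \<le> (t powr (- (2 * s + real n) / 8))\<^sup>2) at_top"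
proof -
  define a where "a = - (2 * s + real n) / 8"
  have "eventually (\<lambda>t::real. 0 < t powr a) at_top" "((\<lambda>t::real. t powr (2 * a - 1 / 2) / (t powr a)\<^sup>2) \<longlongrightarrow> 0) at_top"
    "eventually (\<lambda>t. exp (- \<mu> * t / 2) \<le> (t powr a)\<^sup>2) at_top"
    using assms by real_asymp+
  moreover have e: "2 * a - 1 / 2 = - (2 * (s + 1) + real n) / 4" by (simp add: a_def field_simps)
  ultimately show "eventually (\<lambda>t. 0 < t powr (- (2 * s + real n) / 8)) at_top"
    "((\<lambda>t. t powr (- (2 * (s + 1) + real n) / 4) / (t powr (- (2 * s + real n) / 8))\<^sup>2) \<longlongrightarrow> 0) at_top"
    "eventually (\<lambda>t. exp (- \<mu> * t / 2) \<le> (t powr (- (2 * s + real n) / 8))\<^sup>2) at_top"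
    unfolding a_def[symmetric] e[symmetric] by blast+
qed

lemma eventually_le_of_quotient_tendsto_0:
  fixes f g :: "real \<Rightarrow> real"
  assumes "((\<lambda>t. f t / (g t)\<^sup>2) \<longlongrightarrow> 0) at_top" "eventually (\<lambda>t. 0 < g t) at_top"
  shows "eventually (\<lambda>t. f t \<le> (g t)\<^sup>2) at_top"
proof -
  have "eventually (\<lambda>t. f t / (g t)\<^sup>2 < 1) at_top"
    using assms(1) by (rule order_tendstoD) simp
  with assms(2) show ?thesis
    by eventually_elim (simp add: divide_less_eq)
qed

lemma eventually_low_energy_le:
  fixes \<mu> \<sigma> :: real
  assumes \<mu>: "0 < \<mu>" "\<mu> < 1" and \<sigma>: "0 \<le> \<sigma>" and \<rho>: "eventually (\<lambda>t. 0 < \<rho> t) at_top"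
    and q: "((\<lambda>t. t powr (- (2 * \<sigma> + real CARD('n)) / 4) / (\<rho> t)\<^sup>2) \<longlongrightarrow> 0) at_top"
    and C1: "\<exists>C\<ge>0. eventually (\<lambda>t. low_energy \<sigma> 1 (kernel1 \<mu> t :: real ^ 'n \<Rightarrow> complex) \<le> ennreal (C * (\<rho> t)\<^sup>2)) at_top"
  shows "\<exists>c\<ge>0. eventually (\<lambda>t. low_energy \<sigma> 1 (kernel0 \<mu> t :: real ^ 'n \<Rightarrow> complex) \<le> ennreal (c * (\<rho> t)\<^sup>2) \<and>
    low_energy \<sigma> 1 (kernel1 \<mu> t :: real ^ 'n \<Rightarrow> complex) \<le> ennreal (c * (\<rho> t)\<^sup>2)) at_top"
proof -
  obtain C0 where C0: "0 \<le> C0" "\<forall>t>0. low_energy \<sigma> 1 (kernel0 \<mu> t :: real ^ 'n \<Rightarrow> complex) \<le>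
      ennreal (C0 * t powr (- (2 * \<sigma> + real CARD('n)) / 4))"
    using kernel0_low_frequency_upper[OF \<mu> \<sigma>] by (elim exE conjE)
  obtain C1 where C1: "0 \<le> C1"
    "eventually (\<lambda>t. low_energy \<sigma> 1 (kernel1 \<mu> t :: real ^ 'n \<Rightarrow> complex) \<le> ennreal (C1 * (\<rho> t)\<^sup>2)) at_top"
    using C1 by (elim exE conjE)
  show ?thesis
  proof (rule exI[of _ "C0 + C1"], rule conjI)
    show "0 \<le> C0 + C1" using C0 C1 by simp
    show "eventually (\<lambda>t. low_energy \<sigma> 1 (kernel0 \<mu> t :: real ^ 'n \<Rightarrow> complex) \<le> ennreal ((C0 + C1) * (\<rho> t)\<^sup>2) \<and>
      low_energy \<sigma> 1 (kernel1 \<mu> t :: real ^ 'n \<Rightarrow> complex) \<le> ennreal ((C0 + C1) * (\<rho> t)\<^sup>2)) at_top"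
      using C1(2) eventually_le_of_quotient_tendsto_0[OF q \<rho>] eventually_gt_at_top[of 0]
    proof eventually_elim
      case (elim t)
      have "C0 * t powr (- (2 * \<sigma> + real CARD('n)) / 4) \<le> (C0 + C1) * (\<rho> t)\<^sup>2"
        using elim(2) C0(1) C1(1) by (intro mult_mono) auto
      moreover have "C1 * (\<rho> t)\<^sup>2 \<le> (C0 + C1) * (\<rho> t)\<^sup>2"
        using C0(1) by (intro mult_right_mono) auto
      ultimately show ?case
        using elim(1) C0(2)[rule_format, OF elim(3)] by (auto intro: order_trans ennreal_leI)
    qed
  qed
qed

lemma solution_L2_upper:
  fixes v0 v1 :: "real ^ 'n \<Rightarrow> real" and \<mu> t r :: real
  assumes \<mu>: "0 < \<mu>" "\<mu> < 1" and t: "0 \<le> t" "0 \<le> c" "0 \<le> r"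
    and low: "low_energy 0 1 (kernel0 \<mu> t :: real ^ 'n \<Rightarrow> complex) \<le> ennreal (c * r\<^sup>2)"
      "low_energy 0 1 (kernel1 \<mu> t :: real ^ 'n \<Rightarrow> complex) \<le> ennreal (c * r\<^sup>2)"
    and E: "exp (- \<mu> * t / 2) \<le> r\<^sup>2"
    and v0: "v0 \<in> L2" "v0 \<in> L1" and v1: "v1 \<in> L2" "v1 \<in> L1" and v: "boussinesq_solution \<mu> v0 v1 v"
  shows "L2_norm (v t) \<le> sqrt (4 * c + 50 + 32 / \<mu>\<^sup>2) * r * ((L2_norm v0 + L1_norm v0) + (L2_norm v1 + L1_norm v1))"
    (is "_ \<le> ?B")
proof -
  note f = fourier_in_L2[OF v0(1)] fourier_in_L2[OF v1(1)]
  have vt: "v t \<in> L2" by (rule boussinesq_energy(1)[OF v t(1)])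
  have "energy 0 (fourier v0) \<le> ennreal ((L2_norm v0)\<^sup>2)"
    unfolding nn_integral_weight_zero using v0 f by (simp add: nn_integral_L2_norm L2_norm_fourier)
  \<comment> \<open>The plain L2 norm of \<open>v1\<close> suffices, as the negative weight is at
    most 1 above frequency 1.\<close>
  moreover have "high_energy (0 - 4) (fourier v1) \<le> sq_norm_integral (fourier v1)"
  proof (rule nn_integral_mono)
    fix \<xi> :: "real ^ 'n"
    show "indicator (- ball 0 1) \<xi> * ennreal (weight (0 - 4) \<xi> * (norm (fourier v1 \<xi>))\<^sup>2) \<le> ennreal ((norm (fourier v1 \<xi>))\<^sup>2)"
    proof (cases "1 \<le> norm \<xi>")
      case True
      then have "weight (0 - 4) \<xi> * (norm (fourier v1 \<xi>))\<^sup>2 \<le> 1 * (norm (fourier v1 \<xi>))\<^sup>2"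
        using powr_mono[of "0 - 4" 0 "norm \<xi>"]
        by (intro mult_right_mono power_le_one) (auto split: if_splits)
      from ennreal_leI[OF this] True show ?thesis by (simp add: indicator_def)
    qed simp
  qed
  then have "high_energy (0 - 4) (fourier v1) \<le> ennreal ((L2_norm v1)\<^sup>2)"
    using v1 f by (simp add: nn_integral_L2_norm L2_norm_fourier)
  ultimately have "energy 0 (multiplier \<mu> t (fourier v0) (fourier v1)) \<le> ennreal (?B\<^sup>2)"
    by (intro energy_upper \<mu> t low E fourier_AE_le_L1_norm L2D(1) f v0 v1) simp_all
  then have "sq_norm_integral (fourier (v t)) \<le> ennreal (?B\<^sup>2)"
    unfolding boussinesq_energy(2)[OF v t(1), symmetric] nn_integral_weight_zero .
  then have "L2_norm (fourier (v t)) \<le> ?B"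
    using t by (intro L2_norm_leI(2) L2D(1) fourier_in_L2 vt mult_nonneg_nonneg add_nonneg_nonneg) auto
  then show ?thesis using L2_norm_fourier[OF vt] by simp
qed

lemma solution_hom_sobolev_upper:
  fixes v0 v1 :: "real ^ 'n \<Rightarrow> real" and \<mu> s t r :: real
  assumes \<mu>: "0 < \<mu>" "\<mu> < 1" and s: "0 \<le> s" and t: "0 \<le> t" "0 \<le> c" "0 \<le> r"
    and low: "low_energy (s + 1) 1 (kernel0 \<mu> t :: real ^ 'n \<Rightarrow> complex) \<le> ennreal (c * r\<^sup>2)"
      "low_energy (s + 1) 1 (kernel1 \<mu> t :: real ^ 'n \<Rightarrow> complex) \<le> ennreal (c * r\<^sup>2)"
    and E: "exp (- \<mu> * t / 2) \<le> r\<^sup>2"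
    and v0: "v0 \<in> sobolev (s + 1)" "v0 \<in> L1" and v1: "v1 \<in> sobolev (max (s - 3) 0)" "v1 \<in> L1"
    and v: "boussinesq_solution \<mu> v0 v1 v"
  shows "v t \<in> hom_sobolev (s + 1)" (is ?hom)
    and "hom_sobolev_norm (s + 1) (v t) \<le> sqrt (4 * c + 50 + 32 / \<mu>\<^sup>2) * r *
      ((sobolev_norm (s + 1) v0 + L1_norm v0) + (sobolev_norm (max (s - 3) 0) v1 + L1_norm v1))" (is "_ \<le> ?B")
proof -
  have L2: "v0 \<in> L2" "v1 \<in> L2" using v0 v1 by (auto simp: sobolev_def)
  note f = fourier_in_L2[OF L2(1)] fourier_in_L2[OF L2(2)]
  have vt: "v t \<in> L2" by (rule boussinesq_energy(1)[OF v t(1)])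
  have [measurable]: "fourier (v t) \<in> borel_measurable borel" using fourier_in_L2[OF vt] by (rule L2D)
  have "energy (s + 1) (fourier v0) \<le> ennreal ((sobolev_norm (s + 1) v0)\<^sup>2)"
    unfolding sobolev_norm_weight[OF v0(1), symmetric] using s
    by (intro nn_integral_mono ennreal_leI mult_right_mono weight_le_sobolev_weight) auto
  moreover have "high_energy (s + 1 - 4) (fourier v1) \<le> ennreal ((sobolev_norm (max (s - 3) 0) v1)\<^sup>2)"
    unfolding sobolev_norm_weight[OF v1(1), symmetric]
  proof (rule nn_integral_mono)
    fix \<xi> :: "real ^ 'n"
    have s4: "s + 1 - 4 = s - 3" by simp
    show "indicator (- ball 0 1) \<xi> * ennreal (weight (s + 1 - 4) \<xi> * (norm (fourier v1 \<xi>))\<^sup>2) \<le>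
        ennreal ((sqrt (1 + (norm \<xi>)\<^sup>2) powr (max (s - 3) 0))\<^sup>2 * (norm (fourier v1 \<xi>))\<^sup>2)"
    proof (cases "1 \<le> norm \<xi>")
      case True
      then show ?thesis
        unfolding s4 using mult_right_mono[OF weight_le_sobolev_weight_high[OF True]]
        by (simp add: indicator_def ennreal_leI)
    qed simp
  qed
  ultimately have "energy (s + 1) (multiplier \<mu> t (fourier v0) (fourier v1)) \<le> ennreal (?B\<^sup>2)"
    by (intro energy_upper \<mu> t low E fourier_AE_le_L1_norm L2D(1) f L2 v0(2) v1(2))
      (simp_all add: sobolev_norm_def)
  then have le: "sq_norm_integral (\<lambda>\<xi>. (norm \<xi> powr (s + 1)) *\<^sub>R fourier (v t) \<xi>) \<le> ennreal (?B\<^sup>2)"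
    unfolding boussinesq_energy(2)[OF v t(1), symmetric] by (simp add: power_mult_distrib)
  have B: "0 \<le> ?B"
    using t by (intro mult_nonneg_nonneg add_nonneg_nonneg) (auto simp: sobolev_norm_def)
  have m: "(\<lambda>\<xi>. (norm \<xi> powr (s + 1)) *\<^sub>R fourier (v t) \<xi>) \<in> borel_measurable borel" by measurable
  show ?hom "hom_sobolev_norm (s + 1) (v t) \<le> ?B"
    using L2_norm_leI[OF m B le] vt by (simp_all add: hom_sobolev_def hom_sobolev_norm_def)
qed

lemma solution_energy_lower:
  fixes \<mu> \<sigma> :: real and v0 v1 :: "real ^ 'n \<Rightarrow> real"
  assumes \<mu>: "0 < \<mu>" "\<mu> < 1" and \<sigma>: "0 \<le> \<sigma>" and \<rho>: "eventually (\<lambda>t. 0 < \<rho> t) at_top"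
    and \<kappa>: "0 < \<kappa>" "\<forall>\<delta>>0. \<exists>t0. \<forall>t\<ge>t0. ennreal (\<kappa> * (\<rho> t)\<^sup>2) \<le>
      low_energy \<sigma> \<delta> (kernel1 \<mu> t :: real ^ 'n \<Rightarrow> complex)"
    and q: "((\<lambda>t. t powr (- (2 * \<sigma> + real CARD('n)) / 4) / (\<rho> t)\<^sup>2) \<longlongrightarrow> 0) at_top"
    and v0: "v0 \<in> L2" "v0 \<in> L1" and v1: "v1 \<in> L2" "v1 \<in> L1" and mass: "mass v1 \<noteq> 0"
    and v: "boussinesq_solution \<mu> v0 v1 v"
  shows "eventually (\<lambda>t. v t \<in> L2 \<and>
    ennreal ((sqrt \<kappa> / (4 * sqrt (2 * pi) ^ CARD('n)) * (\<rho> t * \<bar>mass v1\<bar>))\<^sup>2) \<le>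
      energy \<sigma> (fourier (v t))) at_top"
proof -
  define P where "P = \<bar>mass v1\<bar> / (2 * sqrt (2 * pi) ^ CARD('n))"
  obtain \<delta> where \<delta>: "0 < \<delta>" "\<delta> \<le> 1"
    "AE \<xi> in lborel. norm \<xi> \<le> \<delta> \<longrightarrow> P \<le> norm (fourier v1 \<xi>)"
    using fourier_lower_near_zero[OF v1 mass] unfolding P_def by (elim exE conjE)
  have "0 < P" using mass by (simp add: P_def)
  from energy_lower[OF \<mu> \<sigma> \<rho> \<kappa> q L2D(1)[OF fourier_in_L2[OF v0(1)]] L2D(1)[OF fourier_in_L2[OF v1(1)]]
      fourier_AE_le_L1_norm[OF v0] \<delta>(3) this \<delta>(1,2)] eventually_ge_at_top[of 0]
  show ?thesis
  proof eventually_elim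
    case (elim t)
    \<comment> \<open>One factor 2 comes from absorbing the first kernel, the other from halving the
      transform at the origin.\<close>
    have "sqrt \<kappa> / 2 * \<rho> t * P = sqrt \<kappa> / (4 * sqrt (2 * pi) ^ CARD('n)) * (\<rho> t * \<bar>mass v1\<bar>)"
      by (simp add: P_def)
    with elim boussinesq_energy[OF v elim(2)] show ?case by simp
  qed
qed

lemma solution_L2_lower:
  fixes v0 v1 :: "real ^ 'n \<Rightarrow> real" and \<mu> :: real
  assumes \<mu>: "0 < \<mu>" "\<mu> < 1" and \<rho>: "eventually (\<lambda>t. 0 < \<rho> t) at_top"
    and \<kappa>: "0 < \<kappa>" "\<forall>\<delta>>0. \<exists>t0. \<forall>t\<ge>t0. ennreal (\<kappa> * (\<rho> t)\<^sup>2) \<le> low_energy 0 \<delta> (kernel1 \<mu> t :: real ^ 'n \<Rightarrow> complex)"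
    and q: "((\<lambda>t. t powr (- (2 * 0 + real CARD('n)) / 4) / (\<rho> t)\<^sup>2) \<longlongrightarrow> 0) at_top"
    and v01: "v0 \<in> L2" "v0 \<in> L1" "v1 \<in> L2" "v1 \<in> L1" and mass: "mass v1 \<noteq> 0"
    and v: "boussinesq_solution \<mu> v0 v1 v"
  shows "eventually (\<lambda>t. sqrt \<kappa> / (4 * sqrt (2 * pi) ^ CARD('n)) * (\<rho> t * \<bar>mass v1\<bar>) \<le> L2_norm (v t)) at_top"
  using solution_energy_lower[OF \<mu> order_refl \<rho> \<kappa> q v01 mass v]
proof eventually_elim
  case (elim t)
  then have "sqrt \<kappa> / (4 * sqrt (2 * pi) ^ CARD('n)) * (\<rho> t * \<bar>mass v1\<bar>) \<le> L2_norm (fourier (v t))"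
    unfolding nn_integral_weight_zero by (intro L2_norm_geI fourier_in_L2) auto
  then show ?case using L2_norm_fourier[of "v t"] elim by simp
qed

text \<open>Membership stays a premise because the norm would be zero for a diverging integral; for
  large times it is supplied by the upper estimate.\<close>

lemma solution_hom_sobolev_lower:
  fixes v0 v1 :: "real ^ 'n \<Rightarrow> real" and \<mu> \<sigma> :: real
  assumes \<mu>: "0 < \<mu>" "\<mu> < 1" and \<sigma>: "0 \<le> \<sigma>" and \<rho>: "eventually (\<lambda>t. 0 < \<rho> t) at_top"
    and \<kappa>: "0 < \<kappa>" "\<forall>\<delta>>0. \<exists>t0. \<forall>t\<ge>t0. ennreal (\<kappa> * (\<rho> t)\<^sup>2) \<le> low_energy \<sigma> \<delta> (kernel1 \<mu> t :: real ^ 'n \<Rightarrow> complex)"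
    and q: "((\<lambda>t. t powr (- (2 * \<sigma> + real CARD('n)) / 4) / (\<rho> t)\<^sup>2) \<longlongrightarrow> 0) at_top"
    and v01: "v0 \<in> L2" "v0 \<in> L1" "v1 \<in> L2" "v1 \<in> L1" and mass: "mass v1 \<noteq> 0"
    and v: "boussinesq_solution \<mu> v0 v1 v"
  shows "eventually (\<lambda>t. v t \<in> hom_sobolev \<sigma> \<longrightarrow>
    sqrt \<kappa> / (4 * sqrt (2 * pi) ^ CARD('n)) * (\<rho> t * \<bar>mass v1\<bar>) \<le> hom_sobolev_norm \<sigma> (v t)) at_top"
  using solution_energy_lower[OF \<mu> \<sigma> \<rho> \<kappa> q v01 mass v]
proof eventually_elim
  case (elim t)
  then show ?case
    unfolding hom_sobolev_norm_def
    by (intro impI L2_norm_geI) (auto simp: hom_sobolev_def power_mult_distrib)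
qed

theorem theorem3p1:
  fixes \<mu> s :: real
  assumes "0 < \<mu>" "\<mu> < 1" "0 \<le> s"
  shows "\<exists>C>0. \<exists>T. \<forall>(v0 :: real ^ 'n \<Rightarrow> real) v1 v.
    v0 \<in> sobolev (s + 1) \<inter> L1 \<longrightarrow>
    v1 \<in> sobolev (max (s - 3) 0) \<inter> L1 \<longrightarrow>
    mass v1 \<noteq> 0 \<longrightarrow>
    boussinesq_solution \<mu> v0 v1 v \<longrightarrow>
      (\<forall>t\<ge>T.
        L2_norm (v t) \<le> C * decay CARD('n) t *
          ((L2_norm v0 + L1_norm v0) + (L2_norm v1 + L1_norm v1)) \<and>
        v t \<in> hom_sobolev (s + 1) \<and>
        hom_sobolev_norm (s + 1) (v t) \<le> C * t powr (- (2 * s + real CARD('n)) / 8) *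
          ((sobolev_norm (s + 1) v0 + L1_norm v0) +
           (sobolev_norm (max (s - 3) 0) v1 + L1_norm v1))) \<and>
      (\<exists>t0. \<forall>t\<ge>t0.
        decay CARD('n) t * \<bar>mass v1\<bar> \<le> C * L2_norm (v t) \<and>
        t powr (- (2 * s + real CARD('n)) / 8) * \<bar>mass v1\<bar>
          \<le> C * hom_sobolev_norm (s + 1) (v t))"
proof -
  let ?n = "real CARD('n)"
  define d where "d = decay CARD('n)"
  define p where "p t = t powr (- (2 * s + ?n) / 8)" for t :: real
  note \<mu> = assms(1,2)
  have s1: "1 \<le> s + 1" "0 \<le> s + 1" using assms(3) by auto
  have "1 \<le> CARD('n)" by (simp add: Suc_leI)
  note d = decay_rate[OF \<mu>(1) this, folded d_def]
  note p = power_rate[OF \<mu>(1), of s "CARD('n)", folded p_def]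
  \<comment> \<open>At \<sigma> = s + 1 the energy exponent 2 \<sigma> - 2 + n equals 2 s + n, twice
    the exponent of the claimed rate.\<close>
  have p2: "t powr (- (2 * (s + 1) - 2 + ?n) / 4) = (p t)\<^sup>2" for t
    unfolding p_def powr_square by (rule arg_cong[where f="\<lambda>a. t powr a"]) (simp add: field_simps)
  have "\<exists>C\<ge>0. eventually (\<lambda>t. low_energy 0 1 (kernel1 \<mu> t :: real ^ 'n \<Rightarrow> complex) \<le> ennreal (C * (d t)\<^sup>2)) at_top"
    using kernel1_low_frequency_upper_decay[OF \<mu>, where 'n='n] unfolding eventually_at_top_linorder d_def by blast
  from eventually_low_energy_le[OF \<mu> order_refl d(1,2) this] obtain c0 where c0: "0 \<le> c0"
    "eventually (\<lambda>t. low_energy 0 1 (kernel0 \<mu> t :: real ^ 'n \<Rightarrow> complex) \<le> ennreal (c0 * (d t)\<^sup>2) \<and>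
      low_energy 0 1 (kernel1 \<mu> t :: real ^ 'n \<Rightarrow> complex) \<le> ennreal (c0 * (d t)\<^sup>2)) at_top"
    by (elim exE conjE)
  have "\<exists>C\<ge>0. eventually (\<lambda>t. low_energy (s + 1) 1 (kernel1 \<mu> t :: real ^ 'n \<Rightarrow> complex) \<le> ennreal (C * (p t)\<^sup>2)) at_top"
    using kernel1_low_frequency_upper[OF \<mu> disjI1[OF s1(1)], where 'n='n] unfolding eventually_at_top_dense p2 by blast
  from eventually_low_energy_le[OF \<mu> s1(2) p(1,2) this] obtain c1 where c1: "0 \<le> c1"
    "eventually (\<lambda>t. low_energy (s + 1) 1 (kernel0 \<mu> t :: real ^ 'n \<Rightarrow> complex) \<le> ennreal (c1 * (p t)\<^sup>2) \<and>
      low_energy (s + 1) 1 (kernel1 \<mu> t :: real ^ 'n \<Rightarrow> complex) \<le> ennreal (c1 * (p t)\<^sup>2)) at_top"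
    by (elim exE conjE)
  \<comment> \<open>Every condition concerns the kernels and the rates only, so \<open>T\<close> is
    fixed before the data, as the upper bounds demand.\<close>
  obtain T where T: "\<And>t. T \<le> t \<Longrightarrow> 0 \<le> t \<and> 0 < d t \<and> 0 < p t \<and> exp (- \<mu> * t / 2) \<le> (d t)\<^sup>2 \<and> exp (- \<mu> * t / 2) \<le> (p t)\<^sup>2 \<and>
      (low_energy 0 1 (kernel0 \<mu> t :: real ^ 'n \<Rightarrow> complex) \<le> ennreal (c0 * (d t)\<^sup>2) \<and>
        low_energy 0 1 (kernel1 \<mu> t :: real ^ 'n \<Rightarrow> complex) \<le> ennreal (c0 * (d t)\<^sup>2)) \<and>
      (low_energy (s + 1) 1 (kernel0 \<mu> t :: real ^ 'n \<Rightarrow> complex) \<le> ennreal (c1 * (p t)\<^sup>2) \<and>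
        low_energy (s + 1) 1 (kernel1 \<mu> t :: real ^ 'n \<Rightarrow> complex) \<le> ennreal (c1 * (p t)\<^sup>2))"
    using eventually_conj[OF eventually_ge_at_top[of 0] eventually_conj[OF d(1) eventually_conj[OF p(1)
      eventually_conj[OF d(3) eventually_conj[OF p(3) eventually_conj[OF c0(2) c1(2)]]]]]]
    unfolding eventually_at_top_linorder by blast
  obtain \<kappa>0 where \<kappa>0: "0 < \<kappa>0" "\<forall>\<delta>>0. \<exists>t0. \<forall>t\<ge>t0. ennreal (\<kappa>0 * (d t)\<^sup>2) \<le> low_energy 0 \<delta> (kernel1 \<mu> t :: real ^ 'n \<Rightarrow> complex)"
    using kernel1_low_frequency_lower_decay[OF \<mu>, where 'n='n, folded d_def] by (elim exE conjE)
  obtain \<kappa>1 where \<kappa>1: "0 < \<kappa>1" "\<forall>\<delta>>0. \<exists>t0. \<forall>t\<ge>t0. ennreal (\<kappa>1 * (p t)\<^sup>2) \<le> low_energy (s + 1) \<delta> (kernel1 \<mu> t :: real ^ 'n \<Rightarrow> complex)"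
    using kernel1_low_frequency_lower[OF \<mu> s1(2), where 'n='n, unfolded p2] by (elim exE conjE)
  define q where "q \<kappa> = sqrt \<kappa> / (4 * sqrt (2 * pi) ^ CARD('n))" for \<kappa>
  define K where "K c = sqrt (4 * c + 50 + 32 / \<mu>\<^sup>2)" for c
  \<comment> \<open>The two \<open>K\<close> serve the upper bounds; the reciprocals serve the lower
    bounds, where the constant stands on the side of the norm.\<close>
  define C where "C = K c0 + K c1 + 1 / q \<kappa>0 + 1 / q \<kappa>1"
  have q: "0 < q \<kappa>0" "0 < q \<kappa>1" using \<kappa>0(1) \<kappa>1(1) by (auto simp: q_def)
  have K: "0 \<le> K c0" "0 \<le> K c1" using c0(1) c1(1) by (auto simp: K_def)
  have C: "K c0 \<le> C" "K c1 \<le> C" "1 / q \<kappa>0 \<le> C" "1 / q \<kappa>1 \<le> C" "0 < C"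
    using q K by (auto simp: C_def add_nonneg_pos)
  have le_C: "x \<le> C * y" if "q' * x \<le> y" "1 / q' \<le> C" "0 < q'" "0 \<le> y" for q' x y
  proof -
    have "x \<le> 1 / q' * y" using that by (simp add: field_simps)
    also have "\<dots> \<le> C * y" using that by (intro mult_right_mono)
    finally show ?thesis .
  qed
  have sn: "0 \<le> sobolev_norm \<sigma> g" "0 \<le> hom_sobolev_norm \<sigma> g" for \<sigma> and g :: "real ^ 'n \<Rightarrow> real"
    by (simp_all add: sobolev_norm_def hom_sobolev_norm_def)
  show ?thesis
    unfolding d_def[symmetric] p_def[symmetric]
  proof (rule exI[of _ C], rule conjI, rule C(5), rule exI[of _ T], intro allI impI, rule conjI)
    fix v0 v1 :: "real ^ 'n \<Rightarrow> real" and v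
    assume "v0 \<in> sobolev (s + 1) \<inter> L1" "v1 \<in> sobolev (max (s - 3) 0) \<inter> L1"
      and mass: "mass v1 \<noteq> 0" and v: "boussinesq_solution \<mu> v0 v1 v"
    then have v01: "v0 \<in> sobolev (s + 1)" "v0 \<in> L1" "v1 \<in> sobolev (max (s - 3) 0)" "v1 \<in> L1"
      by auto
    then have L2: "v0 \<in> L2" "v1 \<in> L2" by (auto simp: sobolev_def)
    have upper: "L2_norm (v t) \<le> K c0 * d t * ((L2_norm v0 + L1_norm v0) + (L2_norm v1 + L1_norm v1)) \<and>
        v t \<in> hom_sobolev (s + 1) \<and>
        hom_sobolev_norm (s + 1) (v t) \<le> K c1 * p t *
          ((sobolev_norm (s + 1) v0 + L1_norm v0) + (sobolev_norm (max (s - 3) 0) v1 + L1_norm v1))"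
      if "T \<le> t" for t
    proof -
      have nn: "0 \<le> t" "0 \<le> d t" "0 \<le> p t" using T[OF that] by auto
      show ?thesis
        unfolding K_def
        using solution_L2_upper[OF \<mu> nn(1) c0(1) nn(2) _ _ _ L2(1) v01(2) L2(2) v01(4) v]
          solution_hom_sobolev_upper[OF \<mu> assms(3) nn(1) c1(1) nn(3) _ _ _ v01 v] T[OF that] by blast
    qed
    show "\<forall>t\<ge>T. L2_norm (v t) \<le> C * d t * ((L2_norm v0 + L1_norm v0) + (L2_norm v1 + L1_norm v1)) \<and>
        v t \<in> hom_sobolev (s + 1) \<and>
        hom_sobolev_norm (s + 1) (v t) \<le> C * p t *
          ((sobolev_norm (s + 1) v0 + L1_norm v0) + (sobolev_norm (max (s - 3) 0) v1 + L1_norm v1))"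
    proof (intro allI impI)
      fix t assume t: "T \<le> t"
      have "K c0 * d t * ((L2_norm v0 + L1_norm v0) + (L2_norm v1 + L1_norm v1)) \<le>
          C * d t * ((L2_norm v0 + L1_norm v0) + (L2_norm v1 + L1_norm v1))"
        using C(1) T[OF t] by (intro mult_right_mono add_nonneg_nonneg) auto
      moreover have "K c1 * p t * ((sobolev_norm (s + 1) v0 + L1_norm v0) + (sobolev_norm (max (s - 3) 0) v1 + L1_norm v1)) \<le>
          C * p t * ((sobolev_norm (s + 1) v0 + L1_norm v0) + (sobolev_norm (max (s - 3) 0) v1 + L1_norm v1))"
        using C(2) T[OF t] by (intro mult_right_mono add_nonneg_nonneg sn) auto
      ultimately show "L2_norm (v t) \<le> C * d t * ((L2_norm v0 + L1_norm v0) + (L2_norm v1 + L1_norm v1)) \<and>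
          v t \<in> hom_sobolev (s + 1) \<and>
          hom_sobolev_norm (s + 1) (v t) \<le> C * p t *
            ((sobolev_norm (s + 1) v0 + L1_norm v0) + (sobolev_norm (max (s - 3) 0) v1 + L1_norm v1))"
        using upper[OF t] by linarith
    qed
    \<comment> \<open>This time depends on the data. Taking it beyond \<open>T\<close> makes the
      upper estimate available, which provides the membership that the second lower bound
      presupposes.\<close>
    have "eventually (\<lambda>t. d t * \<bar>mass v1\<bar> \<le> C * L2_norm (v t) \<and> p t * \<bar>mass v1\<bar> \<le> C * hom_sobolev_norm (s + 1) (v t)) at_top"
      using solution_L2_lower[OF \<mu> d(1) \<kappa>0 d(2) L2(1) v01(2) L2(2) v01(4) mass v, folded q_def]
        solution_hom_sobolev_lower[OF \<mu> s1(2) p(1) \<kappa>1 p(2) L2(1) v01(2) L2(2) v01(4) mass v, folded q_def]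
        eventually_ge_at_top[of T]
    proof eventually_elim
      case (elim t)
      then show ?case
        using upper[of t] le_C[OF _ C(3) q(1)] le_C[OF _ C(4) q(2)] sn by simp
    qed
    then show "\<exists>t0. \<forall>t\<ge>t0. d t * \<bar>mass v1\<bar> \<le> C * L2_norm (v t) \<and> p t * \<bar>mass v1\<bar> \<le> C * hom_sobolev_norm (s + 1) (v t)"
      unfolding eventually_at_top_linorder .
  qed
qed

end
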